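(* For every $m\in\mathbb{N}$ there is a constant $C=C(m)$ depending only on $m$ such that for every closed subset $E\subset\mathbb{R}$ and every real number $p>1$ there exists a continuous linear extension operator from the trace space $L^m_p(\mathbb{R})|_E$ into $L^m_p(\mathbb{R})$ whose operator norm is at most $C$; that is, a linear map $T:L^m_p(\mathbb{R})|_E\to L^m_p(\mathbb{R})$ such that $(Tf)|_E=f$ and $\|Tf\|_{L^m_p(\mathbb{R})}\le C\,\|f\|_{L^m_p(\mathbb{R})|_E}$ for all $f\in L^m_p(\mathbb{R})|_E$.
   Context: $L^m_p(\mathbb{R})$ is the homogeneous Sobolev space of all functions $F:\mathbb{R}\to\mathbb{R}$ such that $F^{(m-1)}$ is absolutely continuous on $\mathbb{R}$ and the weak derivative $F^{(m)}$ belongs to $L_p(\mathbb{R})$, with seminorm $\|F\|_{L^m_p(\mathbb{R})}=\|F^{(m)}\|_{L_p(\mathbb{R})}$. The trace space $L^m_p(\mathbb{R})|_E$ is the space of all $f:E\to\mathbb{R}$ for which there is $F\in L^m_p(\mathbb{R})$ with $F|_E=f$, with the seminorm $\|f\|_{L^m_p(\mathbb{R})|_E}=\inf\{\|F\|_{L^m_p(\mathbb{R})}: F\in L^m_p(\mathbb{R}),\ F|_E=f\}$. *)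

theory Defs
  imports "HOL-Analysis.Analysis"
begin

definition absolutely_continuous_on :: "real set \<Rightarrow> (real \<Rightarrow> real) \<Rightarrow> bool" where
  "absolutely_continuous_on S f \<longleftrightarrow>
     (\<forall>\<epsilon>>0. \<exists>\<delta>>0. \<forall>(n::nat) a b.
        (\<forall>i<n. a i \<le> b i \<and> {a i..b i} \<subseteq> S) \<longrightarrow>
        disjoint_family_on (\<lambda>i. {a i<..<b i}) {..<n} \<longrightarrow>
        (\<Sum>i<n. b i - a i) < \<delta> \<longrightarrow>
        (\<Sum>i<n. \<bar>f (b i) - f (a i)\<bar>) < \<epsilon>)"

text \<open>Smooth, compactly supported real functions on the line.\<close>

definition test_function :: "(real \<Rightarrow> real) \<Rightarrow> bool" where
  "test_function \<phi> \<longleftrightarrow>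
     (\<forall>k. (deriv ^^ k) \<phi> differentiable_on UNIV) \<and> compact (closure {x. \<phi> x \<noteq> 0})"

definition locally_integrable :: "(real \<Rightarrow> real) \<Rightarrow> bool" where
  "locally_integrable f \<longleftrightarrow> (\<forall>a b. f absolutely_integrable_on {a..b})"

definition has_weak_derivative :: "(real \<Rightarrow> real) \<Rightarrow> (real \<Rightarrow> real) \<Rightarrow> bool" where
  "has_weak_derivative f g \<longleftrightarrow>
     locally_integrable f \<and> locally_integrable g \<and>
     (\<forall>\<phi>. test_function \<phi> \<longrightarrow>
        (LINT x|lebesgue. f x * deriv \<phi> x) = - (LINT x|lebesgue. g x * \<phi> x))"

text \<open>A weak derivative is unique up to a null set; one representative is chosen. The value is
  meaningful only if a weak derivative exists.\<close>

definition weak_deriv :: "(real \<Rightarrow> real) \<Rightarrow> (real \<Rightarrow> real)" where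
  "weak_deriv f = (SOME g. has_weak_derivative f g)"

definition Lp :: "real \<Rightarrow> (real \<Rightarrow> real) set" where
  "Lp p = {g \<in> borel_measurable lebesgue. integrable lebesgue (\<lambda>x. \<bar>g x\<bar> powr p)}"

definition Lp_norm :: "real \<Rightarrow> (real \<Rightarrow> real) \<Rightarrow> real" where
  "Lp_norm p g = (LINT x|lebesgue. \<bar>g x\<bar> powr p) powr (1 / p)"

text \<open>The homogeneous Sobolev space \<open>L^m_p(\<real>)\<close>, for \<open>m \<ge> 1\<close>. The derivatives of order
  \<open>1, \<dots>, m - 1\<close> are classical, so each \<open>(deriv ^^ k) F\<close> with \<open>k < m - 1\<close> is required to be
  differentiable; \<open>F^(m)\<close> is the weak derivative of \<open>(deriv ^^ (m - 1)) F\<close>.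
  Given that this weak derivative lies in \<open>L_p\<close>, absolute continuity on the whole line
  is the same as absolute continuity on every compact interval.\<close>

definition sobolev :: "nat \<Rightarrow> real \<Rightarrow> (real \<Rightarrow> real) set" where
  "sobolev m p =
     {F. (\<forall>k<m - 1. (deriv ^^ k) F differentiable_on UNIV) \<and>
         absolutely_continuous_on UNIV ((deriv ^^ (m - 1)) F) \<and>
         (\<exists>g \<in> Lp p. has_weak_derivative ((deriv ^^ (m - 1)) F) g)}"

definition sobolev_seminorm :: "nat \<Rightarrow> real \<Rightarrow> (real \<Rightarrow> real) \<Rightarrow> real" where
  "sobolev_seminorm m p F = Lp_norm p (weak_deriv ((deriv ^^ (m - 1)) F))"

text \<open>A function \<open>E \<rightarrow> \<real>\<close> is represented by the element of \<^term>\<open>extensional E\<close> with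
  the same values on \<open>E\<close>; the vector space operations are pointwise on \<open>E\<close>.\<close>

definition trace_space :: "nat \<Rightarrow> real \<Rightarrow> real set \<Rightarrow> (real \<Rightarrow> real) set" where
  "trace_space m p E = {f \<in> extensional E. \<exists>F \<in> sobolev m p. restrict F E = f}"

definition trace_seminorm :: "nat \<Rightarrow> real \<Rightarrow> real set \<Rightarrow> (real \<Rightarrow> real) \<Rightarrow> real" where
  "trace_seminorm m p E f =
     Inf {sobolev_seminorm m p F | F. F \<in> sobolev m p \<and> restrict F E = f}"

definition linear_on_trace_space ::
    "nat \<Rightarrow> real \<Rightarrow> real set \<Rightarrow> ((real \<Rightarrow> real) \<Rightarrow> (real \<Rightarrow> real)) \<Rightarrow> bool" where
  "linear_on_trace_space m p E T \<longleftrightarrow>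
     (\<forall>f \<in> trace_space m p E. \<forall>g \<in> trace_space m p E.
        T (\<lambda>x\<in>E. f x + g x) = (\<lambda>x. T f x + T g x)) \<and>
     (\<forall>c. \<forall>f \<in> trace_space m p E. T (\<lambda>x\<in>E. c * f x) = (\<lambda>x. c * T f x))"

end

theory Submission
  imports Defs
begin

text \<open>For finite \<open>E\<close> with nodes \<open>x 0 < x 1 < \<dots>\<close>, let \<open>L i\<close> interpolate \<open>f\<close> at \<open>x i, \<dots>, x (i + m - 1)\<close>. The
  extension passes smoothly from \<open>L i\<close> to \<open>L (i + 1)\<close> on a longest gap between \<open>x i\<close> and \<open>x (i + m)\<close>.
  If \<open>F\<close> is any extension, the leading coefficient of \<open>L i\<close> is, up to a factorial, a value of \<open>F^(m-1)\<close>
  between the nodes of \<open>L i\<close>; hence \<open>L (i + 1) - L i\<close> is controlled by the integral of \<open>\<bar>F^(m)\<bar>\<close> over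
  \<open>[x i, x (i + m)]\<close>. Each point lies in at most \<open>m + 1\<close> of these intervals, so the operator norm is
  bounded in terms of \<open>m\<close> alone.

  For infinite \<open>E\<close> the extensions from the finite subsets of \<open>E\<close> converge pointwise, together with their
  derivatives of order less than \<open>m\<close>, along an ultrafilter on these subsets. The limit is linear in \<open>f\<close>,
  and a weak compactness argument bounds its \<open>m\<close>-th derivative in \<open>L_p\<close>.

  Hoelder's inequality is replaced throughout by \<open>y \<le> t + t powr (1 - p) * y powr p\<close> with a free
  parameter \<open>t > 0\<close>, a form which is stable under sums and limits.\<close>


subsection \<open>Smooth functions and a smooth step\<close>

text \<open>The constant may depend neither on the number of nodes nor on \<open>p\<close>. The
  longest gap secures the first: it makes up at least the fraction \<open>1 / m\<close> of the
  interval from \<open>x i\<close> to \<open>x (i + m)\<close>, so in the coordinate in which the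
  gap is [0, 1] the nodes stay in [-m, m], and a single compactness bound on the transition serves
  all configurations. For the second, every estimate bounds an integral of a p-th power by
  \<open>K powr p\<close> times another one; the parameter \<open>t\<close> costs only factors
  \<open>2 powr p\<close>, and the p-th root leaves a constant free of \<open>p\<close>.

  The passage to infinite \<open>E\<close> needs bounds that do not depend on the finite set. They
  come from comparison with one extension \<open>F\<close>: eventually the finite sets contain the
  same \<open>m\<close> points of \<open>E\<close>, where the difference from \<open>F\<close>
  vanishes, so Rolle's theorem controls its derivatives of order less than \<open>m\<close> by the
  oscillation of the highest one. An ultrafilter serves all \<open>f\<close> at once, whereas a
  subsequence would be chosen for each \<open>f\<close>; this keeps the limit linear.\<close>

fun times_diff :: "nat \<Rightarrow> (real \<Rightarrow> real) \<Rightarrow> bool" where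
  "times_diff 0 f = True"
| "times_diff (Suc k) f = (\<exists>f'. (\<forall>x. (f has_real_derivative f' x) (at x)) \<and> times_diff k f')"

text \<open>The recursion behind \<open>times_diff\<close> asks for some derivative instead of
  iterating \<open>deriv\<close>, so closure under sums, products and affine substitutions is a
  plain induction. The link with \<open>deriv ^^ k\<close> is made afterwards.\<close>

definition smooth :: "(real \<Rightarrow> real) \<Rightarrow> bool" where
  "smooth f \<longleftrightarrow> (\<forall>k. times_diff k f)"

lemma times_diff_Suc_imp: "times_diff (Suc k) f \<Longrightarrow> times_diff k f"
proof (induction k arbitrary: f)
  case (Suc k)
  then obtain f' where f': "\<forall>x. (f has_real_derivative f' x) (at x)" "times_diff (Suc k) f'"
    by auto
  with Suc.IH[of f'] show ?case by auto
qed simp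

lemma times_diff_const: "times_diff k (\<lambda>x. c)"
proof (induction k arbitrary: c)
  case (Suc k)
  have "\<forall>x. ((\<lambda>x. c) has_real_derivative (\<lambda>x. 0) x) (at x)" by simp
  then show ?case using Suc[of 0] by (metis times_diff.simps(2))
qed simp

lemma times_diff_add: "times_diff k f \<Longrightarrow> times_diff k g \<Longrightarrow> times_diff k (\<lambda>x. f x + g x)"
proof (induction k arbitrary: f g)
  case (Suc k)
  obtain f' where f': "\<And>x. (f has_real_derivative f' x) (at x)" "times_diff k f'"
    using Suc.prems(1) by auto
  obtain g' where g': "\<And>x. (g has_real_derivative g' x) (at x)" "times_diff k g'"
    using Suc.prems(2) by auto
  show ?case
    unfolding times_diff.simps
    by (rule exI[of _ "\<lambda>x. f' x + g' x"]) (use f' g' Suc.IH in \<open>auto intro!: derivative_intros\<close>)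
qed simp

lemma times_diff_mult: "times_diff k f \<Longrightarrow> times_diff k g \<Longrightarrow> times_diff k (\<lambda>x. f x * g x)"
proof (induction k arbitrary: f g)
  case (Suc k)
  obtain f' where f': "\<And>x. (f has_real_derivative f' x) (at x)" "times_diff k f'"
    using Suc.prems(1) by auto
  obtain g' where g': "\<And>x. (g has_real_derivative g' x) (at x)" "times_diff k g'"
    using Suc.prems(2) by auto
  have "times_diff k f" "times_diff k g"
    using Suc.prems times_diff_Suc_imp by blast+
  then have "times_diff k (\<lambda>x. f' x * g x + f x * g' x)"
    using Suc.IH f' g' by (intro times_diff_add) auto
  moreover have "((\<lambda>x. f x * g x) has_real_derivative f' x * g x + f x * g' x) (at x)" for x
    using DERIV_mult[OF f'(1)[of x] g'(1)[of x]] by (simp add: mult.commute)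
  ultimately show ?case by (auto intro!: exI[of _ "\<lambda>x. f' x * g x + f x * g' x"])
qed simp

lemma times_diff_affine: "times_diff k f \<Longrightarrow> times_diff k (\<lambda>x. f (a * x + b))"
proof (induction k arbitrary: f)
  case (Suc k)
  obtain f' where f': "\<And>x. (f has_real_derivative f' x) (at x)" "times_diff k f'"
    using Suc.prems(1) by auto
  have "((\<lambda>x. f (a * x + b)) has_real_derivative f' (a * x + b) * a) (at x)" for x
    by (rule DERIV_chain2[OF f'(1)]) (auto intro!: derivative_eq_intros)
  moreover have "times_diff k (\<lambda>x. f' (a * x + b) * a)"
    using Suc.IH f' by (intro times_diff_mult times_diff_const) auto
  ultimately show ?case by (auto intro!: exI[of _ "\<lambda>x. f' (a * x + b) * a"])
qed simp

lemma smooth_const [simp]: "smooth (\<lambda>x. c)"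
  and smooth_add: "smooth f \<Longrightarrow> smooth g \<Longrightarrow> smooth (\<lambda>x. f x + g x)"
  and smooth_mult: "smooth f \<Longrightarrow> smooth g \<Longrightarrow> smooth (\<lambda>x. f x * g x)"
  and smooth_affine: "smooth f \<Longrightarrow> smooth (\<lambda>x. f (a * x + b))"
  by (auto simp: smooth_def times_diff_const times_diff_add times_diff_mult times_diff_affine)

lemma smooth_if_derivative_smooth:
  assumes "\<And>x. (f has_real_derivative f' x) (at x)" "smooth f'"
  shows "smooth f"
  unfolding smooth_def
proof
  fix k show "times_diff k f" using assms by (cases k) (auto simp: smooth_def)
qed

lemma smooth_has_deriv: "smooth f \<Longrightarrow> (f has_real_derivative deriv f x) (at x)"
  unfolding smooth_def by (metis DERIV_imp_deriv times_diff.simps(2))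

lemma smooth_deriv: assumes "smooth f" shows "smooth (deriv f)"
  unfolding smooth_def
proof
  fix k
  have "times_diff (Suc k) f" using assms by (simp add: smooth_def)
  then obtain f' where f': "\<forall>x. (f has_real_derivative f' x) (at x)" "times_diff k f'" by auto
  then have "deriv f = f'" by (intro ext) (simp add: DERIV_imp_deriv)
  then show "times_diff k (deriv f)" using f' by simp
qed

lemma smooth_funpow_deriv: "smooth f \<Longrightarrow> smooth ((deriv ^^ k) f)"
  by (induction k) (auto simp: smooth_deriv)

lemma smooth_funpow_has_deriv:
  "smooth f \<Longrightarrow> ((deriv ^^ k) f has_real_derivative (deriv ^^ Suc k) f x) (at x)"
  using smooth_has_deriv[OF smooth_funpow_deriv[of f k]] by simp

lemma smooth_continuous_on: "smooth f \<Longrightarrow> continuous_on S f"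
  by (meson DERIV_isCont continuous_at_imp_continuous_on smooth_has_deriv)

text \<open>The flat function \<open>exp (- 1 / x)\<close> with a polynomial factor in
  \<open>1 / x\<close>. This family is closed under differentiation, so smoothness can be proved for
  all its members at once.\<close>

definition exp_recip :: "real poly \<Rightarrow> real \<Rightarrow> real" where
  "exp_recip P x = (if x > 0 then poly P (1 / x) * exp (- (1 / x)) else 0)"

lemma poly_times_exp_minus_tendsto_0: "((\<lambda>y::real. poly P y * exp (- y)) \<longlongrightarrow> 0) at_top"
proof -
  have "((\<lambda>y::real. \<Sum>i\<le>degree P. coeff P i * (y ^ i / exp y)) \<longlongrightarrow> (\<Sum>i\<le>degree P. coeff P i * 0)) at_top"
    by (intro tendsto_intros tendsto_power_div_exp_0)
  then show ?thesis
    by (simp add: poly_altdef exp_minus divide_simps sum_distrib_left sum_distrib_right mult.commute mult.left_commute)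
qed

lemma exp_recip_tendsto_0: "(exp_recip P \<longlongrightarrow> 0) (at 0)"
proof -
  have "((\<lambda>x. poly P (inverse x) * exp (- inverse x)) \<longlongrightarrow> 0) (at_right 0)"
    using filterlim_compose[OF poly_times_exp_minus_tendsto_0 filterlim_inverse_at_top_right] .
  moreover have "eventually (\<lambda>x. poly P (inverse x) * exp (- inverse x) = exp_recip P x) (at_right (0::real))"
    by (auto simp: eventually_at_right_less exp_recip_def divide_inverse intro!: eventually_mono[OF eventually_at_right_less])
  ultimately have "(exp_recip P \<longlongrightarrow> 0) (at_right 0)"
    by (rule Lim_transform_eventually)
  moreover have "(exp_recip P \<longlongrightarrow> 0) (at_left 0)"
    by (rule Lim_transform_eventually[OF tendsto_const])
       (auto simp: eventually_at_filter exp_recip_def)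
  ultimately show ?thesis by (simp add: filterlim_at_split)
qed

text \<open>Put y = 1 / x, whose derivative is -y^2; then P(y) exp(-y) has the derivative y^2 (P(y)
  - P'(y)) exp(-y).\<close>

lemma exp_recip_has_derivative:
  "(exp_recip P has_real_derivative exp_recip ([:0, 0, 1:] * (P - pderiv P)) x) (at x)"
proof -
  consider "x > 0" | "x < 0" | "x = 0" by linarith
  then show ?thesis
  proof cases
    case 1
    have "((\<lambda>x. poly P (1 / x) * exp (- (1 / x))) has_real_derivative
            exp_recip ([:0, 0, 1:] * (P - pderiv P)) x) (at x)"
      using 1 by (auto intro!: derivative_eq_intros simp: exp_recip_def field_simps power2_eq_square)
    then show ?thesis
      by (rule has_field_derivative_transform_within_open[where S = "{0<..}"])
         (use 1 in \<open>auto simp: exp_recip_def\<close>)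
  next
    case 2
    have "((\<lambda>x. 0) has_real_derivative exp_recip ([:0, 0, 1:] * (P - pderiv P)) x) (at x)"
      using 2 by (auto simp: exp_recip_def)
    then show ?thesis
      by (rule has_field_derivative_transform_within_open[where S = "{..<0}"])
         (use 2 in \<open>auto simp: exp_recip_def\<close>)
  next
    case 3
    \<comment> \<open>The difference quotient at 0 belongs to the same family, since division by
      \<open>h\<close> multiplies the polynomial by \<open>1 / h\<close>.\<close>
    have "exp_recip P h / h = exp_recip ([:0, 1:] * P) h" for h
      by (auto simp: exp_recip_def)
    then have "((\<lambda>h. exp_recip P h / h) \<longlongrightarrow> 0) (at 0)"
      using exp_recip_tendsto_0[of "[:0, 1:] * P"] by simp
    then show ?thesis
      using 3 by (simp add: DERIV_def exp_recip_def)
  qed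
qed

lemma smooth_exp_recip: "smooth (exp_recip P)"
proof -
  have "times_diff k (exp_recip P)" for k
  proof (induction k arbitrary: P)
    case (Suc k)
    then show ?case
      unfolding times_diff.simps using exp_recip_has_derivative by blast
  qed simp
  then show ?thesis by (simp add: smooth_def)
qed

text \<open>The step is the normalized integral of the bump \<open>b\<close>, a product of two flat
  functions that is supported in [0, 1].\<close>

lemma smooth_step_exists:
  obtains S :: "real \<Rightarrow> real" where
    "smooth S" "\<And>x. x \<le> 0 \<Longrightarrow> S x = 0" "\<And>x. x \<ge> 1 \<Longrightarrow> S x = 1"
    "\<And>x. 0 \<le> deriv S x" "\<And>x. 0 \<le> S x" "\<And>x. S x \<le> 1"
proof -
  define b where "b = (\<lambda>x. exp_recip 1 x * exp_recip 1 (- 1 * x + 1))"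
  have smb: "smooth b"
    unfolding b_def by (intro smooth_mult smooth_affine smooth_exp_recip)
  have b0: "b x \<ge> 0" for x by (auto simp: b_def exp_recip_def)
  have bpos: "b (1/2) > 0" by (auto simp: b_def exp_recip_def)
  have bout: "b x = 0" if "x \<le> 0 \<or> x \<ge> 1" for x using that by (auto simp: b_def exp_recip_def)
  have contb: "continuous_on A b" for A by (rule smooth_continuous_on[OF smb])
  \<comment> \<open>Integration starts at -1 instead of 0, so that 0 is an interior point and
    \<open>B\<close> is differentiable there by the fundamental theorem.\<close>
  define B where "B = (\<lambda>x. integral {-1..x} b)"
  have "((\<lambda>x. integral {-1..x} b) has_real_derivative b x) (at x)" if "x > -1" for x
  proof -
    have "((\<lambda>x. integral {-1..x} b) has_real_derivative b x) (at x within {-1..x + 1})"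
      using that by (intro integral_has_real_derivative contb) auto
    moreover have "at x within {-1..x + 1} = at x"
      using that by (intro at_within_Icc_at) auto
    ultimately show ?thesis by simp
  qed
  then have dB1: "(B has_real_derivative b x) (at x)" if "x > -1" for x
    using that unfolding B_def by blast
  have B0: "B x = 0" if "x \<le> 0" for x
    unfolding B_def using that by (intro integral_unique has_integral_is_0) (auto simp: bout)
  have dB: "(B has_real_derivative b x) (at x)" for x
  proof (cases "x > -1")
    case False
    have "((\<lambda>x. 0) has_real_derivative b x) (at x)"
      using False bout[of x] by simp
    then show ?thesis
      by (rule has_field_derivative_transform_within_open[where S = "{..<0}"])
         (use False B0 in auto)
  qed (rule dB1)
  have monoB: "B x \<le> B y" if "x \<le> y" for x y
    by (rule DERIV_nonneg_imp_nondecreasing[OF that]) (use dB b0 in blast)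
  have B1: "B x = B 1" if "x \<ge> 1" for x
  proof (cases "x = 1")
    case False
    have "\<exists>z. 1 < z \<and> z < x \<and> B x - B 1 = (x - 1) * b z"
      using False that dB by (intro MVT2) auto
    then show ?thesis by (auto simp: bout)
  qed simp
  \<comment> \<open>Otherwise the nondecreasing \<open>B\<close> would vanish on [0, 1], and so
    would its derivative at 1/2, where \<open>b\<close> is positive.\<close>
  have "B 1 \<noteq> 0"
  proof
    assume "B 1 = 0"
    have Bz: "0 = B x" if "x \<in> {0<..<1}" for x
      using monoB[of 0 x] monoB[of x 1] B0[of 0] that \<open>B 1 = 0\<close> by simp
    have "((\<lambda>x. 0) has_real_derivative 0) (at (1/2))" by simp
    then have "(B has_real_derivative 0) (at (1/2))"
      by (rule has_field_derivative_transform_within_open[where S = "{0<..<1}"])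
         (simp, simp, rule Bz)
    then have "b (1/2) = 0" using dB[of "1/2"] DERIV_unique by blast
    then show False using bpos by simp
  qed
  moreover have "B 1 \<ge> 0" using monoB[of 0 1] B0[of 0] by simp
  ultimately have c: "B 1 > 0" by simp
  define S where "S = (\<lambda>x. (1 / B 1) * B x)"
  have "smooth S" unfolding S_def
    by (intro smooth_mult smooth_const smooth_if_derivative_smooth[OF dB] smb)
  moreover have "(S has_real_derivative (1 / B 1) * b x) (at x)" for x
    unfolding S_def by (intro DERIV_cmult dB)
  then have "deriv S x = (1 / B 1) * b x" for x by (rule DERIV_imp_deriv)
  then have "deriv S x \<ge> 0" for x using c b0 by simp
  moreover have "B x \<le> B 1" for x using monoB[of x 1] B1[of x] by linarith
  moreover have "B x \<ge> 0" for x using monoB[of 0 x] B0[of x] B0[of 0] by (cases "x \<le> 0") auto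
  moreover have "S x = 0" if "x \<le> 0" for x using B0[OF that] by (simp add: S_def)
  moreover have "S x = 1" if "x \<ge> 1" for x using B1[OF that] c by (simp add: S_def)
  ultimately show ?thesis
    using c by (intro that[of S]) (simp_all add: S_def)
qed

lemma smooth_imp_test_function:
  assumes "smooth \<phi>" "\<And>x. x \<notin> {a..b} \<Longrightarrow> \<phi> x = 0"
  shows "test_function \<phi>"
proof -
  have "(deriv ^^ k) \<phi> differentiable_on UNIV" for k
    using smooth_funpow_has_deriv[OF assms(1)]
    by (auto simp: differentiable_on_def real_differentiable_def)
  moreover have "closure {x. \<phi> x \<noteq> 0} \<subseteq> {a..b}"
    using assms(2) by (intro closure_minimal subsetI) (blast, simp)
  then have "compact (closure {x. \<phi> x \<noteq> 0})"
    by (meson bounded_closed_interval bounded_subset closed_closure compact_eq_bounded_closed)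
  ultimately show ?thesis by (simp add: test_function_def)
qed


subsection \<open>Weak derivatives and primitives\<close>

text \<open>The kernels \<open>\<rho> n\<close> are derivatives of rescaled steps: nonnegative, of
  mass 1, and supported in an interval of length \<open>1 / Suc n\<close> to the right of
  \<open>x\<close>. They form an approximate identity at \<open>x\<close>.\<close>

lemma smooth_step_kernel_integral_tendsto:
  fixes G S :: "real \<Rightarrow> real" and x :: real
  assumes G: "continuous_on UNIV G"
    and S: "smooth S" "\<And>x. x \<le> 0 \<Longrightarrow> S x = 0" "\<And>x. x \<ge> 1 \<Longrightarrow> S x = 1" "\<And>x. 0 \<le> deriv S x"
  defines "\<rho> \<equiv> \<lambda>n s. deriv S ((real (Suc n)) * (s - x)) * real (Suc n)"
  shows "(\<lambda>n. LINT s|lebesgue. G s * \<rho> n s) \<longlonglongrightarrow> G x"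
    and "\<And>n. integrable lebesgue (\<lambda>s. G s * \<rho> n s)"
proof -
  define I where "I n = {x..x + 1 / real (Suc n)}" for n
  have dS0: "deriv S u = 0" if "u \<notin> {0..1}" for u
  proof (cases "u < 0")
    case True
    have "((\<lambda>x. 0) has_real_derivative 0) (at u)" by simp
    then have "(S has_real_derivative 0) (at u)"
      by (rule has_field_derivative_transform_within_open[where S = "{..<0}"]) (use True S in auto)
    then show ?thesis by (rule DERIV_imp_deriv)
  next
    case False
    have "((\<lambda>x. 1) has_real_derivative 0) (at u)" by simp
    then have "(S has_real_derivative 0) (at u)"
      by (rule has_field_derivative_transform_within_open[where S = "{1<..}"]) (use False that S in auto)
    then show ?thesis by (rule DERIV_imp_deriv)
  qed
  have contS: "continuous_on A (deriv S)" for A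
    by (rule smooth_continuous_on[OF smooth_deriv[OF S(1)]])
  have cont\<rho>: "continuous_on A (\<rho> n)" for A n
    unfolding \<rho>_def
    by (intro continuous_on_mult continuous_on_compose2[OF contS[of UNIV]] continuous_intros) auto
  have contG: "continuous_on A G" for A using G continuous_on_subset by blast
  have \<rho>0: "\<rho> n s = 0" if "s \<notin> I n" for n s
  proof -
    have "real (Suc n) * (s - x) \<notin> {0..1}"
    proof (cases "s < x")
      case True
      then have "real (Suc n) * (s - x) < 0" by (simp add: mult_pos_neg)
      then show ?thesis by simp
    next
      case False
      then have "1 / real (Suc n) < s - x" using that by (auto simp: I_def)
      then have "1 < real (Suc n) * (s - x)" by (simp add: field_simps)
      then show ?thesis by simp
    qed
    then show ?thesis by (simp add: \<rho>_def dS0)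
  qed
  have \<rho>nn: "\<rho> n s \<ge> 0" for n s using S(4) by (simp add: \<rho>_def)
  have \<rho>1: "(\<rho> n has_integral 1) (I n)" for n
  proof -
    have "((\<lambda>s. S (real (Suc n) * (s - x))) has_real_derivative \<rho> n s) (at s)" for s
      unfolding \<rho>_def by (rule DERIV_chain2[OF smooth_has_deriv[OF S(1)]]) (auto intro!: derivative_eq_intros)
    then have "(\<rho> n has_integral (S (real (Suc n) * ((x + 1 / real (Suc n)) - x)) - S (real (Suc n) * (x - x)))) (I n)"
      unfolding I_def
      by (intro fundamental_theorem_of_calculus)
         (auto intro: has_vector_derivative_at_within simp: has_real_derivative_iff_has_vector_derivative)
    then show ?thesis using S by simp
  qed
  have int: "(\<lambda>s. G s * \<rho> n s) absolutely_integrable_on I n" for n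
    unfolding I_def by (intro absolutely_integrable_continuous_real continuous_intros contG cont\<rho>)
  have ind: "indicator (I n) s *\<^sub>R (G s * \<rho> n s) = G s * \<rho> n s" for n s
    using \<rho>0[of s n] by (cases "s \<in> I n") auto
  show "integrable lebesgue (\<lambda>s. G s * \<rho> n s)" for n
    using int[of n] by (simp only: set_integrable_def ind)
  have eq: "(LINT s|lebesgue. G s * \<rho> n s) = integral (I n) (\<lambda>s. G s * \<rho> n s)" for n
    using set_lebesgue_integral_eq_integral(2)[OF int[of n]] by (simp only: set_lebesgue_integral_def ind)
  show "(\<lambda>n. LINT s|lebesgue. G s * \<rho> n s) \<longlonglongrightarrow> G x"
  proof (rule LIMSEQ_I)
    fix e :: real assume "e > 0"
    have "isCont G x" using G by (simp add: continuous_on_eq_continuous_at)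
    then obtain d where d: "d > 0" "\<And>s. \<bar>s - x\<bar> < d \<Longrightarrow> \<bar>G s - G x\<bar> < e / 2"
      unfolding continuous_at_eps_delta dist_real_def using \<open>e > 0\<close> by (metis half_gt_zero)
    obtain N where N: "1 / real (Suc N) < d" using d(1) nat_approx_posE by blast
    have "norm ((LINT s|lebesgue. G s * \<rho> n s) - G x) < e" if "n \<ge> N" for n
    proof -
      have "1 / real (Suc n) \<le> 1 / real (Suc N)" using that by (simp add: frac_le)
      then have near: "\<bar>G s - G x\<bar> < e / 2" if "s \<in> I n" for s
        using that N by (intro d) (auto simp: I_def)
      have nearm: "G s * \<rho> n s \<le> (G x + e/2) * \<rho> n s" "(G x - e/2) * \<rho> n s \<le> G s * \<rho> n s"
        if "s \<in> I n" for s
        using near[OF that] \<rho>nn[of n s] by (intro mult_right_mono; linarith)+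
      have i2: "(\<lambda>s. G s * \<rho> n s) integrable_on I n"
        using int set_lebesgue_integral_eq_integral(1) by blast
      have "integral (I n) (\<lambda>s. G s * \<rho> n s) \<le> (G x + e/2) * 1"
        by (rule has_integral_le[OF integrable_integral[OF i2] has_integral_mult_right[OF \<rho>1]])
           (use nearm in blast)
      moreover have "(G x - e/2) * 1 \<le> integral (I n) (\<lambda>s. G s * \<rho> n s)"
        by (rule has_integral_le[OF has_integral_mult_right[OF \<rho>1] integrable_integral[OF i2]])
           (use nearm in blast)
      ultimately show ?thesis using \<open>e > 0\<close> unfolding eq real_norm_def by (simp add: abs_less_iff)
    qed
    then show "\<exists>no. \<forall>n\<ge>no. norm ((LINT s|lebesgue. G s * \<rho> n s) - G x) < e" by blast
  qed
qed

text \<open>Stated through increments, which avoids a base point. For continuous \<open>G\<close>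
  and locally absolutely integrable \<open>g\<close> this is equivalent to
  \<open>has_weak_derivative G g\<close>, as shown below, and it needs no test functions.\<close>

definition primitive :: "(real \<Rightarrow> real) \<Rightarrow> (real \<Rightarrow> real) \<Rightarrow> bool" where
  "primitive g G \<longleftrightarrow> (\<forall>x y. x \<le> y \<longrightarrow> (g has_integral (G y - G x)) {x..y})"

text \<open>The test functions are smooth approximations of the indicator of the interval: a step at
  \<open>x\<close> minus a step at \<open>y\<close>. Their derivatives are two of the kernels above,
  which recover \<open>G x - G y\<close>; dominated convergence treats the side with
  \<open>g\<close>.\<close>

lemma weak_derivative_imp_primitive:
  assumes G: "continuous_on UNIV G" and w: "has_weak_derivative G g"
  shows "primitive g G"
  unfolding primitive_def
proof (intro allI impI)
  fix x y :: real assume xy: "x \<le> y"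
  obtain S where S: "smooth S" "\<And>x. x \<le> 0 \<Longrightarrow> S x = 0" "\<And>x. x \<ge> 1 \<Longrightarrow> S x = 1" "\<And>x. 0 \<le> deriv S x"
    "\<And>x. 0 \<le> S x" "\<And>x. S x \<le> 1"
    by (rule smooth_step_exists) blast
  define r where "r n = real (Suc n)" for n
  define \<phi> where "\<phi> n s = S (r n * (s - x)) - S (r n * (s - y))" for n s
  have r1: "r n \<ge> 1" for n by (simp add: r_def)
  have out: "\<phi> n s = 0" if "s \<notin> {x..y+1}" for n s
  proof (cases "s < x")
    case True
    then show ?thesis using xy r1[of n] by (simp add: \<phi>_def S(2) mult_nonneg_nonpos)
  next
    case False
    then have s: "s - y \<ge> 1" "s - x \<ge> 1" using that xy by auto
    then have "r n * (s - y) \<ge> 1 * 1" "r n * (s - x) \<ge> 1 * 1"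
      using r1[of n] by (intro mult_mono; simp)+
    then show ?thesis by (simp add: \<phi>_def S(3))
  qed
  have d\<phi>: "(\<phi> n has_real_derivative deriv S (r n * (s - x)) * r n - deriv S (r n * (s - y)) * r n) (at s)" for n s
    unfolding \<phi>_def
    by (intro DERIV_diff DERIV_chain2[OF smooth_has_deriv[OF S(1)]]) (auto intro!: derivative_eq_intros)
  have "smooth (\<lambda>s. S (r n * s + (- r n * x)) + (-1) * S (r n * s + (- r n * y)))" for n
    by (rule smooth_add[OF smooth_affine[OF S(1)] smooth_mult[OF smooth_const smooth_affine[OF S(1)]]])
  moreover have "\<phi> n = (\<lambda>s. S (r n * s + (- r n * x)) + (-1) * S (r n * s + (- r n * y)))" for n
    by (intro ext) (simp add: \<phi>_def algebra_simps)
  ultimately have sm\<phi>: "smooth (\<phi> n)" for n by simp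
  have "test_function (\<phi> n)" for n
    by (rule smooth_imp_test_function[OF sm\<phi>]) (rule out)
  then have wk: "(LINT s|lebesgue. G s * deriv (\<phi> n) s) = - (LINT s|lebesgue. g s * \<phi> n s)" for n
    using w unfolding has_weak_derivative_def by blast
  have deriv\<phi>: "deriv (\<phi> n) s = deriv S (r n * (s - x)) * r n - deriv S (r n * (s - y)) * r n" for n s
    by (rule DERIV_imp_deriv[OF d\<phi>])
  have K: "(\<lambda>n. LINT s|lebesgue. G s * (deriv S (r n * (s - z)) * r n)) \<longlonglongrightarrow> G z"
    "integrable lebesgue (\<lambda>s. G s * (deriv S (r n * (s - z)) * r n))" for z n
    using smooth_step_kernel_integral_tendsto[OF G S(1-4)] by (simp_all add: r_def)
  have "(LINT s|lebesgue. G s * deriv (\<phi> n) s) =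
     (LINT s|lebesgue. G s * (deriv S (r n * (s - x)) * r n)) - (LINT s|lebesgue. G s * (deriv S (r n * (s - y)) * r n))" for n
    using Bochner_Integration.integral_diff[OF K(2)[of n x] K(2)[of n y]]
    by (simp add: deriv\<phi> right_diff_distrib)
  then have L1: "(\<lambda>n. LINT s|lebesgue. G s * deriv (\<phi> n) s) \<longlonglongrightarrow> G x - G y"
    using tendsto_diff[OF K(1)[of x] K(1)[of y]] by simp
  have gint: "g absolutely_integrable_on A" if "A \<subseteq> {x..y+1}" "A \<in> sets lebesgue" for A
    using w that unfolding has_weak_derivative_def locally_integrable_def
    by (meson set_integrable_subset)
  \<comment> \<open>The limit is the half-open indicator because \<open>S 0 = 0\<close>: both steps
    still vanish at their own starting points. The missing endpoint \<open>x\<close> is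
    negligible.\<close>
  have lim: "(\<lambda>n. \<phi> n s) \<longlonglongrightarrow> indicator {x<..y} s" for s
  proof -
    have ev: "\<exists>N. \<forall>n\<ge>N. r n * u \<ge> 1" if "u > 0" for u
    proof -
      obtain N where "1 / real (Suc N) < u" using \<open>u > 0\<close> nat_approx_posE by blast
      then have "1 < r N * u" by (simp add: r_def field_simps)
      moreover have "r n * u \<ge> r N * u" if "n \<ge> N" for n
        using that \<open>u > 0\<close> by (intro mult_right_mono) (auto simp: r_def)
      ultimately show ?thesis by (meson less_imp_le order_trans)
    qed
    have step: "(\<lambda>n. S (r n * u)) \<longlonglongrightarrow> (if u > 0 then 1 else 0)" for u
    proof (cases "u > 0")
      case True
      then obtain N where "\<forall>n\<ge>N. r n * u \<ge> 1" using ev by blast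
      then have "eventually (\<lambda>n. S (r n * u) = 1) sequentially"
        unfolding eventually_sequentially by (metis S(3))
      then show ?thesis using True by (simp add: tendsto_eventually)
    next
      case False
      then have "S (r n * u) = 0" for n using r1[of n] by (intro S) (simp add: mult_nonneg_nonpos)
      then show ?thesis using False by simp
    qed
    have "(\<lambda>n. \<phi> n s) \<longlonglongrightarrow> (if s - x > 0 then 1 else 0) - (if s - y > 0 then 1 else 0)"
      unfolding \<phi>_def by (intro tendsto_diff step)
    also have "(if s - x > 0 then 1 else 0) - (if s - y > 0 then 1 else 0) = (indicator {x<..y} s :: real)"
      using xy by (auto simp: indicator_def)
    finally show ?thesis .
  qed
  have \<phi>b: "\<bar>\<phi> n s\<bar> \<le> indicator {x..y+1} s" for n s
  proof (cases "s \<in> {x..y+1}")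
    case True
    then show ?thesis using S(5,6) unfolding \<phi>_def
      by (smt (verit, best) indicator_simps(1))
  qed (simp add: out)
  have g1: "integrable lebesgue (\<lambda>s. indicator {x..y+1} s *\<^sub>R g s)"
    using gint[of "{x..y+1}"] by (simp add: set_integrable_def)
  have L2: "(\<lambda>n. LINT s|lebesgue. g s * \<phi> n s) \<longlonglongrightarrow> (LINT s|lebesgue. indicator {x<..y} s *\<^sub>R g s)"
  proof (rule integral_dominated_convergence[where w = "\<lambda>s. \<bar>indicator {x..y+1} s *\<^sub>R g s\<bar>"])
    show "integrable lebesgue (\<lambda>s. \<bar>indicator {x..y + 1} s *\<^sub>R g s\<bar>)"
      using g1 by (rule integrable_abs)
    show "(\<lambda>s. indicator {x<..y} s *\<^sub>R g s) \<in> borel_measurable lebesgue"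
    proof -
      have "g absolutely_integrable_on {x<..y}" by (rule gint) auto
      then show ?thesis by (auto simp: set_integrable_def)
    qed
    show "(\<lambda>s. g s * \<phi> n s) \<in> borel_measurable lebesgue" for n
    proof -
      have m1: "(\<lambda>s. indicator {x..y+1} s *\<^sub>R g s) \<in> borel_measurable lebesgue"
        using g1 by auto
      have m2: "\<phi> n \<in> borel_measurable lebesgue"
        using borel_measurable_continuous_onI[OF smooth_continuous_on[OF sm\<phi>]]
        by (simp add: measurable_completion)
      have "(\<lambda>s. g s * \<phi> n s) = (\<lambda>s. (indicator {x..y+1} s *\<^sub>R g s) * \<phi> n s)"
        using out[of _ n] by (intro ext) (auto simp: indicator_def)
      then show ?thesis using m1 m2 by simp
    qed
    show "AE s in lebesgue. (\<lambda>n. g s * \<phi> n s) \<longlonglongrightarrow> indicator {x<..y} s *\<^sub>R g s"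
      using tendsto_mult_left[OF lim] by (auto simp: mult.commute)
    show "AE s in lebesgue. norm (g s * \<phi> n s) \<le> \<bar>indicator {x..y + 1} s *\<^sub>R g s\<bar>" for n
    proof (rule AE_I2)
      fix s
      show "norm (g s * \<phi> n s) \<le> \<bar>indicator {x..y + 1} s *\<^sub>R g s\<bar>"
        using mult_right_mono[OF \<phi>b[of n s], of "\<bar>g s\<bar>"] by (simp add: abs_mult mult.commute)
    qed
  qed
  have "(\<lambda>n. LINT s|lebesgue. G s * deriv (\<phi> n) s) \<longlonglongrightarrow> - (LINT s|lebesgue. indicator {x<..y} s *\<^sub>R g s)"
    unfolding wk by (rule tendsto_minus[OF L2])
  then have e1: "(LINT s:{x<..y}|lebesgue. g s) = G y - G x"
    using L1 LIMSEQ_unique unfolding set_lebesgue_integral_def by fastforce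
  have "g absolutely_integrable_on {x<..y}" by (rule gint) auto
  then have "(g has_integral (G y - G x)) {x<..y}"
    using set_lebesgue_integral_eq_integral[of "{x<..y}" g] e1 by (metis integrable_integral)
  moreover have "negligible {s \<in> {x<..y} - {x..y}. g s \<noteq> 0}" "negligible {s \<in> {x..y} - {x<..y}. g s \<noteq> 0}"
    by (rule negligible_subset[of "{x}"]; auto)+
  ultimately show "(g has_integral (G y - G x)) {x..y}"
    using has_integral_spike_set_eq[of "{x<..y}" "{x..y}" g] by blast
qed

text \<open>Increments of \<open>V\<close> add up and absolute increments of \<open>W\<close> are
  subadditive, so the bound propagates along a chain of steps of length at most
  \<open>\<delta>\<close>.\<close>

lemma local_increment_bound_imp_global:
  fixes W V :: "real \<Rightarrow> real"
  assumes "\<delta> > 0" "a \<le> b"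
    and loc: "\<And>u v. a \<le> u \<Longrightarrow> u \<le> v \<Longrightarrow> v \<le> b \<Longrightarrow> v - u \<le> \<delta> \<Longrightarrow> \<bar>W v - W u\<bar> \<le> V v - V u"
  shows "\<bar>W b - W a\<bar> \<le> V b - V a"
proof -
  have "\<bar>W v - W a\<bar> \<le> V v - V a" if "a \<le> v" "v \<le> b" "v - a \<le> real n * \<delta>" for n v
    using that
  proof (induction n arbitrary: v)
    case 0
    then have "v = a" by simp
    then show ?case by simp
  next
    case (Suc n)
    define u where "u = max a (v - \<delta>)"
    have "\<bar>W u - W a\<bar> \<le> V u - V a"
      by (rule Suc.IH) (use Suc.prems \<open>\<delta> > 0\<close> in \<open>auto simp: u_def algebra_simps\<close>)
    moreover have "\<bar>W v - W u\<bar> \<le> V v - V u"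
      by (rule loc) (use Suc.prems \<open>\<delta> > 0\<close> in \<open>auto simp: u_def\<close>)
    ultimately show ?case by linarith
  qed
  moreover obtain n where "b - a < real n * \<delta>"
    using \<open>\<delta> > 0\<close> reals_Archimedean3 by blast
  ultimately show ?thesis using \<open>a \<le> b\<close> by (meson less_imp_le order_refl)
qed

lemma primitive_continuous_on: assumes "primitive g G" shows "continuous_on S G"
proof -
  have "isCont G x" for x
  proof -
    have "(g has_integral (G (x+1) - G (x-1))) {x-1..x+1}" using assms unfolding primitive_def by simp
    then have "g integrable_on {x-1..x+1}" by (rule has_integral_integrable)
    then have "continuous_on {x-1..x+1} (\<lambda>y. integral {x-1..y} g)"
      by (rule indefinite_integral_continuous_1)
    then have "continuous_on {x-1..x+1} (\<lambda>y. G (x - 1) + integral {x-1..y} g)"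
      by (intro continuous_intros)
    moreover have "G (x - 1) + integral {x-1..y} g = G y" if "y \<in> {x-1..x+1}" for y
    proof -
      have "integral {x-1..y} g = G y - G (x - 1)"
        using assms that unfolding primitive_def by (intro integral_unique) auto
      then show ?thesis by simp
    qed
    ultimately have "continuous_on {x-1..x+1} G" by (rule continuous_on_eq)
    then show ?thesis by (rule continuous_on_interior) simp
  qed
  then show ?thesis by (simp add: continuous_at_imp_continuous_on)
qed

lemma primitive_integral: "primitive g G \<Longrightarrow> x \<le> y \<Longrightarrow> integral {x..y} g = G y - G x"
  unfolding primitive_def by (intro integral_unique) auto

text \<open>The difference of the two sides is an additive function of the interval \<open>{a..b}\<close>, and on short
  intervals it is at most a small multiple of the integral of \<open>\<bar>g\<bar> + \<bar>\<phi>'\<bar>\<close>.\<close>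

lemma primitive_integration_by_parts:
  fixes G g :: "real \<Rightarrow> real"
  assumes p: "primitive g G" and g: "\<And>x y. g absolutely_integrable_on {x..y}"
    and \<phi>: "\<And>x. (\<phi> has_real_derivative \<phi>' x) (at x)" "continuous_on UNIV \<phi>'"
    and ab: "a \<le> b"
  shows "((\<lambda>s. G s * \<phi>' s + g s * \<phi> s) has_integral (G b * \<phi> b - G a * \<phi> a)) {a..b}"
proof -
  define f where "f = (\<lambda>s. G s * \<phi>' s + g s * \<phi> s)"
  have contG: "continuous_on A G" for A by (rule primitive_continuous_on[OF p])
  have cont\<phi>: "continuous_on A \<phi>" for A
    by (meson DERIV_isCont \<phi>(1) continuous_at_imp_continuous_on)
  have cont\<phi>': "continuous_on A \<phi>'" for A using \<phi>(2) continuous_on_subset by blast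
  have ig\<phi>: "(\<lambda>s. h s * g s) integrable_on {x..y}" if "continuous_on UNIV h" for x y h
  proof -
    have "(\<lambda>s. h s * g s) absolutely_integrable_on {x..y}"
    proof (rule absolutely_integrable_bounded_measurable_product_real)
      show "h \<in> borel_measurable (lebesgue_on {x..y})"
        using that by (intro continuous_imp_measurable_on_sets_lebesgue) (auto intro: continuous_on_subset)
      show "bounded (h ` {x..y})"
        using that by (intro compact_imp_bounded compact_continuous_image) (auto intro: continuous_on_subset)
    qed (use g in auto)
    then show ?thesis using set_lebesgue_integral_eq_integral(1) by blast
  qed
  have gi: "g integrable_on {x..y}" for x y using g set_lebesgue_integral_eq_integral(1) by blast
  have gabs: "(\<lambda>s. \<bar>g s\<bar>) integrable_on {x..y}" for x y
    using g[of x y] by (simp add: absolutely_integrable_on_def)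
  have G\<phi>'i: "(\<lambda>s. G s * \<phi>' s) integrable_on {x..y}" for x y
    by (intro integrable_continuous_real continuous_intros contG cont\<phi>')
  have \<phi>'abs: "(\<lambda>s. \<bar>\<phi>' s\<bar>) integrable_on {x..y}" for x y
    by (intro integrable_continuous_real continuous_intros cont\<phi>')
  have g\<phi>i: "(\<lambda>s. g s * \<phi> s) integrable_on {x..y}" for x y
    using ig\<phi>[OF cont\<phi>] by (simp add: mult.commute)
  have fi: "f integrable_on {x..y}" for x y
    unfolding f_def by (intro integrable_add G\<phi>'i g\<phi>i)
  \<comment> \<open>\<open>W\<close> measures the failure of the formula up to \<open>x\<close>; it
    will be shown to have equal values at \<open>a\<close> and \<open>b\<close>.\<close>
  define W where "W x = G x * \<phi> x - integral {a..x} f" for x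
  define V where "V x = integral {a..x} (\<lambda>s. \<bar>g s\<bar> + \<bar>\<phi>' s\<bar>)" for x
  have key: "\<bar>W b - W a\<bar> \<le> e * V b" if "e > 0" for e
  proof -
    have "uniformly_continuous_on {a..b} G" "uniformly_continuous_on {a..b} \<phi>"
      by (intro compact_uniformly_continuous contG cont\<phi>; simp)+
    then obtain d1 d2 where d: "d1 > 0" "d2 > 0"
      "\<And>x y. x \<in> {a..b} \<Longrightarrow> y \<in> {a..b} \<Longrightarrow> dist y x < d1 \<Longrightarrow> dist (G y) (G x) < e"
      "\<And>x y. x \<in> {a..b} \<Longrightarrow> y \<in> {a..b} \<Longrightarrow> dist y x < d2 \<Longrightarrow> dist (\<phi> y) (\<phi> x) < e"
      unfolding uniformly_continuous_on_def using \<open>e > 0\<close> by metis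
    define \<delta> where "\<delta> = min d1 d2 / 2"
    have \<delta>: "\<delta> > 0" "\<delta> < d1" "\<delta> < d2" using d by (auto simp: \<delta>_def)
    have "\<bar>W v - W u\<bar> \<le> e * V v - e * V u" if uv: "a \<le> u" "u \<le> v" "v \<le> b" "v - u \<le> \<delta>" for u v
    proof -
      have sp: "integral {a..v} h = integral {a..u} h + integral {u..v} h"
        if "h integrable_on {a..v}" for h :: "real \<Rightarrow> real"
        using Henstock_Kurzweil_Integration.integral_combine[OF uv(1,2) that] by simp
      have dv: "(\<phi>' has_integral (\<phi> v - \<phi> u)) {u..v}"
        using uv \<phi>(1) by (intro fundamental_theorem_of_calculus)
          (auto intro: has_vector_derivative_at_within simp: has_real_derivative_iff_has_vector_derivative)
      have gv: "(g has_integral (G v - G u)) {u..v}" using p uv by (simp add: primitive_def)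
      \<comment> \<open>With \<open>\<phi>\<close> frozen at \<open>v\<close> and \<open>G\<close>
        at \<open>u\<close>, the formula on {u..v} is an identity: the two terms telescope to
        \<open>G v * \<phi> v - G u * \<phi> u\<close>. Unfreezing costs the oscillation of
        \<open>\<phi>\<close> and \<open>G\<close> on a short interval.\<close>
      have "((\<lambda>s. (\<phi> v * g s + G u * \<phi>' s) - f s) has_integral
         (\<phi> v * (G v - G u) + G u * (\<phi> v - \<phi> u) - integral {u..v} f)) {u..v}"
        by (intro has_integral_diff has_integral_add has_integral_mult_right dv gv integrable_integral fi)
      moreover have "\<phi> v * (G v - G u) + G u * (\<phi> v - \<phi> u) - integral {u..v} f = W v - W u"
        using sp[OF fi] by (simp add: W_def algebra_simps)
      ultimately have "((\<lambda>s. (\<phi> v * g s + G u * \<phi>' s) - f s) has_integral (W v - W u)) {u..v}" by simp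
      moreover have "((\<lambda>s. e * (\<bar>g s\<bar> + \<bar>\<phi>' s\<bar>)) has_integral (e * integral {u..v} (\<lambda>s. \<bar>g s\<bar> + \<bar>\<phi>' s\<bar>))) {u..v}"
        by (intro has_integral_mult_right integrable_integral integrable_add gabs \<phi>'abs)
      moreover have "norm ((\<phi> v * g s + G u * \<phi>' s) - f s) \<le> e * (\<bar>g s\<bar> + \<bar>\<phi>' s\<bar>)" if "s \<in> {u..v}" for s
      proof -
        have "dist (\<phi> v) (\<phi> s) < e" "dist (G u) (G s) < e"
          using that uv \<delta> by (intro d; auto simp: dist_real_def)+
        then have "\<bar>\<phi> v - \<phi> s\<bar> * \<bar>g s\<bar> + \<bar>G u - G s\<bar> * \<bar>\<phi>' s\<bar> \<le> e * \<bar>g s\<bar> + e * \<bar>\<phi>' s\<bar>"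
          by (intro add_mono mult_right_mono) (auto simp: dist_real_def)
        moreover have "(\<phi> v * g s + G u * \<phi>' s) - f s = (\<phi> v - \<phi> s) * g s + (G u - G s) * \<phi>' s"
          by (simp add: f_def algebra_simps)
        ultimately show ?thesis
          using abs_triangle_ineq[of "(\<phi> v - \<phi> s) * g s" "(G u - G s) * \<phi>' s"]
          by (simp add: abs_mult distrib_left)
      qed
      ultimately have "norm (W v - W u) \<le> e * integral {u..v} (\<lambda>s. \<bar>g s\<bar> + \<bar>\<phi>' s\<bar>)"
        by (metis (no_types, lifting) has_integral_iff integral_norm_bound_integral)
      also have "\<dots> = e * V v - e * V u"
        using sp[OF integrable_add[OF gabs \<phi>'abs]] by (simp add: V_def algebra_simps)
      finally show ?thesis by simp
    qed
    from local_increment_bound_imp_global[of _ _ _ W "\<lambda>x. e * V x", OF \<delta>(1) ab this]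
    show ?thesis by (simp add: V_def)
  qed
  have "W b - W a = 0"
  proof (rule ccontr)
    assume ne: "W b - W a \<noteq> 0"
    define e where "e = \<bar>W b - W a\<bar> / (2 * (\<bar>V b\<bar> + 1))"
    have "e > 0" using ne by (simp add: e_def)
    then have "\<bar>W b - W a\<bar> \<le> e * V b" by (rule key)
    also have "\<dots> \<le> e * (\<bar>V b\<bar> + 1)" using \<open>e > 0\<close> by (intro mult_left_mono) auto
    also have "\<dots> = \<bar>W b - W a\<bar> / 2" by (simp add: e_def field_simps)
    finally show False using ne by simp
  qed
  then have "integral {a..b} f = G b * \<phi> b - G a * \<phi> a" by (simp add: W_def)
  then show ?thesis using fi by (simp add: f_def has_integral_iff)
qed

text \<open>Integration by parts on an interval that contains the support of the test
  function.\<close>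

lemma primitive_imp_weak_derivative:
  assumes p: "primitive g G" and g: "\<And>x y. g absolutely_integrable_on {x..y}"
  shows "has_weak_derivative G g"
  unfolding has_weak_derivative_def
proof (intro conjI allI impI)
  have contG: "continuous_on A G" for A by (rule primitive_continuous_on[OF p])
  show "locally_integrable G"
    unfolding locally_integrable_def by (intro allI absolutely_integrable_continuous_real contG)
  show "locally_integrable g" using g by (simp add: locally_integrable_def)
  fix \<phi> assume \<phi>: "test_function \<phi>"
  have d0: "(deriv ^^ k) \<phi> differentiable_on UNIV" for k using \<phi> by (simp add: test_function_def)
  have d\<phi>: "(\<phi> has_real_derivative deriv \<phi> x) (at x)" for x
    using d0[of 0] by (auto simp: differentiable_on_def intro: DERIV_deriv_iff_real_differentiable[THEN iffD2])
  have cont\<phi>': "continuous_on A (deriv \<phi>)" for A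
    using differentiable_imp_continuous_on[OF d0[of 1]] continuous_on_subset by auto
  have cont\<phi>: "continuous_on A \<phi>" for A
    using differentiable_imp_continuous_on[OF d0[of 0]] continuous_on_subset by auto
  have "bounded (closure {x. \<phi> x \<noteq> 0})"
    using \<phi> compact_imp_bounded by (auto simp: test_function_def)
  then obtain R where R: "\<And>x. \<phi> x \<noteq> 0 \<Longrightarrow> \<bar>x\<bar> \<le> R"
    unfolding bounded_real by (metis (mono_tags, lifting) closure_subset mem_Collect_eq subsetD)
  \<comment> \<open>Larger than the radius of the support, so that \<open>\<phi>\<close> vanishes at
    both endpoints and the boundary terms drop out.\<close>
  define r where "r = \<bar>R\<bar> + 1"
  have z: "\<phi> x = 0" if "\<bar>x\<bar> \<ge> r" for x using R[of x] that unfolding r_def by (cases "\<phi> x = 0") auto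
  have z': "deriv \<phi> x = 0" if "\<bar>x\<bar> > r" for x
  proof -
    have "((\<lambda>x. 0) has_real_derivative 0) (at x)" by simp
    then have "(\<phi> has_real_derivative 0) (at x)"
      by (rule has_field_derivative_transform_within_open[where S = "- {-r..r}"])
         (use that z in \<open>auto intro!: z[symmetric]\<close>)
    then show ?thesis by (rule DERIV_imp_deriv)
  qed
  have zo: "deriv \<phi> s = 0" "\<phi> s = 0" if "s \<notin> {-r..r}" for s
    using that by (auto intro!: z z')
  have i1: "(\<lambda>s. G s * deriv \<phi> s) absolutely_integrable_on {-r..r}"
    by (intro absolutely_integrable_continuous_real continuous_intros contG cont\<phi>')
  have i2: "(\<lambda>s. \<phi> s * g s) absolutely_integrable_on {-r..r}"
  proof (rule absolutely_integrable_bounded_measurable_product_real)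
    show "\<phi> \<in> borel_measurable (lebesgue_on {-r..r})"
      by (intro continuous_imp_measurable_on_sets_lebesgue cont\<phi>) auto
    show "bounded (\<phi> ` {-r..r})"
      by (intro compact_imp_bounded compact_continuous_image cont\<phi>) auto
  qed (use g in auto)
  have ind: "indicator {-r..r} s *\<^sub>R (G s * deriv \<phi> s) = G s * deriv \<phi> s"
    "indicator {-r..r} s *\<^sub>R (\<phi> s * g s) = \<phi> s * g s" for s
    using zo[of s] by (cases "s \<in> {-r..r}"; simp)+
  have "(LINT s|lebesgue. G s * deriv \<phi> s) = (LINT s:{-r..r}|lebesgue. G s * deriv \<phi> s)"
    unfolding set_lebesgue_integral_def ind ..
  also have "\<dots> = integral {-r..r} (\<lambda>s. G s * deriv \<phi> s)"
    by (rule set_lebesgue_integral_eq_integral(2)[OF i1])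
  finally have e1: "(LINT s|lebesgue. G s * deriv \<phi> s) = integral {-r..r} (\<lambda>s. G s * deriv \<phi> s)" .
  have "(LINT s|lebesgue. \<phi> s * g s) = (LINT s:{-r..r}|lebesgue. \<phi> s * g s)"
    unfolding set_lebesgue_integral_def ind ..
  also have "\<dots> = integral {-r..r} (\<lambda>s. \<phi> s * g s)"
    by (rule set_lebesgue_integral_eq_integral(2)[OF i2])
  finally have e2: "(LINT s|lebesgue. g s * \<phi> s) = integral {-r..r} (\<lambda>s. g s * \<phi> s)"
    by (simp add: mult.commute[of "g _"])
  have rr: "-r \<le> r" by (simp add: r_def)
  have "integral {-r..r} (\<lambda>s. G s * deriv \<phi> s + g s * \<phi> s) = G r * \<phi> r - G (-r) * \<phi> (-r)"
    by (rule integral_unique[OF primitive_integration_by_parts[OF p g d\<phi> cont\<phi>' rr]])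
  also have "\<dots> = 0" by (simp add: z)
  also have "integral {-r..r} (\<lambda>s. G s * deriv \<phi> s + g s * \<phi> s) =
    integral {-r..r} (\<lambda>s. G s * deriv \<phi> s) + integral {-r..r} (\<lambda>s. g s * \<phi> s)"
    using set_lebesgue_integral_eq_integral(1)[OF i1] set_lebesgue_integral_eq_integral(1)[OF i2]
    by (intro Henstock_Kurzweil_Integration.integral_add) (auto simp: mult.commute)
  finally show "(LINT x|lebesgue. G x * deriv \<phi> x) = - (LINT x|lebesgue. g x * \<phi> x)"
    unfolding e1 e2 by linarith
qed

text \<open>The difference of the densities has integral 0 over every interval; by Lebesgue's
  differentiation theorem its averages over shrinking intervals converge to it almost
  everywhere.\<close>

lemma primitive_unique_AE:
  assumes "primitive g G" "primitive h G"
  shows "AE x in lebesgue. g x = h x"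
proof -
  have hi: "((\<lambda>x. g x - h x) has_integral 0) {a..b}" for a b
  proof (cases "a \<le> b")
    case True
    then show ?thesis
      using has_integral_diff[of g "G b - G a" "{a..b}" h "G b - G a"] assms by (simp add: primitive_def)
  qed simp
  have ii: "(\<lambda>x. g x - h x) integrable_on cbox a b" for a b using hi[of a b] by auto
  obtain N where N: "negligible N" "\<And>x e. \<lbrakk>x \<notin> N; 0 < e\<rbrakk> \<Longrightarrow>
      \<exists>d>0. \<forall>k. 0 < k \<and> k < d \<longrightarrow>
        norm (integral (cbox x (x + k *\<^sub>R One)) (\<lambda>x. g x - h x) /\<^sub>R k ^ DIM(real) - (g x - h x)) < e"
    using integrable_ccontinuous_explicit[OF ii] by blast
  have "g x = h x" if "x \<notin> N" for x
  proof (rule ccontr)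
    assume "g x \<noteq> h x"
    then have "\<bar>g x - h x\<bar> > 0" by simp
    from N(2)[OF that this] obtain d where d: "d > 0" "\<And>k. 0 < k \<Longrightarrow> k < d \<Longrightarrow>
        norm (integral (cbox x (x + k *\<^sub>R One)) (\<lambda>x. g x - h x) /\<^sub>R k ^ DIM(real) - (g x - h x)) < \<bar>g x - h x\<bar>"
      by blast
    show False using d(2)[of "d/2"] d(1) integral_unique[OF hi, of x "x + d/2"] by simp
  qed
  then show ?thesis
    using N(1) by (auto simp: negligible_iff_null_sets intro: AE_I'[of N])
qed


subsection \<open>The Sobolev space in terms of primitives\<close>

text \<open>Where \<open>y > t\<close>, write \<open>y = y powr (1 - p) * y powr p\<close> and use
  that the exponent \<open>1 - p\<close> is negative.\<close>

lemma le_powr_young: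
  fixes t y p :: real
  assumes "t > 0" "p > 1" "y \<ge> 0"
  shows "y \<le> t + t powr (1 - p) * y powr p"
proof (cases "y \<le> t")
  case True
  then show ?thesis by (simp add: add_increasing2)
next
  case False
  then have "y = y powr (1 - p) * y powr p" using assms by (simp flip: powr_add)
  also have "\<dots> \<le> t powr (1 - p) * y powr p"
    using False assms by (intro mult_right_mono powr_mono2') auto
  finally show ?thesis using assms by linarith
qed

text \<open>The way back to Hoelder's inequality: optimizing over \<open>t\<close> turns the family
  of linear bounds into a bound of p-th powers, at the price of the factor
  \<open>2 powr p\<close>.\<close>

lemma powr_le_of_young:
  fixes a b c p :: real
  assumes y: "\<And>t. t > 0 \<Longrightarrow> a \<le> t * b + t powr (1 - p) * c"
    and "a \<ge> 0" "b > 0" "c \<ge> 0" "p > 1"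
  shows "a powr p \<le> 2 powr p * b powr (p - 1) * c"
proof (cases "c = 0")
  case True
  have "a = 0"
  proof (rule ccontr)
    assume "a \<noteq> 0"
    then have "a > 0" using \<open>a \<ge> 0\<close> by simp
    then have "a \<le> a / (2 * b) * b" using y[of "a / (2 * b)"] True \<open>b > 0\<close> by simp
    then show False using \<open>a > 0\<close> \<open>b > 0\<close> by simp
  qed
  then show ?thesis using True by simp
next
  case False
  then have c: "c > 0" using \<open>c \<ge> 0\<close> by simp
  \<comment> \<open>This \<open>t\<close> makes the two terms \<open>t * b\<close> and
    \<open>t powr (1 - p) * c\<close> equal, whence the factor 2.\<close>
  define t where "t = (c / b) powr (1 / p)"
  have t: "t > 0" using c \<open>b > 0\<close> by (simp add: t_def)
  have "t powr p = c / b" using c assms by (simp add: t_def powr_powr)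
  then have "c = t powr p * b" using \<open>b > 0\<close> by (simp add: field_simps)
  then have "t powr (1 - p) * c = (t powr (1 - p) * t powr p) * b" by simp
  also have "\<dots> = t * b" using t by (simp flip: powr_add)
  finally have "a \<le> 2 * (t * b)" using y[OF t] by linarith
  then have "a powr p \<le> (2 * (t * b)) powr p"
    using assms by (intro powr_mono2) auto
  also have "\<dots> = 2 powr p * (t powr p * b powr p)"
    using t \<open>b > 0\<close> by (simp add: powr_mult)
  also have "t powr p * b powr p = b powr (p - 1) * c"
    using \<open>t powr p = c / b\<close> \<open>b > 0\<close> by (simp add: powr_diff)
  finally show ?thesis by (simp add: mult.assoc)
qed

lemma powr_tendsto_0_at_top: "p > (1::real) \<Longrightarrow> ((\<lambda>t. t powr (1 - p) * c) \<longlongrightarrow> (0::real)) at_top"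
  using tendsto_mult_left_zero[OF tendsto_neg_powr[OF _ filterlim_ident]] by simp

text \<open>The source of all absolute continuity and equicontinuity below: a large \<open>t\<close>
  makes the p-th power term small, and afterwards a short total length makes the term linear in
  \<open>t\<close> small.\<close>

lemma young_small_exists:
  fixes p c e :: real
  assumes "p > 1" "e > 0"
  obtains t where "t > 0" "t powr (1 - p) * c < e"
proof -
  have "eventually (\<lambda>t. t powr (1 - p) * c < e) at_top"
    by (rule order_tendstoD(2)[OF powr_tendsto_0_at_top[OF assms(1)] assms(2)])
  then have "eventually (\<lambda>t. t powr (1 - p) * c < e \<and> t > 0) at_top"
    using eventually_gt_at_top[of 0] by (rule eventually_conj)
  then obtain t where "t powr (1 - p) * c < e" "t > 0"
    by (metis (no_types, lifting) eventually_at_top_linorder order_refl)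
  then show ?thesis by (rule that[rotated])
qed

section \<open>Integrals of functions in L_p over intervals\<close>

lemma Lp_measurable: "g \<in> Lp p \<Longrightarrow> g \<in> borel_measurable lebesgue"
  and Lp_integrable: "g \<in> Lp p \<Longrightarrow> integrable lebesgue (\<lambda>x. \<bar>g x\<bar> powr p)"
  by (auto simp: Lp_def)

lemma Lp_set_integrable_powr:
  assumes "g \<in> Lp p" "S \<in> sets lebesgue"
  shows "set_integrable lebesgue S (\<lambda>x. \<bar>g x\<bar> powr p)"
  using integrable_mult_indicator[OF assms(2) Lp_integrable[OF assms(1)]]
  by (simp add: set_integrable_def)

text \<open>The case \<open>t = 1\<close> of \<open>le_powr_young\<close> gives the integrable
  majorant 1 + |g|^p on sets of finite measure.\<close>

lemma Lp_absolutely_integrable: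
  assumes "g \<in> Lp p" "p > 1" "S \<in> lmeasurable"
  shows "g absolutely_integrable_on S"
  unfolding set_integrable_def
proof (rule Bochner_Integration.integrable_bound)
  have S: "S \<in> sets lebesgue" using assms(3) by auto
  show "integrable lebesgue (\<lambda>x. indicator S x + indicator S x *\<^sub>R \<bar>g x\<bar> powr p :: real)"
    using Lp_set_integrable_powr[OF assms(1) S] assms(3)
    by (intro Bochner_Integration.integrable_add) (auto simp: set_integrable_def fmeasurable_def)
  show "(\<lambda>x. indicat_real S x *\<^sub>R g x) \<in> borel_measurable lebesgue"
    using Lp_measurable[OF assms(1)] S by simp
  show "AE x in lebesgue. norm (indicat_real S x *\<^sub>R g x)
         \<le> norm (indicator S x + indicator S x *\<^sub>R \<bar>g x\<bar> powr p)"
    using le_powr_young[of 1 p "\<bar>g _\<bar>"] assms(2) by (auto simp: indicator_def)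
qed

lemma Lp_interval: "g \<in> Lp p \<Longrightarrow> p > 1 \<Longrightarrow> g absolutely_integrable_on {a..b}"
  by (rule Lp_absolutely_integrable) auto

lemma Lp_abs_integrable_on: "g \<in> Lp p \<Longrightarrow> p > 1 \<Longrightarrow> (\<lambda>x. \<bar>g x\<bar>) integrable_on {a..b}"
  using Lp_interval[of g p a b] by (simp add: absolutely_integrable_on_def)

lemma Lp_powr_integrable_on: "g \<in> Lp p \<Longrightarrow> (\<lambda>x. \<bar>g x\<bar> powr p) integrable_on {a..b}"
  using set_lebesgue_integral_eq_integral(1)[OF Lp_set_integrable_powr[of g p "{a..b}"]] by simp

lemma Lp_integral_le_young:
  assumes "g \<in> Lp p" "p > 1" "t > 0" "a \<le> b"
  shows "integral {a..b} (\<lambda>x. \<bar>g x\<bar>)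
    \<le> t * (b - a) + t powr (1 - p) * integral {a..b} (\<lambda>x. \<bar>g x\<bar> powr p)"
proof -
  have c: "((\<lambda>x. t) has_integral t * (b - a)) {a..b}"
    using has_integral_const_real[of t a b] assms(4) by (simp add: mult.commute)
  have "((\<lambda>x. t + t powr (1 - p) * \<bar>g x\<bar> powr p) has_integral
      t * (b - a) + t powr (1 - p) * integral {a..b} (\<lambda>x. \<bar>g x\<bar> powr p)) {a..b}"
    by (intro has_integral_add c has_integral_mult_right integrable_integral Lp_powr_integrable_on assms)
  then show ?thesis
    by (rule has_integral_le[OF integrable_integral[OF Lp_abs_integrable_on[OF assms(1,2)]]])
       (use le_powr_young[OF assms(3,2)] in auto)
qed

lemma sum_set_integral_le:
  fixes w :: "real \<Rightarrow> real"
  assumes "finite I" and w: "integrable lebesgue w" "\<And>x. w x \<ge> 0"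
    and A: "\<And>i. i \<in> I \<Longrightarrow> A i \<in> sets lebesgue"
    and K: "\<And>x. (\<Sum>i\<in>I. indicator (A i) x) \<le> K"
  shows "(\<Sum>i\<in>I. LINT x:A i|lebesgue. w x) \<le> K * (LINT x|lebesgue. w x)"
proof -
  have i: "integrable lebesgue (\<lambda>x. indicator (A i) x *\<^sub>R w x)" if "i \<in> I" for i
    by (rule integrable_mult_indicator[OF A[OF that] w(1)])
  have "(\<Sum>i\<in>I. LINT x:A i|lebesgue. w x) = (LINT x|lebesgue. (\<Sum>i\<in>I. indicator (A i) x *\<^sub>R w x))"
    unfolding set_lebesgue_integral_def by (rule Bochner_Integration.integral_sum[symmetric]) (rule i)
  also have "\<dots> \<le> (LINT x|lebesgue. K * w x)"
  proof (rule integral_mono)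
    show "integrable lebesgue (\<lambda>x. \<Sum>i\<in>I. indicator (A i) x *\<^sub>R w x)"
      by (rule Bochner_Integration.integrable_sum) (rule i)
    show "integrable lebesgue (\<lambda>x. K * w x)" using w by simp
    show "(\<Sum>i\<in>I. indicator (A i) x *\<^sub>R w x) \<le> K * w x" for x
      using mult_right_mono[OF K[of x] w(2)[of x]] by (simp add: sum_distrib_right)
  qed
  finally show ?thesis by simp
qed

lemma integral_interval_eq_set_integral:
  fixes w :: "real \<Rightarrow> real"
  assumes "integrable lebesgue w"
  shows "integral {a..b} w = (LINT x:{a..b}|lebesgue. w x)"
    and "integral {a..b} w = (LINT x:{a<..<b}|lebesgue. w x)"
proof -
  have "set_integrable lebesgue S w" if "S \<in> sets lebesgue" for S :: "real set"
    using integrable_mult_indicator[OF that assms] by (simp add: set_integrable_def)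
  then have e: "(LINT x:S|lebesgue. w x) = integral S w" if "S \<in> sets lebesgue" for S :: "real set"
    using that set_lebesgue_integral_eq_integral(2) by blast
  show "integral {a..b} w = (LINT x:{a..b}|lebesgue. w x)"
    "integral {a..b} w = (LINT x:{a<..<b}|lebesgue. w x)"
    by (simp_all add: e integral_open_interval_real)
qed

text \<open>Only the open intervals are disjoint, as in the definition of absolute continuity;
  common endpoints have measure 0.\<close>

lemma sum_integral_disjoint_le:
  fixes w :: "real \<Rightarrow> real"
  assumes "finite I" "disjoint_family_on (\<lambda>i. {a i<..<b i}) I"
    and w: "integrable lebesgue w" "\<And>x. w x \<ge> 0"
  shows "(\<Sum>i\<in>I. integral {a i..b i} w) \<le> (LINT x|lebesgue. w x)"
proof -
  have "(\<Sum>i\<in>I. indicator {a i<..<b i} x) \<le> (1::real)" for x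
  proof (cases "\<exists>j\<in>I. x \<in> {a j<..<b j}")
    case True
    then obtain j where j: "j \<in> I" "x \<in> {a j<..<b j}" by blast
    have "indicator {a i<..<b i} x = (0::real)" if "i \<in> I - {j}" for i
    proof -
      have "{a i<..<b i} \<inter> {a j<..<b j} = {}"
        using assms(2) that j(1) by (intro disjoint_family_onD[OF assms(2)]) auto
      then show ?thesis using j(2) by (auto simp: indicator_def)
    qed
    then show ?thesis
      using sum.remove[OF assms(1) j(1), of "\<lambda>i. indicator {a i<..<b i} x :: real"] j(2) by simp
  next
    case False
    then have "(\<Sum>i\<in>I. indicator {a i<..<b i} x) = (\<Sum>i\<in>I. 0::real)"
      by (intro sum.cong) (auto simp: indicator_def)
    then show ?thesis by simp
  qed
  then have "(\<Sum>i\<in>I. LINT x:{a i<..<b i}|lebesgue. w x) \<le> 1 * (LINT x|lebesgue. w x)"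
    by (intro sum_set_integral_le assms) auto
  then show ?thesis by (simp add: integral_interval_eq_set_integral(2)[OF w(1)])
qed

lemma Lp_sum_integral_le_young:
  assumes g: "g \<in> Lp p" "p > 1" "t > 0"
    and I: "finite I" "\<And>i. i \<in> I \<Longrightarrow> a i \<le> b i" "disjoint_family_on (\<lambda>i. {a i<..<b i}) I"
  shows "(\<Sum>i\<in>I. integral {a i..b i} (\<lambda>x. \<bar>g x\<bar>))
    \<le> t * (\<Sum>i\<in>I. b i - a i) + t powr (1 - p) * (LINT x|lebesgue. \<bar>g x\<bar> powr p)"
proof -
  have "(\<Sum>i\<in>I. integral {a i..b i} (\<lambda>x. \<bar>g x\<bar>)) \<le>
      (\<Sum>i\<in>I. t * (b i - a i) + t powr (1 - p) * integral {a i..b i} (\<lambda>x. \<bar>g x\<bar> powr p))"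
    by (intro sum_mono Lp_integral_le_young g I)
  also have "\<dots> = t * (\<Sum>i\<in>I. b i - a i)
      + t powr (1 - p) * (\<Sum>i\<in>I. integral {a i..b i} (\<lambda>x. \<bar>g x\<bar> powr p))"
    by (simp add: sum.distrib sum_distrib_left)
  also have "\<dots> \<le> t * (\<Sum>i\<in>I. b i - a i) + t powr (1 - p) * (LINT x|lebesgue. \<bar>g x\<bar> powr p)"
    by (intro add_left_mono mult_left_mono sum_integral_disjoint_le I Lp_integrable[OF g(1)]) auto
  finally show ?thesis .
qed

lemma primitive_abs_diff_le:
  assumes "primitive g G" "\<And>x y. g absolutely_integrable_on {x..y}" "a \<le> b"
  shows "\<bar>G b - G a\<bar> \<le> integral {a..b} (\<lambda>x. \<bar>g x\<bar>)"
proof -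
  have "(g has_integral (G b - G a)) {a..b}" using assms by (simp add: primitive_def)
  moreover have "(\<lambda>x. \<bar>g x\<bar>) integrable_on {a..b}"
    using assms(2)[of a b] by (simp add: absolutely_integrable_on_def)
  ultimately have "norm (integral {a..b} g) \<le> integral {a..b} (\<lambda>x. \<bar>g x\<bar>)"
    by (intro integral_norm_bound_integral) auto
  then show ?thesis using assms primitive_integral by simp
qed

lemma primitive_Lp_absolutely_continuous:
  assumes G: "primitive g G" and g: "g \<in> Lp p" "p > 1"
  shows "absolutely_continuous_on UNIV G"
  unfolding absolutely_continuous_on_def
proof (intro allI impI)
  fix e :: real assume "e > 0"
  then obtain t where t: "t > 0" "t powr (1 - p) * (LINT x|lebesgue. \<bar>g x\<bar> powr p) < e / 2"
    using young_small_exists[OF g(2), of "e / 2"] by auto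
  have bd: "(\<Sum>i<n. \<bar>G (b i) - G (a i)\<bar>) < e"
    if *: "\<forall>i<n. a i \<le> b i \<and> {a i..b i} \<subseteq> UNIV"
      "disjoint_family_on (\<lambda>i. {a i<..<b i}) {..<n}" "(\<Sum>i<n. b i - a i) < e / (2 * t)"
    for n :: nat and a b
  proof -
    have "(\<Sum>i<n. \<bar>G (b i) - G (a i)\<bar>) \<le> (\<Sum>i<n. integral {a i..b i} (\<lambda>x. \<bar>g x\<bar>))"
      using * by (intro sum_mono primitive_abs_diff_le G Lp_interval[OF g]) auto
    also have "\<dots> \<le> t * (\<Sum>i<n. b i - a i) + t powr (1 - p) * (LINT x|lebesgue. \<bar>g x\<bar> powr p)"
      using * by (intro Lp_sum_integral_le_young g t) auto
    also have "t * (\<Sum>i<n. b i - a i) < t * (e / (2 * t))"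
      using * t by (intro mult_strict_left_mono) auto
    also have "t * (e / (2 * t)) = e / 2" using t by simp
    finally show ?thesis using t by linarith
  qed
  show "\<exists>\<delta>>0. \<forall>(n::nat) a b.
           (\<forall>i<n. a i \<le> b i \<and> {a i..b i} \<subseteq> UNIV) \<longrightarrow>
           disjoint_family_on (\<lambda>i. {a i<..<b i}) {..<n} \<longrightarrow>
           (\<Sum>i<n. b i - a i) < \<delta> \<longrightarrow> (\<Sum>i<n. \<bar>G (b i) - G (a i)\<bar>) < e"
  proof (intro exI conjI allI impI)
    show "e / (2 * t) > 0" using \<open>e > 0\<close> t by simp
  qed (rule bd)
qed

lemma absolutely_continuous_imp_continuous:
  assumes "absolutely_continuous_on UNIV G"
  shows "continuous_on UNIV G"
  unfolding continuous_on_iff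
proof (intro ballI allI impI)
  fix x e :: real assume "e > 0"
  then obtain d where d: "d > 0" and
    D: "\<And>(n::nat) a b. (\<forall>i<n. a i \<le> b i \<and> {a i..b i} \<subseteq> UNIV) \<Longrightarrow>
        disjoint_family_on (\<lambda>i. {a i<..<b i}) {..<n} \<Longrightarrow>
        (\<Sum>i<n. b i - a i) < d \<Longrightarrow> (\<Sum>i<n. \<bar>G (b i) - G (a i)\<bar>) < e"
    using assms unfolding absolutely_continuous_on_def by meson
  have inc: "\<bar>G v - G u\<bar> < e" if "u \<le> v" "v - u < d" for u v
    using D[of 1 "\<lambda>_. u" "\<lambda>_. v"] that by (simp add: disjoint_family_on_def)
  have "dist (G y) (G x) < e" if "dist y x < d" for y
    using that inc[of x y] inc[of y x] by (cases "x \<le> y") (simp_all add: dist_real_def abs_minus_commute)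
  then show "\<exists>d>0. \<forall>x'\<in>UNIV. dist x' x < d \<longrightarrow> dist (G x') (G x) < e" using d by blast
qed

text \<open>\<open>weak_deriv\<close> is an arbitrary choice, but any two densities of
  \<open>G\<close> agree almost everywhere, so the seminorm can be computed from whichever density
  is at hand.\<close>

lemma weak_deriv_primitive:
  assumes G: "primitive g G" and g: "g \<in> Lp p" "p > 1"
  shows "Lp_norm p (weak_deriv G) = Lp_norm p g"
proof -
  have "has_weak_derivative G g"
    by (rule primitive_imp_weak_derivative[OF G Lp_interval[OF g]])
  then have "has_weak_derivative G (weak_deriv G)"
    unfolding weak_deriv_def by (rule someI[of "has_weak_derivative G"])
  then have "primitive (weak_deriv G) G"
    by (rule weak_derivative_imp_primitive[OF primitive_continuous_on[OF G]])
  then have ae: "AE x in lebesgue. g x = weak_deriv G x" by (rule primitive_unique_AE[OF G])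
  have m: "g \<in> borel_measurable lebesgue" using g by (simp add: Lp_def)
  have "weak_deriv G \<in> borel_measurable lebesgue"
    using m ae by (rule borel_measurable_AE)
  then have "(LINT x|lebesgue. \<bar>weak_deriv G x\<bar> powr p) = (LINT x|lebesgue. \<bar>g x\<bar> powr p)"
    using ae m by (intro integral_cong_AE) auto
  then show ?thesis by (simp add: Lp_norm_def)
qed

section \<open>Sobolev functions as chains of derivatives ending in a primitive\<close>

lemma sobolev_derivative_chain:
  assumes "F \<in> sobolev m p" "k < m - 1"
  shows "((deriv ^^ k) F has_real_derivative (deriv ^^ Suc k) F x) (at x)"
proof -
  have "(deriv ^^ k) F differentiable_on UNIV" using assms by (simp add: sobolev_def)
  then have "(deriv ^^ k) F differentiable (at x)" by (simp add: differentiable_on_def)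
  then show ?thesis by (simp add: DERIV_deriv_iff_real_differentiable)
qed

lemma sobolev_primitive:
  assumes "F \<in> sobolev m p" "p > 1"
  obtains g where "g \<in> Lp p" "primitive g ((deriv ^^ (m - 1)) F)" "sobolev_seminorm m p F = Lp_norm p g"
proof -
  obtain g where g: "g \<in> Lp p" "has_weak_derivative ((deriv ^^ (m - 1)) F) g"
    and ac: "absolutely_continuous_on UNIV ((deriv ^^ (m - 1)) F)"
    using assms by (auto simp: sobolev_def)
  have pr: "primitive g ((deriv ^^ (m - 1)) F)"
    by (rule weak_derivative_imp_primitive[OF absolutely_continuous_imp_continuous[OF ac] g(2)])
  show ?thesis
    by (rule that[OF g(1) pr]) (simp only: sobolev_seminorm_def weak_deriv_primitive[OF pr g(1) assms(2)])
qed

text \<open>The derivatives are given as separate functions \<open>u k\<close> because the limit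
  construction yields each of them as a limit of its own.\<close>

lemma sobolev_from_jet:
  assumes u: "\<And>k x. k < m - 1 \<Longrightarrow> (u k has_real_derivative u (Suc k) x) (at x)"
    and g: "g \<in> Lp p" "p > 1" "primitive g (u (m - 1))"
  shows "u 0 \<in> sobolev m p" "sobolev_seminorm m p (u 0) = Lp_norm p g"
proof -
  have du: "(deriv ^^ k) (u 0) = u k" if "k \<le> m - 1" for k
    using that
  proof (induction k)
    case (Suc k)
    then have "deriv (u k) = u (Suc k)" by (intro ext DERIV_imp_deriv u) auto
    then show ?case using Suc by simp
  qed simp
  have "u k differentiable_on UNIV" if "k < m - 1" for k
    using u[OF that] by (auto simp: differentiable_on_def real_differentiable_def)
  moreover have "has_weak_derivative (u (m - 1)) g"
    by (rule primitive_imp_weak_derivative[OF g(3) Lp_interval[OF g(1,2)]])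
  ultimately show "u 0 \<in> sobolev m p"
    using du g primitive_Lp_absolutely_continuous[OF g(3,1,2)] by (auto simp: sobolev_def)
  show "sobolev_seminorm m p (u 0) = Lp_norm p g"
    by (simp only: sobolev_seminorm_def du[OF order_refl] weak_deriv_primitive[OF g(3,1,2)])
qed


subsection \<open>Primitives with a density in \<open>L_p\<close>\<close>

text \<open>Nonoverlapping intervals inside a set of measure less than \<open>\<delta>\<close> have
  total length less than \<open>\<delta>\<close>, so the modulus of absolute continuity applies.
  Endpoints cause no loss: \<open>N\<close> is continuous, and closed intervals have mass
  \<open>N b - N a\<close>.\<close>

lemma absolutely_continuous_interval_measure_finite:
  fixes N :: "real \<Rightarrow> real"
  assumes mono: "\<And>x y. x \<le> y \<Longrightarrow> N x \<le> N y" and cont: "continuous_on UNIV N"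
    and bound: "\<And>(n::nat) a b. (\<forall>i<n. a i \<le> b i) \<Longrightarrow> disjoint_family_on (\<lambda>i. {a i<..<b i}) {..<n} \<Longrightarrow>
        (\<Sum>i<n. b i - a i) < \<delta> \<Longrightarrow> (\<Sum>i<n. \<bar>N (b i) - N (a i)\<bar>) < \<epsilon>"
    and D: "finite D" "\<And>K. K \<in> D \<Longrightarrow> \<exists>c d. c < d \<and> K = {c..d}"
      "pairwise (\<lambda>A B. interior A \<inter> interior B = {}) D"
    and U: "\<Union>D \<subseteq> U" "U \<in> sets borel" "emeasure lborel U < ennreal \<delta>"
  shows "emeasure (interval_measure N) (\<Union>D) \<le> ennreal \<epsilon>"
proof -
  obtain h where h: "bij_betw h {0..<card D} D"
    using ex_bij_betw_nat_finite[OF D(1)] by blast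
  define n where "n = card D"
  have hD: "h i \<in> D" if "i < n" for i using h that by (auto simp: bij_betw_def n_def)
  have img: "h ` {..<n} = D" using h by (auto simp: bij_betw_def n_def atLeast0LessThan)
  have inj: "inj_on h {..<n}" using h by (auto simp: bij_betw_def n_def atLeast0LessThan)
  have "\<forall>i. \<exists>c d. i < n \<longrightarrow> c < d \<and> h i = {c..d}" using D(2) hD by blast
  then obtain a b where ab: "\<And>i. i < n \<Longrightarrow> a i < b i \<and> h i = {a i..b i}" by metis
  have disj: "disjoint_family_on (\<lambda>i. {a i<..<b i}) {..<n}"
    unfolding disjoint_family_on_def
  proof (intro ballI impI)
    fix i j assume ij: "i \<in> {..<n}" "j \<in> {..<n}" "i \<noteq> j"
    then have "h i \<noteq> h j" using inj by (auto dest: inj_onD)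
    then have "interior (h i) \<inter> interior (h j) = {}"
      using D(3) hD ij by (auto simp: pairwise_def)
    then show "{a i<..<b i} \<inter> {a j<..<b j} = {}" using ab ij by simp
  qed
  have "ennreal (\<Sum>i<n. b i - a i) = (\<Sum>i<n. ennreal (b i - a i))"
    using ab by (intro sum_ennreal[symmetric]) (auto simp: less_imp_le)
  also have "\<dots> = (\<Sum>i<n. emeasure lborel {a i<..<b i})"
    using ab by (intro sum.cong) (auto simp: less_imp_le)
  also have "\<dots> = emeasure lborel (\<Union>i<n. {a i<..<b i})"
    by (rule sum_emeasure) (auto simp: disj)
  also have "\<dots> \<le> emeasure lborel U"
  proof (rule emeasure_mono)
    have "{a i<..<b i} \<subseteq> U" if "i < n" for i
      using hD[OF that] ab[OF that] U(1) by force
    then show "(\<Union>i<n. {a i<..<b i}) \<subseteq> U" by blast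
  qed (use U in simp)
  also have "\<dots> < ennreal \<delta>" by (rule U)
  finally have "(\<Sum>i<n. b i - a i) < \<delta>"
    using ab by (subst (asm) ennreal_less_iff) (auto intro!: sum_nonneg simp: less_imp_le)
  then have sm: "(\<Sum>i<n. \<bar>N (b i) - N (a i)\<bar>) < \<epsilon>"
    using ab by (intro bound disj) (auto simp: less_imp_le)
  have "emeasure (interval_measure N) (\<Union>D) = emeasure (interval_measure N) (\<Union>i<n. {a i..b i})"
    using ab by (simp flip: img)
  also have "\<dots> \<le> (\<Sum>i<n. emeasure (interval_measure N) {a i..b i})"
    by (rule emeasure_subadditive_finite) auto
  also have "\<dots> = (\<Sum>i<n. ennreal (N (b i) - N (a i)))"
    using ab by (intro sum.cong emeasure_interval_measure_Icc mono cont) (auto simp: less_imp_le)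
  also have "\<dots> = ennreal (\<Sum>i<n. N (b i) - N (a i))"
    using ab mono by (intro sum_ennreal) (auto simp: less_imp_le)
  also have "\<dots> \<le> ennreal \<epsilon>"
  proof (rule ennreal_leI)
    have "(\<Sum>i<n. N (b i) - N (a i)) \<le> (\<Sum>i<n. \<bar>N (b i) - N (a i)\<bar>)" by (rule sum_mono) simp
    then show "(\<Sum>i<n. N (b i) - N (a i)) \<le> \<epsilon>" using sm by linarith
  qed
  finally show ?thesis .
qed

text \<open>A bounded null set lies in an open set of measure less than \<open>\<delta>\<close> and
  is covered there by countably many nonoverlapping intervals. Finite subfamilies have mass at most
  \<open>\<epsilon>\<close>, hence so does their union. A general null set is a countable union of
  bounded ones.\<close>

lemma absolutely_continuous_interval_measure:
  fixes N :: "real \<Rightarrow> real"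
  assumes mono: "\<And>x y. x \<le> y \<Longrightarrow> N x \<le> N y" and ac: "absolutely_continuous_on UNIV N"
  shows "absolutely_continuous lborel (interval_measure N)"
proof -
  let ?\<mu> = "interval_measure N"
  have cont: "continuous_on UNIV N" by (rule absolutely_continuous_imp_continuous[OF ac])
  have small: "emeasure ?\<mu> A = 0" if A: "A \<in> null_sets lborel" "A \<subseteq> {-r..r}" for A r
  proof -
    have le: "emeasure ?\<mu> A \<le> ennreal \<epsilon>" if "\<epsilon> > 0" for \<epsilon>
    proof -
      obtain \<delta> where \<delta>: "\<delta> > 0" and
        bound: "\<And>(n::nat) a b. (\<forall>i<n. a i \<le> b i \<and> {a i..b i} \<subseteq> UNIV) \<Longrightarrow>
          disjoint_family_on (\<lambda>i. {a i<..<b i}) {..<n} \<Longrightarrow>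
          (\<Sum>i<n. b i - a i) < \<delta> \<Longrightarrow> (\<Sum>i<n. \<bar>N (b i) - N (a i)\<bar>) < \<epsilon>"
        using ac \<open>\<epsilon> > 0\<close> unfolding absolutely_continuous_on_def by meson
      have bound': "(\<Sum>i<n. \<bar>N (b i) - N (a i)\<bar>) < \<epsilon>"
        if "\<forall>i<n. a i \<le> b i" "disjoint_family_on (\<lambda>i. {a i<..<b i}) {..<n}" "(\<Sum>i<n. b i - a i) < \<delta>"
        for n :: nat and a b using that by (intro bound) auto
      have Ab: "A \<in> sets borel" and A0: "emeasure lborel A = 0" using A by auto
      have "A \<in> sets lebesgue" using Ab by simp
      from sets_lebesgue_outer_open[OF this \<delta>] obtain T where
        T: "open T" "A \<subseteq> T" "emeasure lebesgue (T - A) < ennreal \<delta>" by metis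
      have "emeasure lborel T = emeasure lborel (A \<union> (T - A))" using T(2) by (simp add: Un_absorb1)
      also have "\<dots> = emeasure lborel (T - A)"
        using emeasure_Un_null_set[of "T - A" lborel A] A T(1) Ab by (simp add: Un_commute)
      also have "\<dots> = emeasure lebesgue (T - A)" using T(1) Ab by simp
      finally have Tm: "emeasure lborel T < ennreal \<delta>" using T(3) by simp
      \<comment> \<open>With this gauge, an interval from the covering lemma lies in
        \<open>T\<close>, because it is subordinate to one of its points in \<open>A\<close>, a
        subset of \<open>T\<close>.\<close>
      define g where "g x = (if x \<in> T then T else UNIV)" for x :: real
      have "gauge g" using T(1) by (auto simp: gauge_def g_def)
      moreover have "A \<subseteq> cbox (- \<bar>r\<bar> - 1) (\<bar>r\<bar> + 1)" using A(2) by force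
      moreover have "box (- \<bar>r\<bar> - 1) (\<bar>r\<bar> + 1) \<noteq> {}" by simp
      ultimately obtain D where D: "countable D"
        "\<And>K. K \<in> D \<Longrightarrow> interior K \<noteq> {} \<and> (\<exists>c d. K = cbox c d)"
        "pairwise (\<lambda>A B. interior A \<inter> interior B = {}) D"
        "\<And>K. K \<in> D \<Longrightarrow> \<exists>x \<in> A \<inter> K. K \<subseteq> g x" "A \<subseteq> \<Union>D"
        using covering_lemma[of A "- \<bar>r\<bar> - 1" "\<bar>r\<bar> + 1" g] by metis
      have DT: "\<Union>D \<subseteq> T" using D(4) T(2) unfolding g_def by force
      have Dint: "\<exists>c d. c < d \<and> K = {c..d}" if "K \<in> D" for K
      proof -
        from D(2)[OF that] obtain c d where "K = cbox c d" "interior K \<noteq> {}" by blast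
        then show ?thesis by (intro exI[of _ c] exI[of _ d]) simp
      qed
      have fin: "emeasure ?\<mu> (\<Union>D') \<le> ennreal \<epsilon>" if "finite D'" "D' \<subseteq> D" for D'
      proof (rule absolutely_continuous_interval_measure_finite[where U = T and \<delta> = \<delta>, OF mono cont bound'])
        show "\<And>K. K \<in> D' \<Longrightarrow> \<exists>c d. c < d \<and> K = {c..d}" using Dint that(2) by blast
        show "pairwise (\<lambda>A B. interior A \<inter> interior B = {}) D'" by (rule pairwise_subset[OF D(3) that(2)])
        show "\<Union>D' \<subseteq> T" using DT that(2) by blast
      qed (use that(1) T(1) Tm in auto)
      show ?thesis
      proof (cases "D = {}")
        case True
        then show ?thesis using D(5) by simp
      next
        case False
        \<comment> \<open>Unions over initial segments of an enumeration, so that continuity from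
          below transfers the bound from finite subfamilies to \<open>D\<close>.\<close>
        define S where "S n = \<Union>(from_nat_into D ` {..n})" for n
        have Dn: "from_nat_into D ` {..n} \<subseteq> D" for n
          using from_nat_into[OF False] by blast
        have "(SUP n. emeasure ?\<mu> (S n)) = emeasure ?\<mu> (\<Union>n. S n)"
        proof (rule SUP_emeasure_incseq)
          have "S n \<in> sets ?\<mu>" for n
            unfolding S_def using Dn[of n] Dint by (intro sets.finite_Union) (auto, metis atLeastAtMost_borel subsetD imageI atMost_iff)
          then show "range S \<subseteq> sets ?\<mu>" by blast
          show "incseq S" unfolding incseq_def S_def by (intro allI impI Union_mono image_mono) auto
        qed
        moreover have "(\<Union>n. S n) = \<Union>D"
        proof -
          have "(\<Union>n. from_nat_into D ` {..n}) = range (from_nat_into D)" by blast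
          also have "\<dots> = D" by (rule range_from_nat_into[OF False D(1)])
          finally have r: "(\<Union>n. from_nat_into D ` {..n}) = D" .
          have "(\<Union>n. S n) = \<Union>(\<Union>n. from_nat_into D ` {..n})" by (auto simp: S_def)
          then show ?thesis by (simp only: r)
        qed
        moreover have "(SUP n. emeasure ?\<mu> (S n)) \<le> ennreal \<epsilon>"
          unfolding S_def by (intro SUP_least fin Dn) auto
        moreover have "emeasure ?\<mu> A \<le> emeasure ?\<mu> (\<Union>D)"
        proof (rule emeasure_mono[OF D(5)])
          have "K \<in> sets borel" if "K \<in> D" for K using Dint[OF that] by auto
          then show "\<Union>D \<in> sets ?\<mu>" using D(1) by (simp add: sets.countable_Union subset_eq)
        qed
        ultimately show ?thesis by simp
      qed
    qed
    have "emeasure ?\<mu> A \<le> 0"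
    proof (rule ennreal_le_epsilon)
      fix e :: real assume "0 < e"
      then show "emeasure ?\<mu> A \<le> 0 + ennreal e" using le[of e] by simp
    qed
    then show ?thesis by simp
  qed
  show ?thesis
    unfolding absolutely_continuous_def
  proof
    fix A :: "real set" assume A: "A \<in> null_sets lborel"
    have "emeasure ?\<mu> (\<Union>n. A \<inter> {-real n..real n}) = 0"
    proof (rule emeasure_UN_eq_0)
      fix n
      show "emeasure ?\<mu> (A \<inter> {-real n..real n}) = 0"
        by (rule small[of _ "real n"]) (use A in \<open>auto intro: null_set_Int2\<close>)
    qed (use A in auto)
    moreover have "(\<Union>n. A \<inter> {-real n..real n}) = A"
    proof -
      have "\<exists>n. x \<in> {-real n..real n}" for x :: real
      proof -
        obtain n where "\<bar>x\<bar> \<le> real n" using real_arch_simple by blast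
        then have "x \<in> {-real n..real n}" by (simp add: abs_le_iff)
        then show ?thesis by blast
      qed
      then show ?thesis by blast
    qed
    ultimately show "A \<in> null_sets ?\<mu>" using A by (auto simp: null_sets_def)
  qed
qed

text \<open>The density is the Radon-Nikodym derivative of the Stieltjes measure of \<open>N\<close>
  with respect to Lebesgue measure.\<close>

lemma monotone_absolutely_continuous_primitive:
  fixes N :: "real \<Rightarrow> real"
  assumes mono: "\<And>x y. x \<le> y \<Longrightarrow> N x \<le> N y" and ac: "absolutely_continuous_on UNIV N"
  obtains n where "n \<in> borel_measurable borel" "\<And>x. n x \<ge> 0" "primitive n N"
proof -
  have cont: "continuous_on UNIV N" by (rule absolutely_continuous_imp_continuous[OF ac])
  obtain f where f: "f \<in> borel_measurable lborel" "density lborel f = interval_measure N"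
    using sigma_finite_measure.Radon_Nikodym[OF sigma_finite_lborel absolutely_continuous_interval_measure[OF mono ac]]
    by auto
  have fI: "(\<integral>\<^sup>+x. f x * indicator {a..b} x \<partial>lborel) = ennreal (N b - N a)" if "a \<le> b" for a b
  proof -
    have "emeasure (density lborel f) {a..b} = ennreal (N b - N a)"
      unfolding f(2) by (rule emeasure_interval_measure_Icc[OF that mono cont])
    then show ?thesis using f(1) by (simp add: emeasure_density)
  qed
  have fin: "AE x in lborel. f x * indicator {a..b} x \<noteq> \<infinity>" if "a \<le> b" for a b
    using f(1) fI[OF that] by (intro nn_integral_PInf_AE) auto
  \<comment> \<open>\<open>enn2real\<close> sends infinite values to 0; by \<open>fin\<close> these
    occur only on a null set in each interval, so the integrals are unchanged.\<close>
  define n where "n = (\<lambda>x. enn2real (f x))"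
  have nb: "n \<in> borel_measurable borel" using f(1) unfolding n_def by simp
  have "(n has_integral (N y - N x)) {x..y}" if "x \<le> y" for x y
  proof -
    have "(\<integral>\<^sup>+s. ennreal (n s * indicator {x..y} s) \<partial>lborel) = (\<integral>\<^sup>+s. f s * indicator {x..y} s \<partial>lborel)"
      using fin[OF that]
    proof (intro nn_integral_cong_AE, elim eventually_mono)
      fix s assume "f s * indicator {x..y} s \<noteq> \<infinity>"
      then show "ennreal (n s * indicator {x..y} s) = f s * indicator {x..y} s"
        by (auto simp: n_def indicator_def ennreal_enn2real less_top)
    qed
    also have "\<dots> = ennreal (N y - N x)" by (rule fI[OF that])
    finally have "((\<lambda>s. n s * indicator {x..y} s) has_integral (N y - N x)) UNIV"
      using mono[OF that] nb by (intro nn_integral_has_integral) (auto simp: n_def)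
    moreover have "(\<lambda>s. n s * indicator {x..y} s) = (\<lambda>s. if s \<in> {x..y} then n s else 0)"
      by (auto simp: indicator_def)
    ultimately show ?thesis using has_integral_restrict_UNIV[of "{x..y}" n] by simp
  qed
  then show ?thesis
    using nb by (intro that[of n]) (auto simp: n_def primitive_def)
qed

text \<open>Both \<open>N\<close> and \<open>N + G\<close> are nondecreasing and absolutely
  continuous; the difference of their densities is a density of \<open>G\<close>.\<close>

lemma dominated_increments_primitive:
  fixes G N :: "real \<Rightarrow> real"
  assumes le: "\<And>x y. x \<le> y \<Longrightarrow> \<bar>G y - G x\<bar> \<le> N y - N x" and ac: "absolutely_continuous_on UNIV N"
  shows "\<exists>g. g \<in> borel_measurable borel \<and> primitive g G"
proof -
  have Nm: "N x \<le> N y" if "x \<le> y" for x y using le[OF that] by linarith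
  have Pm: "N x + G x \<le> N y + G y" if "x \<le> y" for x y using le[OF that] by linarith
  have Pac: "absolutely_continuous_on UNIV (\<lambda>x. N x + G x)"
    unfolding absolutely_continuous_on_def
  proof (intro allI impI)
    fix e :: real assume "e > 0"
    then have "e / 2 > 0" by simp
    then obtain \<delta> where \<delta>: "\<delta> > 0" and
      bound: "\<And>(n::nat) a b. (\<forall>i<n. a i \<le> b i \<and> {a i..b i} \<subseteq> UNIV) \<Longrightarrow>
        disjoint_family_on (\<lambda>i. {a i<..<b i}) {..<n} \<Longrightarrow>
        (\<Sum>i<n. b i - a i) < \<delta> \<Longrightarrow> (\<Sum>i<n. \<bar>N (b i) - N (a i)\<bar>) < e / 2"
      using ac unfolding absolutely_continuous_on_def by meson
    show "\<exists>\<delta>>0. \<forall>(n::nat) a b.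
           (\<forall>i<n. a i \<le> b i \<and> {a i..b i} \<subseteq> UNIV) \<longrightarrow>
           disjoint_family_on (\<lambda>i. {a i<..<b i}) {..<n} \<longrightarrow>
           (\<Sum>i<n. b i - a i) < \<delta> \<longrightarrow> (\<Sum>i<n. \<bar>N (b i) + G (b i) - (N (a i) + G (a i))\<bar>) < e"
    proof (intro exI conjI allI impI)
      fix n :: nat and a b
      assume *: "\<forall>i<n. a i \<le> b i \<and> {a i..b i} \<subseteq> UNIV" "disjoint_family_on (\<lambda>i. {a i<..<b i}) {..<n}"
        "(\<Sum>i<n. b i - a i) < \<delta>"
      have "\<bar>N (b i) + G (b i) - (N (a i) + G (a i))\<bar> \<le> 2 * \<bar>N (b i) - N (a i)\<bar>" if "i < n" for i
        using le[of "a i" "b i"] *(1) that by fastforce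
      then have "(\<Sum>i<n. \<bar>N (b i) + G (b i) - (N (a i) + G (a i))\<bar>) \<le> (\<Sum>i<n. 2 * \<bar>N (b i) - N (a i)\<bar>)"
        by (intro sum_mono) auto
      also have "\<dots> = 2 * (\<Sum>i<n. \<bar>N (b i) - N (a i)\<bar>)" by (simp add: sum_distrib_left)
      also have "\<dots> < e" using bound[OF *] by simp
      finally show "(\<Sum>i<n. \<bar>N (b i) + G (b i) - (N (a i) + G (a i))\<bar>) < e" .
    qed (rule \<delta>)
  qed
  obtain n where n: "n \<in> borel_measurable borel" "\<And>x. n x \<ge> 0" "primitive n N"
    using monotone_absolutely_continuous_primitive[OF Nm ac] by blast
  obtain q where q: "q \<in> borel_measurable borel" "\<And>x. q x \<ge> 0" "primitive q (\<lambda>x. N x + G x)"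
    using monotone_absolutely_continuous_primitive[OF Pm Pac] by blast
  show ?thesis
  proof (intro exI[of _ "\<lambda>x. q x - n x"] conjI)
    show "(\<lambda>x. q x - n x) \<in> borel_measurable borel" using n q by simp
    show "primitive (\<lambda>x. q x - n x) G"
      unfolding primitive_def
    proof (intro allI impI)
      fix x y :: real assume "x \<le> y"
      then have "((\<lambda>x. q x - n x) has_integral ((N y + G y - (N x + G x)) - (N y - N x))) {x..y}"
        using n(3) q(3) unfolding primitive_def by (intro has_integral_diff) auto
      then show "((\<lambda>x. q x - n x) has_integral (G y - G x)) {x..y}" by simp
    qed
  qed
qed

text \<open>After the shift by \<open>h\<close> all but the two ends cancel: the integral is the
  average of \<open>M\<close> over {b..b + h} minus that over {a..a + h}, at most
  \<open>M (b + h) - M a\<close>.\<close>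

lemma mono_difference_quotient_nn_integral_le:
  fixes M :: "real \<Rightarrow> real"
  assumes mono: "\<And>x y. x \<le> y \<Longrightarrow> M x \<le> M y" and bd: "\<And>x y. x \<le> y \<Longrightarrow> M y - M x \<le> \<Lambda>"
    and h: "h > 0" and ab: "a \<le> b"
  shows "(\<integral>\<^sup>+x. ennreal (indicator {a..b} x * ((M (x + h) - M x) / h)) \<partial>lborel) \<le> ennreal \<Lambda>"
proof -
  have iM: "M integrable_on {x..y}" for x y
    by (intro integrable_on_mono_on mono_onI mono)
  let ?I = "\<lambda>x y. integral {x..y} M"
  have "(M has_integral ?I (a + h) (b + h)) (cbox (a + h) (b + h))"
    using iM by (simp add: integrable_integral)
  from has_integral_affinity[OF this, of 1 h]
  have "((\<lambda>x. M (x + h)) has_integral ?I (a + h) (b + h)) ((\<lambda>x. x - h) ` {a + h..b + h})" by simp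
  moreover have "(\<lambda>x. x - h) ` {a + h..b + h} = {a..b}"
    using image_add_atLeastAtMost[of "-h" "a + h" "b + h"] by simp
  ultimately have "((\<lambda>x. M (x + h)) has_integral ?I (a + h) (b + h)) {a..b}" by simp
  then have "((\<lambda>x. (M (x + h) - M x) / h) has_integral (?I (a + h) (b + h) - ?I a b) / h) {a..b}"
    by (intro has_integral_divide has_integral_diff integrable_integral iM)
  then have "(\<integral>\<^sup>+x. ennreal (indicator {a..b} x * ((M (x + h) - M x) / h)) \<partial>lborel)
      = ennreal ((?I (a + h) (b + h) - ?I a b) / h)"
    using mono h by (intro nn_integral_has_integral_lebesgue) auto
  also have "\<dots> \<le> ennreal \<Lambda>"
  proof (rule ennreal_leI)
    have "?I a (a + h) + ?I (a + h) (b + h) = ?I a (b + h)"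
      using h ab by (intro Henstock_Kurzweil_Integration.integral_combine iM) auto
    moreover have "?I a b + ?I b (b + h) = ?I a (b + h)"
      using h ab by (intro Henstock_Kurzweil_Integration.integral_combine iM) auto
    moreover have "?I b (b + h) \<le> M (b + h) * h"
      using has_integral_le[OF integrable_integral[OF iM[of b "b + h"]] has_integral_const_real[of "M (b + h)" b "b + h"]] h mono
      by (simp add: mult.commute)
    moreover have "M a * h \<le> ?I a (a + h)"
      using has_integral_le[OF has_integral_const_real[of "M a" a "a + h"] integrable_integral[OF iM[of a "a + h"]]] h mono
      by (simp add: mult.commute)
    ultimately have "?I (a + h) (b + h) - ?I a b \<le> (M (b + h) - M a) * h"
      by (simp add: algebra_simps)
    also have "\<dots> \<le> \<Lambda> * h" using bd[of a "b + h"] h ab by (intro mult_right_mono) auto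
    finally show "(?I (a + h) (b + h) - ?I a b) / h \<le> \<Lambda>" using h by (simp add: field_simps)
  qed
  finally show ?thesis .
qed

text \<open>Optimizing \<open>t\<close> bounds the p-th power of a difference quotient of
  \<open>G\<close> by \<open>2 powr p\<close> times the difference quotient of \<open>M\<close>,
  whose integral is at most \<open>\<Lambda>\<close>. The difference quotients of \<open>G\<close>
  converge to \<open>g\<close> almost everywhere, and Fatou's lemma transfers the bound to
  \<open>g\<close>.\<close>

lemma primitive_Lp_of_young:
  fixes G M g :: "real \<Rightarrow> real"
  assumes g: "g \<in> borel_measurable borel" "primitive g G" and p: "p > 1"
    and mono: "\<And>x y. x \<le> y \<Longrightarrow> M x \<le> M y" and bd: "\<And>x y. x \<le> y \<Longrightarrow> M y - M x \<le> \<Lambda>"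
    and young: "\<And>x y t. x < y \<Longrightarrow> t > 0 \<Longrightarrow> \<bar>G y - G x\<bar> \<le> t * (y - x) + t powr (1 - p) * (M y - M x)"
  shows "g \<in> Lp p" "(LINT x|lebesgue. \<bar>g x\<bar> powr p) \<le> 2 powr p * \<Lambda>"
proof -
  define h where "h n = 1 / real (Suc n)" for n
  have h: "h n > 0" for n by (simp add: h_def)
  define q where "q n x = \<bar>(G (x + h n) - G x) / h n\<bar> powr p" for n x
  \<comment> \<open>The cut-off to {-n..n} matches the bound for compact intervals, which is
    independent of the interval; the cut-off disappears in the limit.\<close>
  define u where "u n x = ennreal (indicator {-real n..real n} x * q n x)" for n x
  have \<Lambda>: "\<Lambda> \<ge> 0" using bd[of 0 0] by simp
  have q_le: "q n x \<le> 2 powr p * ((M (x + h n) - M x) / h n)" for n x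
  proof -
    have "\<bar>G (x + h n) - G x\<bar> powr p \<le> 2 powr p * h n powr (p - 1) * (M (x + h n) - M x)"
      using young[of x "x + h n"] h[of n] mono[of x "x + h n"] p by (intro powr_le_of_young) auto
    then have "\<bar>G (x + h n) - G x\<bar> powr p / h n powr p \<le>
        2 powr p * h n powr (p - 1) * (M (x + h n) - M x) / h n powr p"
      using h[of n] by (intro divide_right_mono) auto
    also have "\<dots> = 2 powr p * ((M (x + h n) - M x) / h n)"
      using h[of n] by (simp add: powr_diff)
    also have "\<bar>G (x + h n) - G x\<bar> powr p / h n powr p = q n x"
      using h[of n] by (simp add: q_def powr_divide)
    finally show ?thesis .
  qed
  have contG: "continuous_on A G" for A by (rule primitive_continuous_on[OF g(2)])
  have contGh: "continuous_on UNIV (\<lambda>x. G (x + h n))" for n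
    by (rule continuous_on_compose2[OF contG[of UNIV]]) (auto intro!: continuous_intros)
  have "G \<in> borel_measurable borel" "(\<lambda>x. G (x + h n)) \<in> borel_measurable borel" for n
    by (intro borel_measurable_continuous_onI contG contGh)+
  then have qm: "q n \<in> borel_measurable borel" for n unfolding q_def by measurable
  then have um: "u n \<in> borel_measurable borel" for n unfolding u_def by measurable
  have u_int: "(\<integral>\<^sup>+x. u n x \<partial>lborel) \<le> ennreal (2 powr p * \<Lambda>)" for n
  proof -
    have "(\<integral>\<^sup>+x. u n x \<partial>lborel) \<le>
        (\<integral>\<^sup>+x. ennreal (2 powr p) * ennreal (indicator {-real n..real n} x * ((M (x + h n) - M x) / h n)) \<partial>lborel)"
    proof (rule nn_integral_mono)
      fix x :: real
      show "u n x \<le> ennreal (2 powr p) * ennreal (indicator {-real n..real n} x * ((M (x + h n) - M x) / h n))"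
        using q_le[of n x] by (auto simp: u_def indicator_def ennreal_leI simp flip: ennreal_mult')
    qed
    also have "\<dots> = ennreal (2 powr p) * (\<integral>\<^sup>+x. ennreal (indicator {-real n..real n} x * ((M (x + h n) - M x) / h n)) \<partial>lborel)"
    proof (rule nn_integral_cmult)
      have "M \<in> borel_measurable borel" by (intro borel_measurable_mono monoI mono)
      then show "(\<lambda>x. ennreal (indicator {-real n..real n} x * ((M (x + h n) - M x) / h n))) \<in> borel_measurable lborel"
        by measurable
    qed
    also have "\<dots> \<le> ennreal (2 powr p) * ennreal \<Lambda>"
      using h by (intro mult_left_mono mono_difference_quotient_nn_integral_le mono bd) auto
    finally show ?thesis by (simp add: ennreal_mult')
  qed
  have gi: "g integrable_on cbox a b" for a b
    using g(2) unfolding primitive_def by (cases "a \<le> b") (auto simp: integrable_on_def)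
  obtain N where N: "negligible N" "\<And>x e. \<lbrakk>x \<notin> N; 0 < e\<rbrakk> \<Longrightarrow>
      \<exists>d>0. \<forall>k. 0 < k \<and> k < d \<longrightarrow> norm (integral (cbox x (x + k *\<^sub>R One)) g /\<^sub>R k ^ DIM(real) - g x) < e"
    using integrable_ccontinuous_explicit[OF gi] by blast
  have lim: "(\<lambda>n. (G (x + h n) - G x) / h n) \<longlonglongrightarrow> g x" if "x \<notin> N" for x
  proof (rule LIMSEQ_I)
    fix e :: real assume "e > 0"
    from N(2)[OF that this] obtain d where d: "d > 0"
      "\<And>k. 0 < k \<Longrightarrow> k < d \<Longrightarrow> norm (integral (cbox x (x + k *\<^sub>R One)) g /\<^sub>R k ^ DIM(real) - g x) < e" by blast
    obtain n0 where n0: "h n0 < d" using nat_approx_posE[OF d(1)] by (auto simp: h_def)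
    have "norm ((G (x + h n) - G x) / h n - g x) < e" if "n \<ge> n0" for n
    proof -
      have "h n \<le> h n0" using that by (simp add: h_def frac_le)
      then have "norm (integral {x..x + h n} g /\<^sub>R h n - g x) < e" using d(2)[OF h, of n] n0 by simp
      moreover have "integral {x..x + h n} g = G (x + h n) - G x"
        using h[of n] by (intro primitive_integral[OF g(2)]) simp
      ultimately show ?thesis by (simp add: divide_inverse_commute)
    qed
    then show "\<exists>no. \<forall>n\<ge>no. norm ((G (x + h n) - G x) / h n - g x) < e" by blast
  qed
  have liminf: "liminf (\<lambda>n. u n x) = ennreal (\<bar>g x\<bar> powr p)" if "x \<notin> N" for x
  proof (rule lim_imp_Liminf)
    have "(\<lambda>n. q n x) \<longlonglongrightarrow> \<bar>g x\<bar> powr p"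
      unfolding q_def by (intro tendsto_powr' tendsto_rabs lim that tendsto_const) (use p in auto)
    then have "(\<lambda>n. ennreal (q n x)) \<longlonglongrightarrow> ennreal (\<bar>g x\<bar> powr p)" by (rule tendsto_ennrealI)
    moreover have "eventually (\<lambda>n. ennreal (q n x) = u n x) sequentially"
    proof -
      obtain k where k: "\<bar>x\<bar> \<le> real k" using real_arch_simple by blast
      have "ennreal (q n x) = u n x" if "n \<ge> k" for n
      proof -
        have "x \<in> {-real n..real n}" using k that by (auto simp: abs_le_iff)
        then show ?thesis by (simp add: u_def)
      qed
      then show ?thesis by (auto simp: eventually_sequentially)
    qed
    ultimately show "(\<lambda>n. u n x) \<longlonglongrightarrow> ennreal (\<bar>g x\<bar> powr p)" by (rule Lim_transform_eventually)
  qed simp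
  have leb: "f \<in> borel_measurable lebesgue" if "f \<in> borel_measurable borel"
    for f :: "real \<Rightarrow> 'c::topological_space"
    using that by (simp add: measurable_completion)
  have "AE x in lebesgue. x \<notin> N"
    using N(1) by (simp add: negligible_iff_null_sets AE_not_in)
  then have "(\<integral>\<^sup>+x. ennreal (\<bar>g x\<bar> powr p) \<partial>lebesgue) = (\<integral>\<^sup>+x. liminf (\<lambda>n. u n x) \<partial>lebesgue)"
    by (intro nn_integral_cong_AE) (auto simp: liminf)
  also have "\<dots> \<le> liminf (\<lambda>n. \<integral>\<^sup>+x. u n x \<partial>lebesgue)"
    by (intro nn_integral_liminf leb um)
  also have "\<dots> \<le> liminf (\<lambda>n. ennreal (2 powr p * \<Lambda>))"
    using u_int um by (intro Liminf_mono) (simp add: nn_integral_completion)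
  also have "\<dots> = ennreal (2 powr p * \<Lambda>)" by (simp add: Liminf_const)
  finally have nn: "(\<integral>\<^sup>+x. ennreal (\<bar>g x\<bar> powr p) \<partial>lebesgue) \<le> ennreal (2 powr p * \<Lambda>)" .
  have gm: "g \<in> borel_measurable lebesgue" by (rule leb[OF g(1)])
  have int: "integrable lebesgue (\<lambda>x. \<bar>g x\<bar> powr p)"
  proof (rule integrableI_nonneg)
    show "(\<integral>\<^sup>+x. ennreal (\<bar>g x\<bar> powr p) \<partial>lebesgue) < \<infinity>"
      using nn by (rule le_less_trans) simp
  qed (use gm in auto)
  then show "g \<in> Lp p" using gm by (simp add: Lp_def)
  have "ennreal (LINT x|lebesgue. \<bar>g x\<bar> powr p) \<le> ennreal (2 powr p * \<Lambda>)"
    using nn nn_integral_eq_integral[OF int] by simp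
  then show "(LINT x|lebesgue. \<bar>g x\<bar> powr p) \<le> 2 powr p * \<Lambda>"
    using \<Lambda> by simp
qed


subsection \<open>Interpolation\<close>

text \<open>Induction removes the largest zero. The zero that Rolle's theorem adds lies beyond the
  second largest one, hence to the right of all zeros found before.\<close>

lemma derivative_zeros:
  fixes f f' :: "real \<Rightarrow> real"
  assumes "\<And>x. (f has_real_derivative f' x) (at x)"
    and "finite A" "card A = Suc n" "A \<subseteq> {a..b}" "\<And>x. x \<in> A \<Longrightarrow> f x = 0"
  shows "\<exists>B. finite B \<and> card B = n \<and> B \<subseteq> {a..b} \<and> (\<forall>x\<in>B. f' x = 0)"
  using assms(2-)
proof (induction n arbitrary: A b)
  case 0
  then show ?case by (intro exI[of _ "{}"]) auto
next
  case (Suc n)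
  define M where "M = Max A"
  define A0 where "A0 = A - {M}"
  define M0 where "M0 = Max A0"
  have "A \<noteq> {}" using Suc.prems by auto
  then have M: "M \<in> A" using Suc.prems(1) by (simp add: M_def)
  have A0: "finite A0" "card A0 = Suc n" using Suc.prems M by (auto simp: A0_def)
  then have "A0 \<noteq> {}" by auto
  then have M0: "M0 \<in> A0" using A0(1) by (simp add: M0_def)
  have "M0 < M"
    using M0 Suc.prems(1) unfolding A0_def M_def by (metis DiffE Max_ge order_less_le singletonI)
  have "A0 \<subseteq> {a..M0}"
    using Suc.prems(3) Max_ge[OF A0(1)] unfolding A0_def M0_def by fastforce
  then obtain B where B: "finite B" "card B = n" "B \<subseteq> {a..M0}" "\<forall>x\<in>B. f' x = 0"
    using Suc.IH[OF A0, of M0] Suc.prems(4) by (auto simp: A0_def)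
  have "f M0 = f M" using Suc.prems(4) M M0 by (simp add: A0_def)
  moreover have "continuous_on {M0..M} f"
    by (meson DERIV_isCont assms(1) continuous_at_imp_continuous_on)
  ultimately obtain z where z: "M0 < z" "z < M" "(f has_real_derivative 0) (at z)"
    using Rolle[OF \<open>M0 < M\<close>] assms(1) by (metis real_differentiable_def)
  have "f' z = 0" using z(3) assms(1) DERIV_unique by blast
  moreover have "z \<notin> B" using B(3) z(1) by auto
  moreover have "M \<le> b" "a \<le> M0" using Suc.prems(3) M M0 by (auto simp: A0_def)
  ultimately show ?case
    using B z by (intro exI[of _ "insert z B"]) (force simp: subset_iff)
qed

text \<open>Each differentiation loses one zero, so one is left for every order up to
  \<open>n\<close>. Order \<open>n\<close> yields the mean value form of divided differences; the
  lower orders are used when two extensions are compared.\<close>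

lemma higher_derivative_zero:
  fixes u :: "nat \<Rightarrow> real \<Rightarrow> real"
  assumes u: "\<And>k x. k < n \<Longrightarrow> (u k has_real_derivative u (Suc k) x) (at x)"
    and A: "finite A" "card A = Suc n" "A \<subseteq> {a..b}" "\<And>x. x \<in> A \<Longrightarrow> u 0 x = 0"
    and "k \<le> n"
  shows "\<exists>z\<in>{a..b}. u k z = 0"
proof -
  have "\<exists>B. finite B \<and> card B = Suc n - k \<and> B \<subseteq> {a..b} \<and> (\<forall>x\<in>B. u k x = 0)"
    using \<open>k \<le> n\<close>
  proof (induction k)
    case 0
    then show ?case using A by (intro exI[of _ A]) auto
  next
    case (Suc k)
    then obtain B where B: "finite B" "card B = Suc (n - k)" "B \<subseteq> {a..b}" "\<forall>x\<in>B. u k x = 0"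
      by (auto simp: Suc_diff_le)
    then show ?case
      using derivative_zeros[of "u k" "u (Suc k)" B "n - k"] u Suc.prems by simp
  qed
  then obtain B where B: "card B = Suc n - k" "B \<subseteq> {a..b}" "\<forall>x\<in>B. u k x = 0" by blast
  then have "B \<noteq> {}" using \<open>k \<le> n\<close> by auto
  then show ?thesis using B by blast
qed

lemma poly_higher_pderiv_degree_le:
  fixes P :: "real poly"
  assumes "degree P \<le> n"
  shows "poly ((pderiv ^^ n) P) x = fact n * coeff P n"
proof -
  have "degree ((pderiv ^^ n) P) = 0" using assms by (simp add: degree_higher_pderiv)
  then obtain c where c: "(pderiv ^^ n) P = [:c:]" by (rule degree_eq_zeroE)
  then have "c = coeff ((pderiv ^^ n) P) 0" by simp
  also have "\<dots> = fact n * coeff P n" by (simp add: coeff_higher_pderiv pochhammer_fact)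
  finally show ?thesis by (simp add: c)
qed

lemma poly_funpow_pderiv_has_derivative:
  "((\<lambda>x. poly ((pderiv ^^ k) P) x) has_real_derivative poly ((pderiv ^^ Suc k) P) x) (at x)"
  using poly_DERIV[of "(pderiv ^^ k) P" x] by simp

text \<open>The mean value theorem for divided differences: Rolle's theorem is applied to the
  difference between \<open>u 0\<close> and its interpolating polynomial.\<close>

lemma leading_coefficient_mvt:
  fixes u :: "nat \<Rightarrow> real \<Rightarrow> real"
  assumes u: "\<And>k x. k < n \<Longrightarrow> (u k has_real_derivative u (Suc k) x) (at x)"
    and P: "degree P \<le> n" "\<And>x. x \<in> A \<Longrightarrow> u 0 x = poly P x"
    and A: "finite A" "card A = Suc n" "A \<subseteq> {a..b}"
  shows "\<exists>z\<in>{a..b}. u n z = fact n * coeff P n"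
proof -
  have "\<exists>z\<in>{a..b}. (\<lambda>k x. u k x - poly ((pderiv ^^ k) P) x) n z = 0"
  proof (rule higher_derivative_zero[OF _ A _ order_refl])
    show "((\<lambda>x. u k x - poly ((pderiv ^^ k) P) x) has_real_derivative
        u (Suc k) x - poly ((pderiv ^^ Suc k) P) x) (at x)" if "k < n" for k x
      by (intro DERIV_diff u that poly_funpow_pderiv_has_derivative)
    show "u 0 x - poly ((pderiv ^^ 0) P) x = 0" if "x \<in> A" for x
      using P(2)[OF that] by simp
  qed
  then show ?thesis using poly_higher_pderiv_degree_le[OF P(1)] by auto
qed

text \<open>The difference of the two sides has degree less than \<open>card A\<close> and all of
  \<open>A\<close> as roots. The factor is the coefficient at \<open>card A\<close> rather than the
  leading one, so that \<open>P = 0\<close> is covered. Applied to a difference of neighbouring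
  interpolants.\<close>

lemma poly_eq_smult_prod_roots:
  fixes P :: "real poly"
  assumes "finite A" "degree P \<le> card A" "\<And>a. a \<in> A \<Longrightarrow> poly P a = 0"
  shows "P = smult (coeff P (card A)) (\<Prod>a\<in>A. [:-a, 1:])"
proof -
  define Q where "Q = (\<Prod>a\<in>A. [:-a, 1::real:])"
  have dQ: "degree Q = card A" using degree_prod_eq_sum_degree[of A "\<lambda>a. [:-a, 1::real:]"] by (simp add: Q_def)
  have "lead_coeff Q = 1" by (simp add: Q_def lead_coeff_prod)
  then have cQ: "coeff Q (card A) = 1" by (simp add: dQ)
  define R where "R = P - smult (coeff P (card A)) Q"
  have "R = 0"
  proof (rule ccontr)
    assume "R \<noteq> 0"
    have dR: "degree R \<le> card A" unfolding R_def by (intro degree_diff_le) (auto simp: assms dQ)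
    have "poly R a = 0" if "a \<in> A" for a
      using that assms by (auto simp: R_def Q_def poly_prod)
    then have "A \<subseteq> {x. poly R x = 0}" by blast
    then have "card A \<le> card {x. poly R x = 0}"
      by (intro card_mono poly_roots_finite \<open>R \<noteq> 0\<close>)
    also have "\<dots> \<le> degree R" by (rule card_poly_roots_bound[OF \<open>R \<noteq> 0\<close>])
    finally have "degree R = card A" using dR by simp
    then have "lead_coeff R = 0" by (simp add: R_def cQ)
    then show False using \<open>R \<noteq> 0\<close> by simp
  qed
  then show ?thesis by (simp add: R_def Q_def)
qed

section \<open>Lagrange interpolation\<close>

definition lagrange :: "real set \<Rightarrow> (real \<Rightarrow> real) \<Rightarrow> real poly" where
  "lagrange A f = (\<Sum>a\<in>A. smult (f a) (\<Prod>b\<in>A - {a}. smult (1 / (a - b)) [:-b, 1:]))"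

lemma poly_lagrange:
  assumes "finite A" "x \<in> A"
  shows "poly (lagrange A f) x = f x"
proof -
  have "poly (lagrange A f) x = (\<Sum>a\<in>A. f a * (\<Prod>b\<in>A - {a}. 1 / (a - b) * (x - b)))"
    by (simp add: lagrange_def poly_sum poly_prod diff_divide_distrib)
  also have "\<dots> = (\<Sum>a\<in>A. if a = x then f x else 0)"
  proof (rule sum.cong[OF refl])
    fix a assume "a \<in> A"
    show "f a * (\<Prod>b\<in>A - {a}. 1 / (a - b) * (x - b)) = (if a = x then f x else 0)"
    proof (cases "a = x")
      case True
      have "(\<Prod>b\<in>A - {x}. 1 / (x - b) * (x - b)) = (\<Prod>b\<in>A - {x}. 1)"
        by (rule prod.cong) auto
      then show ?thesis using True by simp
    next
      case False
      then have "(\<Prod>b\<in>A - {a}. 1 / (a - b) * (x - b)) = 0"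
        using assms by (intro prod_zero) auto
      then show ?thesis using False by simp
    qed
  qed
  also have "\<dots> = f x" using assms by simp
  finally show ?thesis .
qed

lemma degree_lagrange:
  assumes "finite A"
  shows "degree (lagrange A f) \<le> card A - 1"
  unfolding lagrange_def
proof (rule degree_sum_le[OF assms])
  fix a assume a: "a \<in> A"
  have "degree (\<Prod>b\<in>A - {a}. smult (1 / (a - b)) [:-b, 1:]) \<le> (\<Sum>b\<in>A - {a}. degree (smult (1 / (a - b)) [:-b, 1:]))"
    using degree_prod_sum_le[of "A - {a}" "\<lambda>b. smult (1 / (a - b)) [:-b, 1:]"] assms by (simp add: o_def)
  also have "\<dots> \<le> (\<Sum>b\<in>A - {a}. 1)" by (rule sum_mono) simp
  also have "\<dots> = card A - 1" using assms a by simp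
  finally show "degree (smult (f a) (\<Prod>b\<in>A - {a}. smult (1 / (a - b)) [:-b, 1:])) \<le> card A - 1"
    using degree_smult_le order_trans by blast
qed

lemma lagrange_cong: "(\<And>x. x \<in> A \<Longrightarrow> f x = g x) \<Longrightarrow> lagrange A f = lagrange A g"
  by (simp add: lagrange_def)

lemma lagrange_add: "lagrange A (\<lambda>x. f x + g x) = lagrange A f + lagrange A g"
  by (simp add: lagrange_def smult_add_left sum.distrib)

lemma lagrange_cmult: "lagrange A (\<lambda>x. c * f x) = smult c (lagrange A f)"
  by (simp add: poly_eq_iff coeff_sum lagrange_def sum_distrib_left mult.assoc)

lemma smooth_poly: "smooth (poly P)"
proof -
  have "times_diff k (poly P)" for k
  proof (induction k arbitrary: P)
    case (Suc k)
    then show ?case by (auto intro!: exI[of _ "poly (pderiv P)"] poly_DERIV)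
  qed simp
  then show ?thesis by (simp add: smooth_def)
qed

section \<open>Higher derivatives of sums, rescalings and products\<close>

lemma funpow_deriv_poly: "(deriv ^^ k) (poly P) = poly ((pderiv ^^ k) P)"
  by (induction k) (auto intro!: DERIV_imp_deriv poly_DERIV)

lemma funpow_deriv_add:
  assumes "smooth f" "smooth g"
  shows "(deriv ^^ k) (\<lambda>x. f x + g x) = (\<lambda>x. (deriv ^^ k) f x + (deriv ^^ k) g x)"
proof (induction k)
  case (Suc k)
  have "deriv (\<lambda>x. (deriv ^^ k) f x + (deriv ^^ k) g x) = (\<lambda>x. (deriv ^^ Suc k) f x + (deriv ^^ Suc k) g x)"
    by (intro ext DERIV_imp_deriv DERIV_add smooth_funpow_has_deriv assms)
  then show ?case using Suc by simp
qed simp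

lemma funpow_deriv_cmult:
  assumes "smooth f"
  shows "(deriv ^^ k) (\<lambda>x. c * f x) = (\<lambda>x. c * (deriv ^^ k) f x)"
proof (induction k)
  case (Suc k)
  have "deriv (\<lambda>x. c * (deriv ^^ k) f x) = (\<lambda>x. c * (deriv ^^ Suc k) f x)"
    by (intro ext DERIV_imp_deriv DERIV_cmult smooth_funpow_has_deriv assms)
  then show ?case using Suc by simp
qed simp

lemma smooth_sum: "(\<And>i. i \<in> I \<Longrightarrow> smooth (f i)) \<Longrightarrow> smooth (\<lambda>x. \<Sum>i\<in>I. f i x)"
proof (induction I rule: infinite_finite_induct)
  case (insert i I)
  then show ?case using smooth_add[of "f i" "\<lambda>x. \<Sum>i\<in>I. f i x"] by simp
qed simp_all

lemma funpow_deriv_sum: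
  "(\<And>i. i \<in> I \<Longrightarrow> smooth (f i)) \<Longrightarrow>
    (deriv ^^ k) (\<lambda>x. \<Sum>i\<in>I. f i x) = (\<lambda>x. \<Sum>i\<in>I. (deriv ^^ k) (f i) x)"
proof (induction I rule: infinite_finite_induct)
  case (insert i I)
  then have "(deriv ^^ k) (\<lambda>x. f i x + (\<Sum>i\<in>I. f i x)) = (\<lambda>x. (deriv ^^ k) (f i) x + (deriv ^^ k) (\<lambda>x. \<Sum>i\<in>I. f i x) x)"
    by (intro funpow_deriv_add smooth_sum) auto
  then show ?case using insert by simp
next
  case (infinite I)
  have "(deriv ^^ k) (\<lambda>x::real. 0::real) = (\<lambda>x. 0)" by (induction k) simp_all
  then show ?case using infinite by simp
next
  case empty
  have "(deriv ^^ k) (\<lambda>x::real. 0::real) = (\<lambda>x. 0)" by (induction k) simp_all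
  then show ?case by simp
qed

lemma funpow_deriv_affine:
  assumes "smooth f"
  shows "(deriv ^^ k) (\<lambda>x. f (a * x + b)) = (\<lambda>x. a ^ k * (deriv ^^ k) f (a * x + b))"
proof (induction k)
  case (Suc k)
  have "((\<lambda>x. a ^ k * (deriv ^^ k) f (a * x + b)) has_real_derivative
      a ^ k * ((deriv ^^ Suc k) f (a * x + b) * a)) (at x)" for x
    by (intro DERIV_cmult DERIV_chain2[OF smooth_funpow_has_deriv[OF assms]])
       (auto intro!: derivative_eq_intros)
  then have "deriv (\<lambda>x. a ^ k * (deriv ^^ k) f (a * x + b)) = (\<lambda>x. a ^ k * ((deriv ^^ Suc k) f (a * x + b) * a))"
    by (intro ext DERIV_imp_deriv)
  then show ?case using Suc by (simp add: mult_ac)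
qed simp

text \<open>Leibniz' rule with a linear factor has only two terms. For \<open>k = 0\<close> the
  truncated index \<open>k - 1\<close> is harmless, as its coefficient is 0.\<close>

lemma funpow_deriv_linear_mult:
  assumes "smooth f"
  shows "(deriv ^^ k) (\<lambda>x. (x - c) * f x) x
    = (x - c) * (deriv ^^ k) f x + real k * (deriv ^^ (k - 1)) f x"
proof (induction k arbitrary: x)
  case (Suc k)
  have *: "((\<lambda>x. (x - c) * (deriv ^^ k) f x) has_real_derivative
       (x - c) * (deriv ^^ Suc k) f x + (deriv ^^ k) f x) (at x)" for x
  proof -
    have "((\<lambda>x. (x - c) * (deriv ^^ k) f x) has_real_derivative
        1 * (deriv ^^ k) f x + (deriv ^^ Suc k) f x * (x - c)) (at x)"
      by (intro DERIV_mult smooth_funpow_has_deriv assms) (auto intro!: derivative_eq_intros)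
    then show ?thesis by (simp add: algebra_simps)
  qed
  have "(deriv ^^ k) (\<lambda>x. (x - c) * f x) =
      (\<lambda>x. (x - c) * (deriv ^^ k) f x + real k * (deriv ^^ (k - 1)) f x)" using Suc by blast
  moreover have "((\<lambda>x. (x - c) * (deriv ^^ k) f x + real k * (deriv ^^ (k - 1)) f x) has_real_derivative
      ((x - c) * (deriv ^^ Suc k) f x + (deriv ^^ k) f x) + real k * (deriv ^^ k) f x) (at x)" for x
  proof (cases k)
    case 0
    then show ?thesis using *[of x] by simp
  next
    case (Suc j)
    then show ?thesis
      using DERIV_add[OF *[of x] DERIV_cmult[OF smooth_funpow_has_deriv[OF assms, of j x], of "real k"]] by simp
  qed
  ultimately have "(deriv ^^ Suc k) (\<lambda>x. (x - c) * f x) x =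
      ((x - c) * (deriv ^^ Suc k) f x + (deriv ^^ k) f x) + real k * (deriv ^^ k) f x"
    by (simp only: funpow.simps o_apply DERIV_imp_deriv)
  then show ?case by (simp only: algebra_simps of_nat_Suc diff_Suc_1)
qed simp

lemma funpow_deriv_zero_where_constant:
  fixes f :: "real \<Rightarrow> real"
  assumes "open U" "\<And>x. x \<in> U \<Longrightarrow> f x = c" "x \<in> U"
  shows "(deriv ^^ Suc k) f x = 0"
proof -
  have base: "deriv h x = 0" if h: "\<And>x. x \<in> U \<Longrightarrow> h x = d" and "x \<in> U" for h :: "real \<Rightarrow> real" and d x
  proof -
    have "((\<lambda>x. d) has_real_derivative 0) (at x)" by simp
    then have "(h has_real_derivative 0) (at x)"
      by (rule has_field_derivative_transform_within_open[OF _ \<open>open U\<close> \<open>x \<in> U\<close>]) (simp add: h)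
    then show ?thesis by (rule DERIV_imp_deriv)
  qed
  have "\<forall>x\<in>U. (deriv ^^ Suc k) f x = 0"
  proof (induction k)
    case 0
    then show ?case using base[of f c] assms(2) by simp
  next
    case (Suc k)
    then show ?case using base[of "(deriv ^^ Suc k) f" 0] by simp
  qed
  then show ?thesis using assms(3) by blast
qed

text \<open>The bound is uniform in the roots \<open>\<theta> j\<close>, which is what makes the
  final constant independent of the position of the nodes. Beyond [0, 1] the step is constant, so
  the function is a polynomial of degree at most \<open>k\<close> there and its derivatives of
  higher order vanish.\<close>

lemma prod_times_step_derivative_bound:
  fixes S :: "real \<Rightarrow> real"
  assumes S: "smooth S" "\<And>x. x \<le> 0 \<Longrightarrow> S x = 0" "\<And>x. x \<ge> 1 \<Longrightarrow> S x = 1"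
  shows "\<exists>C. \<forall>\<theta> x. (\<forall>j<k. \<bar>\<theta> j\<bar> \<le> R) \<longrightarrow> x \<in> {0..1} \<longrightarrow>
            \<bar>(deriv ^^ q) (\<lambda>t. (\<Prod>j<k. t - \<theta> j) * S t) x\<bar> \<le> C" (is "\<exists>C. ?P k q C")
    and "smooth (\<lambda>t. (\<Prod>j<k. t - \<theta> j) * S t)"
    and "q > k \<Longrightarrow> x \<notin> {0..1} \<Longrightarrow> (deriv ^^ q) (\<lambda>t. (\<Prod>j<k. t - \<theta> j) * S t) x = 0"
proof -
  have H: "(\<lambda>t. (\<Prod>j<Suc k. t - \<theta> j) * S t) = (\<lambda>t. (t - \<theta> k) * ((\<Prod>j<k. t - \<theta> j) * S t))" for k and \<theta> :: "nat \<Rightarrow> real"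
    by (simp add: fun_eq_iff)
  have sm: "smooth (\<lambda>t. (\<Prod>j<k. t - \<theta> j) * S t)" for k and \<theta> :: "nat \<Rightarrow> real"
  proof (induction k)
    case (Suc k)
    have "smooth (\<lambda>t. t - \<theta> k)" using smooth_add[OF smooth_poly[of "[:0, 1:]"] smooth_const[of "-\<theta> k"]] by simp
    from smooth_mult[OF this Suc] show ?case unfolding H .
  qed (simp add: S)
  then show "smooth (\<lambda>t. (\<Prod>j<k. t - \<theta> j) * S t)" .
  have out: "(deriv ^^ q) (\<lambda>t. (\<Prod>j<k. t - \<theta> j) * S t) x = 0" if "q > k" "x \<notin> {0..1}" for k q x and \<theta> :: "nat \<Rightarrow> real"
    using that
  proof (induction k arbitrary: q)
    case 0
    then obtain r where q: "q = Suc r" using gr0_implies_Suc by blast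
    have "(deriv ^^ Suc r) S x = 0"
    proof (cases "x < 0")
      case True
      then show ?thesis
        using S(2) by (intro funpow_deriv_zero_where_constant[of "{..<0}" S 0]) auto
    next
      case False
      then show ?thesis
        using S(3) 0 by (intro funpow_deriv_zero_where_constant[of "{1<..}" S 1]) auto
    qed
    then show ?case by (simp add: q)
  next
    case (Suc k)
    then show ?case
      unfolding H funpow_deriv_linear_mult[OF sm] by simp
  qed
  then show "q > k \<Longrightarrow> x \<notin> {0..1} \<Longrightarrow> (deriv ^^ q) (\<lambda>t. (\<Prod>j<k. t - \<theta> j) * S t) x = 0" .
  show "\<exists>C. ?P k q C"
  \<comment> \<open>The order \<open>q\<close> is arbitrary because splitting off a factor by
    Leibniz' rule leads to the orders \<open>q\<close> and \<open>q - 1\<close>.\<close>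
  proof (induction k arbitrary: q)
    case 0
    have "compact ((deriv ^^ q) S ` {0..1})"
      by (intro compact_continuous_image smooth_continuous_on smooth_funpow_deriv S) simp
    then obtain C where "\<forall>y\<in>(deriv ^^ q) S ` {0..1}. \<bar>y\<bar> \<le> C"
      using compact_imp_bounded bounded_real by blast
    then have "?P 0 q C" by auto
    then show ?case by blast
  next
    case (Suc k)
    obtain C where C: "?P k q C" using Suc by blast
    obtain D where D: "?P k (q - 1) D" using Suc by blast
    have "?P (Suc k) q ((1 + \<bar>R\<bar>) * \<bar>C\<bar> + real q * \<bar>D\<bar>)"
    proof (intro allI impI)
      fix \<theta> :: "nat \<Rightarrow> real" and x :: real assume \<theta>: "\<forall>j<Suc k. \<bar>\<theta> j\<bar> \<le> R" and x: "x \<in> {0..1}"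
      let ?h = "\<lambda>t. (\<Prod>j<k. t - \<theta> j) * S t"
      have b1: "\<bar>(deriv ^^ q) ?h x\<bar> \<le> \<bar>C\<bar>" "\<bar>(deriv ^^ (q - 1)) ?h x\<bar> \<le> \<bar>D\<bar>"
        using C D \<theta> x by (meson abs_ge_self less_SucI order_trans)+
      have "\<bar>\<theta> k\<bar> \<le> R" using \<theta> by simp
      then have b2: "\<bar>x - \<theta> k\<bar> \<le> 1 + \<bar>R\<bar>" using x by auto
      have "\<bar>(x - \<theta> k) * (deriv ^^ q) ?h x + real q * (deriv ^^ (q - 1)) ?h x\<bar>
          \<le> \<bar>x - \<theta> k\<bar> * \<bar>(deriv ^^ q) ?h x\<bar> + real q * \<bar>(deriv ^^ (q - 1)) ?h x\<bar>"
        by (rule order_trans[OF abs_triangle_ineq]) (simp add: abs_mult)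
      also have "\<dots> \<le> (1 + \<bar>R\<bar>) * \<bar>C\<bar> + real q * \<bar>D\<bar>"
        using b1 b2 by (intro add_mono mult_mono) auto
      finally show "\<bar>(deriv ^^ q) (\<lambda>t. (\<Prod>j<Suc k. t - \<theta> j) * S t) x\<bar> \<le> (1 + \<bar>R\<bar>) * \<bar>C\<bar> + real q * \<bar>D\<bar>"
        unfolding H funpow_deriv_linear_mult[OF sm] .
    qed
    then show ?case by blast
  qed
qed


subsection \<open>Extension from finite sets\<close>

text \<open>If \<open>i0\<close> is the first index whose interval contains \<open>t\<close>, an
  interval with index beyond \<open>i0 + m\<close> begins to the right of \<open>x (i0 + m)\<close>
  and misses \<open>t\<close>.\<close>

lemma overlap_indicator_sum_le:
  fixes x :: "nat \<Rightarrow> real"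
  assumes mono: "\<And>i j. i < j \<Longrightarrow> j < n \<Longrightarrow> x i < x j"
  shows "card {i. i < n - m \<and> t \<in> {x i..x (i + m)}} \<le> m + 1"
    and "(\<Sum>i<n - m. indicator {x i..x (i + m)} t) \<le> real (m + 1)"
proof -
  define S where "S = {i. i < n - m \<and> t \<in> {x i..x (i + m)}}"
  have fin: "finite S" by (simp add: S_def)
  have card: "card S \<le> m + 1"
  proof (cases "S = {}")
    case False
    define i0 where "i0 = Min S"
    have i0: "i0 \<in> S" using False fin by (simp add: i0_def)
    have "i \<in> {i0..i0 + m}" if "i \<in> S" for i
    proof -
      have "i0 \<le> i" using that fin by (simp add: i0_def)
      moreover have "\<not> i0 + m < i"
      proof
        assume "i0 + m < i"
        then have "x (i0 + m) < x i" using that by (intro mono) (auto simp: S_def)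
        then show False using i0 that by (auto simp: S_def)
      qed
      ultimately show ?thesis by simp
    qed
    then have "card S \<le> card {i0..i0 + m}" by (intro card_mono) auto
    then show ?thesis by simp
  qed simp
  then show "card {i. i < n - m \<and> t \<in> {x i..x (i + m)}} \<le> m + 1" by (simp add: S_def)
  have "(\<Sum>i<n - m. indicator {x i..x (i + m)} t) = (\<Sum>i\<in>S. 1::real)"
    by (rule sum.mono_neutral_cong_right) (auto simp: S_def indicator_def)
  also have "\<dots> = real (card S)" by simp
  also have "\<dots> \<le> real (m + 1)" using card by (simp only: of_nat_le_iff)
  finally show "(\<Sum>i<n - m. indicator {x i..x (i + m)} t) \<le> real (m + 1)" .
qed

text \<open>The sum is at most \<open>D\<close> times its largest term.\<close>

lemma sum_powr_le:
  fixes A :: "'a \<Rightarrow> real"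
  assumes "finite S" "\<And>i. i \<in> S \<Longrightarrow> A i \<ge> 0" "p > 0" "card S \<le> D"
  shows "(\<Sum>i\<in>S. A i) powr p \<le> real D powr p * (\<Sum>i\<in>S. A i powr p)"
proof (cases "S = {}")
  case False
  define a where "a = Max (A ` S)"
  have "a \<in> A ` S" using False assms(1) by (simp add: a_def)
  then obtain j where j: "j \<in> S" "A j = a" by auto
  have a0: "a \<ge> 0" using assms(2)[OF j(1)] j by simp
  have "(\<Sum>i\<in>S. A i) \<le> (\<Sum>i\<in>S. a)" using assms(1) by (intro sum_mono) (simp add: a_def)
  also have "\<dots> = real (card S) * a" by simp
  also have "\<dots> \<le> real D * a" using assms(4) a0 by (intro mult_right_mono) auto
  finally have "(\<Sum>i\<in>S. A i) powr p \<le> (real D * a) powr p"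
    using assms by (intro powr_mono2 sum_nonneg) auto
  also have "\<dots> = real D powr p * A j powr p" using a0 j by (simp add: powr_mult)
  also have "\<dots> \<le> real D powr p * (\<Sum>i\<in>S. A i powr p)"
    using assms(1) j(1) by (intro mult_left_mono member_le_sum) auto
  finally show ?thesis .
qed simp

text \<open>The \<open>m\<close> gaps add up to \<open>x (i + m) - x i\<close>, so not all of them
  can be shorter than the average.\<close>

lemma exists_large_gap:
  fixes x :: "nat \<Rightarrow> real"
  assumes "m \<ge> 1"
  shows "\<exists>r\<in>{i..<i + m}. x (i + m) - x i \<le> real m * (x (Suc r) - x r)"
proof (rule ccontr)
  assume *: "\<not> ?thesis"
  have "real m * (x (i + m) - x i) = (\<Sum>r=i..<i + m. real m * (x (Suc r) - x r))"
    by (simp add: sum_Suc_diff' flip: sum_distrib_left)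
  also have "\<dots> < (\<Sum>r=i..<i + m. x (i + m) - x i)"
    using * assms by (intro sum_strict_mono) (auto simp: not_le)
  also have "\<dots> = real m * (x (i + m) - x i)" by simp
  finally show False by simp
qed

text \<open>In the constant, the factor 2 comes from \<open>powr_le_of_young\<close>, one factor
  \<open>m + 1\<close> from the number of terms that are nonzero at a point, and the other from
  adding up integrals over overlapping intervals.\<close>

lemma overlapping_sum_Lp_bound:
  fixes x c :: "nat \<Rightarrow> real" and w g :: "real \<Rightarrow> real"
  assumes p: "p > 1" and mono: "\<And>i j. i < j \<Longrightarrow> j < n \<Longrightarrow> x i < x j" and m: "m \<ge> 1"
    and g: "g \<in> Lp p" and w: "w \<in> borel_measurable lebesgue" and B: "B \<ge> 0"
    and c: "\<And>i. i < n - m \<Longrightarrow> \<bar>c i\<bar> \<le> integral {x i..x (i + m)} (\<lambda>t. \<bar>g t\<bar>)"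
    and le: "\<And>t. \<bar>w t\<bar> \<le> (\<Sum>i<n - m. B * \<bar>c i\<bar> / (x (i + m) - x i) * indicator {x i..x (i + m)} t)"
  shows "w \<in> Lp p"
    "(LINT t|lebesgue. \<bar>w t\<bar> powr p) \<le> (2 * B * real (m + 1)^2) powr p * (LINT t|lebesgue. \<bar>g t\<bar> powr p)"
proof -
  define D where "D = m + 1"
  define len where "len i = x (i + m) - x i" for i
  define A where "A i = B * \<bar>c i\<bar> / len i" for i
  define I where "I i = {x i..x (i + m)}" for i
  define \<Gamma> where "\<Gamma> = (LINT t|lebesgue. \<bar>g t\<bar> powr p)"
  have \<Gamma>: "\<Gamma> \<ge> 0" by (simp add: \<Gamma>_def)
  have len: "len i > 0" if "i < n - m" for i using mono[of i "i + m"] that m by (simp add: len_def)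
  have A0: "A i \<ge> 0" if "i < n - m" for i using len[OF that] B by (simp add: A_def)
  have pw: "\<bar>w t\<bar> powr p \<le> real D powr p * (\<Sum>i<n - m. A i powr p * indicator (I i) t)" for t
  proof -
    define S where "S = {i. i < n - m \<and> t \<in> I i}"
    have sub: "(\<Sum>i<n - m. a i * indicator (I i) t) = (\<Sum>i\<in>S. a i)" for a :: "nat \<Rightarrow> real"
      by (rule sum.mono_neutral_cong_right) (auto simp: S_def indicator_def)
    have "\<bar>w t\<bar> \<le> (\<Sum>i\<in>S. A i)"
      using le[of t, folded I_def len_def, folded A_def] by (simp only: sub)
    then have "\<bar>w t\<bar> powr p \<le> (\<Sum>i\<in>S. A i) powr p" using p by (intro powr_mono2) auto
    also have "\<dots> \<le> real D powr p * (\<Sum>i\<in>S. A i powr p)"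
    proof (rule sum_powr_le)
      show "card S \<le> D"
        unfolding S_def D_def I_def by (rule overlap_indicator_sum_le(1)[OF mono])
    qed (use A0 p in \<open>auto simp: S_def\<close>)
    finally show ?thesis by (simp add: sub)
  qed
  have ind: "integrable lebesgue (\<lambda>t. indicator (I i) t :: real)" for i
    by (rule integrable_real_indicator) (auto simp: I_def emeasure_lborel_Icc_eq)
  have iW: "integrable lebesgue (\<lambda>t. real D powr p * (\<Sum>i<n - m. A i powr p * indicator (I i) t))"
    by (intro integrable_mult_right Bochner_Integration.integrable_sum ind)
  have iw: "integrable lebesgue (\<lambda>t. \<bar>w t\<bar> powr p)"
  proof (rule Bochner_Integration.integrable_bound[OF iW])
    show "(\<lambda>t. \<bar>w t\<bar> powr p) \<in> borel_measurable lebesgue" using w by simp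
    show "AE t in lebesgue. norm (\<bar>w t\<bar> powr p)
        \<le> norm (real D powr p * (\<Sum>i<n - m. A i powr p * indicator (I i) t))"
    proof (rule AE_I2)
      fix t
      have "norm (\<bar>w t\<bar> powr p) = \<bar>w t\<bar> powr p" by simp
      also have "\<dots> \<le> norm (real D powr p * (\<Sum>i<n - m. A i powr p * indicator (I i) t))"
        unfolding real_norm_def by (rule order_trans[OF pw abs_ge_self])
      finally show "norm (\<bar>w t\<bar> powr p)
        \<le> norm (real D powr p * (\<Sum>i<n - m. A i powr p * indicator (I i) t))" .
    qed
  qed
  then show "w \<in> Lp p" using w by (simp add: Lp_def)
  have each: "A i powr p * len i \<le> (2 * B) powr p * (LINT t:I i|lebesgue. \<bar>g t\<bar> powr p)" if i: "i < n - m" for i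
  proof -
    let ?c = "integral {x i..x (i + m)} (\<lambda>t. \<bar>g t\<bar>)"
    let ?G = "integral {x i..x (i + m)} (\<lambda>t. \<bar>g t\<bar> powr p)"
    have "?c powr p \<le> 2 powr p * len i powr (p - 1) * ?G"
    proof (rule powr_le_of_young)
      show "?c \<le> t * len i + t powr (1 - p) * ?G" if "t > 0" for t
        using len[OF i] unfolding len_def by (intro Lp_integral_le_young g p that) simp
      show "?c \<ge> 0" "?G \<ge> 0"
        by (intro Henstock_Kurzweil_Integration.integral_nonneg Lp_abs_integrable_on[OF g p] Lp_powr_integrable_on[OF g]; simp)+
    qed (use p len[OF i] in auto)
    moreover have "\<bar>c i\<bar> powr p \<le> ?c powr p" using c[OF i] p by (intro powr_mono2) auto
    ultimately have "\<bar>c i\<bar> powr p \<le> 2 powr p * len i powr (p - 1) * ?G" by simp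
    \<comment> \<open>The weight is chosen so that all powers of the length cancel: -p + 1 + (p - 1)
      = 0.\<close>
    then have "B powr p / len i powr p * len i * \<bar>c i\<bar> powr p \<le>
        B powr p / len i powr p * len i * (2 powr p * len i powr (p - 1) * ?G)"
      using len[OF i] by (intro mult_left_mono) auto
    also have "\<dots> = (2 * B) powr p * ?G"
      using len[OF i] B by (simp add: powr_mult powr_diff)
    also have "B powr p / len i powr p * len i * \<bar>c i\<bar> powr p = A i powr p * len i"
      using len[OF i] B by (simp add: A_def powr_mult powr_divide)
    also have "?G = (LINT t:I i|lebesgue. \<bar>g t\<bar> powr p)"
      unfolding I_def by (rule integral_interval_eq_set_integral(1)[OF Lp_integrable[OF g]])
    finally show ?thesis .
  qed
  have "(LINT t|lebesgue. \<bar>w t\<bar> powr p) \<le> (LINT t|lebesgue. real D powr p * (\<Sum>i<n - m. A i powr p * indicator (I i) t))"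
    by (rule integral_mono[OF iw iW pw])
  also have "\<dots> = real D powr p * (\<Sum>i<n - m. A i powr p * measure lebesgue (I i))"
  proof -
    have "(LINT t|lebesgue. (\<Sum>i<n - m. A i powr p * indicator (I i) t)) =
        (\<Sum>i<n - m. LINT t|lebesgue. A i powr p * indicator (I i) t)"
      by (intro Bochner_Integration.integral_sum integrable_mult_right ind)
    also have "\<dots> = (\<Sum>i<n - m. A i powr p * measure lebesgue (I i))" by simp
    finally show ?thesis by (simp only: integral_mult_right_zero)
  qed
  also have "\<dots> = real D powr p * (\<Sum>i<n - m. A i powr p * len i)"
  proof -
    have "measure lebesgue (I i) = len i" if "i < n - m" for i
      using len[OF that] by (simp add: I_def len_def)
    then show ?thesis by simp
  qed
  also have "\<dots> \<le> real D powr p * (\<Sum>i<n - m. (2 * B) powr p * (LINT t:I i|lebesgue. \<bar>g t\<bar> powr p))"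
    by (intro mult_left_mono sum_mono each) auto
  also have "\<dots> = real D powr p * ((2 * B) powr p * (\<Sum>i<n - m. LINT t:I i|lebesgue. \<bar>g t\<bar> powr p))"
    by (simp add: sum_distrib_left)
  also have "\<dots> \<le> real D powr p * ((2 * B) powr p * (real D * \<Gamma>))"
    unfolding \<Gamma>_def
  proof (intro mult_left_mono sum_set_integral_le Lp_integrable[OF g])
    show "(\<Sum>i<n - m. indicator (I i) t) \<le> real D" for t
      unfolding I_def D_def by (rule overlap_indicator_sum_le(2)[OF mono])
  qed (auto simp: I_def)
  \<comment> \<open>The overlap enters to the first power; it is enlarged to a p-th power so that
    the p-th root of the whole constant is free of \<open>p\<close>.\<close>
  also have "\<dots> \<le> real D powr p * ((2 * B) powr p * (real D powr p * \<Gamma>))"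
  proof -
    have "real D powr 1 \<le> real D powr p" using p by (intro powr_mono) (auto simp: D_def)
    then show ?thesis using \<Gamma> by (intro mult_left_mono mult_right_mono) (auto simp: D_def)
  qed
  also have "\<dots> = (2 * B * real D ^ 2) powr p * \<Gamma>"
    using B by (simp add: powr_mult power2_eq_square mult_ac)
  finally show "(LINT t|lebesgue. \<bar>w t\<bar> powr p) \<le> (2 * B * real (m + 1)^2) powr p * (LINT t|lebesgue. \<bar>g t\<bar> powr p)"
    by (simp only: D_def \<Gamma>_def)
qed

text \<open>\<open>\<Phi>\<close> acts on all functions on the line, of which only the values on
  \<open>X\<close> count by the third clause; thus the same \<open>f\<close> can be fed to the
  operators of different sets. The estimate is against every competing extension, given as a chain
  \<open>u\<close>, with one \<open>K\<close> and one \<open>\<Phi>\<close> for all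
  \<open>p\<close>.\<close>

definition extension_operator :: "nat \<Rightarrow> real \<Rightarrow> real set \<Rightarrow> ((real \<Rightarrow> real) \<Rightarrow> real \<Rightarrow> real) \<Rightarrow> bool" where
  "extension_operator m K X \<Phi> \<longleftrightarrow>
     (\<forall>f. smooth (\<Phi> f)) \<and>
     (\<forall>f. \<forall>x\<in>X. \<Phi> f x = f x) \<and>
     (\<forall>f g. (\<forall>x\<in>X. f x = g x) \<longrightarrow> \<Phi> f = \<Phi> g) \<and>
     (\<forall>f g. \<Phi> (\<lambda>x. f x + g x) = (\<lambda>x. \<Phi> f x + \<Phi> g x)) \<and>
     (\<forall>c f. \<Phi> (\<lambda>x. c * f x) = (\<lambda>x. c * \<Phi> f x)) \<and>
     (\<forall>p f u g. p > 1 \<longrightarrow> (\<forall>k<m - 1. \<forall>x. (u k has_real_derivative u (Suc k) x) (at x)) \<longrightarrow>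
        (\<forall>x\<in>X. u 0 x = f x) \<longrightarrow> g \<in> Lp p \<longrightarrow> primitive g (u (m - 1)) \<longrightarrow>
        (deriv ^^ m) (\<Phi> f) \<in> Lp p \<and>
        (LINT x|lebesgue. \<bar>(deriv ^^ m) (\<Phi> f) x\<bar> powr p) \<le> K powr p * (LINT x|lebesgue. \<bar>g x\<bar> powr p))"

lemma primitive_diff_le_integral:
  assumes "primitive g G" "g \<in> Lp p" "p > 1" "y \<in> {a..b}" "z \<in> {a..b}"
  shows "\<bar>G z - G y\<bar> \<le> integral {a..b} (\<lambda>t. \<bar>g t\<bar>)"
proof -
  have "\<bar>G v - G u\<bar> \<le> integral {a..b} (\<lambda>t. \<bar>g t\<bar>)" if "u \<le> v" "u \<in> {a..b}" "v \<in> {a..b}" for u v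
  proof -
    have "\<bar>G v - G u\<bar> \<le> integral {u..v} (\<lambda>t. \<bar>g t\<bar>)"
      by (rule primitive_abs_diff_le[OF assms(1) Lp_interval[OF assms(2,3)] that(1)])
    also have "\<dots> \<le> integral {a..b} (\<lambda>t. \<bar>g t\<bar>)"
      using that by (intro integral_subset_le Lp_abs_integrable_on[OF assms(2,3)]) auto
    finally show ?thesis .
  qed
  from this[of y z] this[of z y] assms(4,5) show ?thesis by (cases "y \<le> z") auto
qed

text \<open>As \<open>L (i + 1) - L i\<close> vanishes at the nodes strictly between \<open>x i\<close> and \<open>x (i + m)\<close>, it does not
  matter for the interpolation which gap between them is used for the switch.\<close>

lemma finite_extension_operator:
  assumes m: "m \<ge> 1" and S: "smooth S" "\<And>x. x \<le> 0 \<Longrightarrow> S x = 0" "\<And>x. x \<ge> 1 \<Longrightarrow> S x = 1"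
    and C: "\<And>\<theta> x. (\<forall>j<m - 1. \<bar>\<theta> j\<bar> \<le> real m) \<Longrightarrow> x \<in> {0..1} \<Longrightarrow>
            \<bar>(deriv ^^ m) (\<lambda>t. (\<Prod>j<m - 1. t - \<theta> j) * S t) x\<bar> \<le> C"
    and X: "finite X" "card X \<ge> m"
  shows "\<exists>\<Phi>. extension_operator m (2 * (real m * \<bar>C\<bar>) * real (m + 1)^2) X \<Phi>"
proof -
  define n where "n = card X"
  define x where "x i = sorted_list_of_set X ! i" for i
  have mono: "x i < x j" if "i < j" "j < n" for i j
    using sorted_wrt_nth_less[OF strict_sorted_list_of_set[of X]] that by (simp add: x_def n_def)
  have mono_le: "x i \<le> x j" if "i \<le> j" "j < n" for i j
    using mono[of i j] that by (cases "i = j") auto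
  have inj: "inj_on x {..<n}"
    by (rule linorder_inj_onI) (use mono in force)+
  have X_eq: "X = x ` {..<n}"
  proof -
    have "X = set (sorted_list_of_set X)" using X(1) by simp
    also have "\<dots> = (\<lambda>i. sorted_list_of_set X ! i) ` {..<length (sorted_list_of_set X)}"
      unfolding set_conv_nth by blast
    finally show ?thesis by (simp add: x_def[abs_def] n_def)
  qed
  define A where "A i = x ` {i..<i + m}" for i
  have A: "finite (A i)" "card (A i) = m" "A i \<subseteq> X" "A i \<subseteq> {x i..x (i + m - 1)}" if "i + m \<le> n" for i
  proof -
    have "inj_on x {i..<i + m}" using inj by (rule inj_on_subset) (use that in auto)
    then show "card (A i) = m" by (simp add: A_def card_image)
    show "A i \<subseteq> {x i..x (i + m - 1)}" using that by (auto simp: A_def intro!: mono_le)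
  qed (use that in \<open>auto simp: A_def X_eq\<close>)
  define L where "L f i = lagrange (A i) f" for f i
  have polyL: "poly (L f i) (x k) = f (x k)" if "i \<le> k" "k < i + m" for f i k
    unfolding L_def using that by (intro poly_lagrange) (auto simp: A_def)
  have degL: "degree (L f i) \<le> m - 1" if "i + m \<le> n" for f i
    using degree_lagrange[OF A(1)[OF that]] A(2)[OF that] by (simp add: L_def)
  have "\<forall>i. \<exists>r. r \<in> {i..<i + m} \<and> x (i + m) - x i \<le> real m * (x (Suc r) - x r)"
    using exists_large_gap[OF m, where x = x] by blast
  then obtain r where r: "\<And>i. r i \<in> {i..<i + m}" "\<And>i. x (i + m) - x i \<le> real m * (x (Suc (r i)) - x (r i))"
    by metis
  define a where "a i = x (r i)" for i
  define d where "d i = x (Suc (r i)) - x (r i)" for i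
  have d: "d i > 0" if "i < n - m" for i
  proof -
    have "Suc (r i) < n" using r(1)[of i] that by auto
    then show ?thesis using mono[of "r i" "Suc (r i)"] by (simp add: d_def)
  qed
  \<comment> \<open>The rescaled step rises from 0 to 1 on the chosen gap, from \<open>a i\<close>
    to \<open>a i + d i\<close>.\<close>
  define s where "s i t = S (1 / d i * t + (- a i / d i))" for i t
  have s_eq: "s i t = S ((t - a i) / d i)" for i t by (simp add: s_def diff_divide_distrib)
  have s0: "s i t = 0" if "i < n - m" "t \<le> x i" for i t
  proof -
    have "x i \<le> a i" using r(1)[of i] that(1) unfolding a_def by (intro mono_le) auto
    then show ?thesis using d[OF that(1)] that(2) unfolding s_eq by (intro S(2)) (simp add: divide_nonpos_pos)
  qed
  have s1: "s i t = 1" if "i < n - m" "x (i + m) \<le> t" for i t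
  proof -
    have "x (Suc (r i)) \<le> x (i + m)" using r(1)[of i] that(1) by (intro mono_le) auto
    then show ?thesis using d[OF that(1)] that(2) unfolding s_eq by (intro S(3)) (simp add: a_def d_def field_simps)
  qed
  have sm_s: "smooth (s i)" for i unfolding s_def by (rule smooth_affine[OF S(1)])
  \<comment> \<open>A telescoping form of the switches: where those before \<open>k\<close> are
    completed and the others have not begun, the value is that of \<open>L f k\<close>.\<close>
  define \<Phi> where "\<Phi> f t = poly (L f 0) t + (\<Sum>i<n - m. poly (L f (Suc i) - L f i) t * s i t)" for f t
  have sm_term: "smooth (\<lambda>t. poly (L f (Suc i) - L f i) t * s i t)" for f i
    by (rule smooth_mult[OF smooth_poly sm_s])
  have sm: "smooth (\<Phi> f)" for f
    unfolding \<Phi>_def by (rule smooth_add[OF smooth_poly smooth_sum[OF sm_term]])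
  have interp: "\<Phi> f y = f y" if "y \<in> X" for f y
  proof -
    obtain k where k: "k < n" "y = x k" using \<open>y \<in> X\<close> X_eq by auto
    \<comment> \<open>At the node \<open>x k\<close> a switch is completed, or not begun, or joins
      two polynomials with the same value \<open>f y\<close>. The sum therefore telescopes to the
      interpolant with index \<open>Suc k - m\<close>; the truncation to 0 covers the first
      nodes.\<close>
    have "poly (L f (Suc i) - L f i) y * s i y =
        (if i < Suc k - m then poly (L f (Suc i)) y - poly (L f i) y else 0)" if "i < n - m" for i
    proof -
      consider "i + m \<le> k" | "k \<le> i" | "i < k" "k < i + m" by linarith
      then show ?thesis
      proof cases
        case 1
        then have "i < Suc k - m" by linarith
        then show ?thesis using s1[OF that, of y] mono_le[OF 1 k(1)] k(2) by simp
      next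
        case 2
        then have "\<not> i < Suc k - m" using m by linarith
        moreover have "s i y = 0" using mono_le[OF 2] that k(2) by (intro s0) auto
        ultimately show ?thesis by simp
      next
        case 3
        then have "poly (L f (Suc i)) y = f y" "poly (L f i) y = f y"
          using polyL[of i k f] polyL[of "Suc i" k f] k(2) by auto
        then show ?thesis by simp
      qed
    qed
    then have "(\<Sum>i<n - m. poly (L f (Suc i) - L f i) y * s i y)
        = (\<Sum>i<n - m. if i < Suc k - m then poly (L f (Suc i)) y - poly (L f i) y else 0)" by simp
    also have "\<dots> = (\<Sum>i<Suc k - m. poly (L f (Suc i)) y - poly (L f i) y)"
      using k(1) by (intro sum.mono_neutral_cong_right) auto
    also have "\<dots> = poly (L f (Suc k - m)) y - poly (L f 0) y" by (rule sum_lessThan_telescope)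
    finally have "\<Phi> f y = poly (L f (Suc k - m)) y" by (simp add: \<Phi>_def)
    also have "\<dots> = f y" using m unfolding k(2) by (intro polyL) auto
    finally show ?thesis .
  qed
  have cong: "\<Phi> f = \<Phi> h" if "\<forall>y\<in>X. f y = h y" for f h
  proof -
    have "L f i = L h i" if "i + m \<le> n" for i
      unfolding L_def using A(3)[OF that] \<open>\<forall>y\<in>X. f y = h y\<close> by (intro lagrange_cong) auto
    then have "L f 0 = L h 0" "\<And>i. i < n - m \<Longrightarrow> L f i = L h i \<and> L f (Suc i) = L h (Suc i)"
      using X(2) by (auto simp: n_def)
    then show ?thesis by (simp add: \<Phi>_def fun_eq_iff)
  qed
  have add: "\<Phi> (\<lambda>x. f x + h x) = (\<lambda>x. \<Phi> f x + \<Phi> h x)" for f h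
  proof
    fix t
    have "poly (L (\<lambda>x. f x + h x) (Suc i) - L (\<lambda>x. f x + h x) i) t * s i t =
        poly (L f (Suc i) - L f i) t * s i t + poly (L h (Suc i) - L h i) t * s i t" for i
      by (simp add: L_def lagrange_add algebra_simps)
    then show "\<Phi> (\<lambda>x. f x + h x) t = \<Phi> f t + \<Phi> h t"
      by (simp add: \<Phi>_def L_def lagrange_add sum.distrib)
  qed
  have cmult: "\<Phi> (\<lambda>x. c * f x) = (\<lambda>x. c * \<Phi> f x)" for c f
  proof
    fix t
    have e: "poly (L (\<lambda>x. c * f x) (Suc i) - L (\<lambda>x. c * f x) i) t * s i t =
        c * (poly (L f (Suc i) - L f i) t * s i t)" for i
      by (simp add: L_def lagrange_cmult algebra_simps)
    have "poly (L (\<lambda>x. c * f x) 0) t = c * poly (L f 0) t" by (simp add: L_def lagrange_cmult)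
    then show "\<Phi> (\<lambda>x. c * f x) t = c * \<Phi> f t"
      unfolding \<Phi>_def e by (simp only: sum_distrib_left[symmetric] distrib_left)
  qed
  have est: "(deriv ^^ m) (\<Phi> f) \<in> Lp p \<and>
      (LINT t|lebesgue. \<bar>(deriv ^^ m) (\<Phi> f) t\<bar> powr p)
        \<le> (2 * (real m * \<bar>C\<bar>) * real (m + 1)^2) powr p * (LINT t|lebesgue. \<bar>g t\<bar> powr p)"
    if p: "p > 1" and u: "\<forall>k<m - 1. \<forall>t. (u k has_real_derivative u (Suc k) t) (at t)"
      and uf: "\<forall>y\<in>X. u 0 y = f y" and g: "g \<in> Lp p" "primitive g (u (m - 1))" for p f u g
  proof -
    define c where "c i = coeff (L f (Suc i) - L f i) (m - 1)" for i
    have mv: "\<exists>z\<in>{x i..x (i + m - 1)}. u (m - 1) z = fact (m - 1) * coeff (L f i) (m - 1)" if "i + m \<le> n" for i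
    proof (rule leading_coefficient_mvt)
      show "u 0 y = poly (L f i) y" if "y \<in> A i" for y
        using that A(3)[OF \<open>i + m \<le> n\<close>] uf polyL by (auto simp: A_def)
    qed (use u A[OF that] degL[OF that] m in auto)
    have cb: "\<bar>c i\<bar> \<le> integral {x i..x (i + m)} (\<lambda>t. \<bar>g t\<bar>)" if i: "i < n - m" for i
    proof -
      have "i + m \<le> n" "Suc i + m \<le> n" using i by auto
      then obtain z z' where z: "z \<in> {x i..x (i + m - 1)}" "u (m - 1) z = fact (m - 1) * coeff (L f i) (m - 1)"
        and z': "z' \<in> {x (Suc i)..x (Suc i + m - 1)}" "u (m - 1) z' = fact (m - 1) * coeff (L f (Suc i)) (m - 1)"
        using mv[of i] mv[of "Suc i"] by blast
      have "x (i + m - 1) \<le> x (i + m)" "x i \<le> x (Suc i)" "x (Suc i + m - 1) = x (i + m)"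
        using i m by (auto intro!: mono_le)
      then have zz: "z \<in> {x i..x (i + m)}" "z' \<in> {x i..x (i + m)}" using z(1) z'(1) by auto
      have "1 * \<bar>c i\<bar> \<le> fact (m - 1) * \<bar>c i\<bar>" by (intro mult_right_mono) (auto simp: fact_ge_1)
      also have "\<dots> = \<bar>u (m - 1) z' - u (m - 1) z\<bar>"
        unfolding z(2) z'(2) c_def coeff_diff right_diff_distrib[symmetric] abs_mult by simp
      also have "\<dots> \<le> integral {x i..x (i + m)} (\<lambda>t. \<bar>g t\<bar>)"
        by (rule primitive_diff_le_integral[OF g(2,1) p zz])
      finally show ?thesis by simp
    qed
    \<comment> \<open>The nodes strictly between \<open>x i\<close> and \<open>x (i + m)\<close>, in
      the coordinate in which the chosen gap is [0, 1].\<close>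
    define \<theta> where "\<theta> i j = (x (Suc i + j) - a i) / d i" for i j
    define H where "H i t = (\<Prod>j<m - 1. t - \<theta> i j) * S t" for i t
    have smH: "smooth (H i)" for i
      unfolding H_def by (rule prod_times_step_derivative_bound(2)[OF S])
    have term_eq: "(\<lambda>t. poly (L f (Suc i) - L f i) t * s i t) =
        (\<lambda>t. (c i * d i ^ (m - 1)) * H i (1 / d i * t + (- a i / d i)))" if i: "i < n - m" for i
    proof
      fix t
      let ?P = "L f (Suc i) - L f i"
      let ?B = "x ` {Suc i..<i + m}"
      have inB: "inj_on x {Suc i..<i + m}" using inj by (rule inj_on_subset) (use i in auto)
      then have cB: "card ?B = m - 1" using m by (simp add: card_image)
      have "?P = smult (coeff ?P (card ?B)) (\<Prod>y\<in>?B. [:-y, 1:])"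
      proof (rule poly_eq_smult_prod_roots)
        show "degree ?P \<le> card ?B" unfolding cB using i by (intro degree_diff_le degL) auto
        show "poly ?P y = 0" if "y \<in> ?B" for y
          using that polyL[of i _ f] polyL[of "Suc i" _ f] by auto
      qed simp
      then have "poly ?P t = poly (smult (coeff ?P (card ?B)) (\<Prod>y\<in>?B. [:-y, 1:])) t"
        by (rule arg_cong[where f = "\<lambda>P. poly P t"])
      also have "\<dots> = c i * (\<Prod>y\<in>?B. t - y)"
        unfolding cB c_def[symmetric] by (simp add: poly_prod)
      also have "(\<Prod>y\<in>?B. t - y) = (\<Prod>k\<in>{Suc i..<i + m}. t - x k)"
        by (simp add: prod.reindex[OF inB])
      also have "\<dots> = (\<Prod>j<m - 1. t - x (Suc i + j))"
        by (rule prod.reindex_bij_witness[of _ "\<lambda>j. Suc i + j" "\<lambda>k. k - Suc i"]) (use m in auto)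
      also have "\<dots> = (\<Prod>j<m - 1. d i * ((t - a i) / d i - \<theta> i j))"
        using d[OF i] by (intro prod.cong refl) (simp add: \<theta>_def field_simps)
      also have "\<dots> = d i ^ (m - 1) * (\<Prod>j<m - 1. (t - a i) / d i - \<theta> i j)"
        by (simp add: prod.distrib)
      finally show "poly ?P t * s i t = (c i * d i ^ (m - 1)) * H i (1 / d i * t + (- a i / d i))"
        by (simp add: H_def s_def diff_divide_distrib mult_ac)
    qed
    have term_deriv: "(deriv ^^ m) (\<lambda>t. poly (L f (Suc i) - L f i) t * s i t) t =
        c i / d i * (deriv ^^ m) (H i) ((t - a i) / d i)" if i: "i < n - m" for i t
    proof -
      \<comment> \<open>Rescaling the \<open>m - 1\<close> linear factors gains
        \<open>d i ^ (m - 1)\<close>, and differentiating \<open>m\<close> times loses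
        \<open>d i ^ m\<close>.\<close>
      have "d i ^ (m - 1) * (1 / d i) ^ m = 1 / d i"
        using m d[OF i] by (cases m) (simp_all add: power_divide field_simps)
      then have "c i * d i ^ (m - 1) * ((1 / d i) ^ m * y) = c i / d i * y" for y
        by (metis (no_types, lifting) mult.assoc mult.right_neutral times_divide_eq_right)
      then show ?thesis
        unfolding term_eq[OF i] funpow_deriv_cmult[OF smooth_affine[OF smH]] funpow_deriv_affine[OF smH]
        by (simp add: diff_divide_distrib)
    qed
    have L0: "(deriv ^^ m) (poly (L f 0)) t = 0" for t
    proof -
      have "degree (L f 0) < m" using degL[of 0 f] X(2) m by (simp add: n_def)
      then show ?thesis
        unfolding funpow_deriv_poly
        using poly_higher_pderiv_degree_le[of "L f 0" m t] by (simp add: coeff_eq_0)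
    qed
    have \<Phi>m: "(deriv ^^ m) (\<Phi> f) t = (\<Sum>i<n - m. c i / d i * (deriv ^^ m) (H i) ((t - a i) / d i))" for t
    proof -
      have "(deriv ^^ m) (\<Phi> f) t = (deriv ^^ m) (poly (L f 0)) t +
          (\<Sum>i<n - m. (deriv ^^ m) (\<lambda>t. poly (L f (Suc i) - L f i) t * s i t) t)"
        unfolding \<Phi>_def funpow_deriv_add[OF smooth_poly smooth_sum[OF sm_term]] funpow_deriv_sum[OF sm_term] ..
      also have "(\<Sum>i<n - m. (deriv ^^ m) (\<lambda>t. poly (L f (Suc i) - L f i) t * s i t) t) =
          (\<Sum>i<n - m. c i / d i * (deriv ^^ m) (H i) ((t - a i) / d i))"
        by (rule sum.cong[OF refl]) (rule term_deriv, simp)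
      finally show ?thesis by (simp only: L0 add_0)
    qed
    have H_le: "\<bar>c i / d i * (deriv ^^ m) (H i) ((t - a i) / d i)\<bar> \<le>
        (real m * \<bar>C\<bar>) * \<bar>c i\<bar> / (x (i + m) - x i) * indicator {x i..x (i + m)} t" if i: "i < n - m" for i t
    proof (cases "(t - a i) / d i \<in> {0..1}")
      \<comment> \<open>Off the gap the term is a polynomial of degree at most \<open>m - 1\<close>,
        so its derivative of order \<open>m\<close> vanishes.\<close>
      case False
      have "(deriv ^^ m) (H i) ((t - a i) / d i) = 0"
        unfolding H_def by (rule prod_times_step_derivative_bound(3)[OF S _ False]) (use m in auto)
      moreover have "x i < x (i + m)" using i m by (intro mono) auto
      ultimately show ?thesis by simp
    next
      case True
      then have t: "a i \<le> t" "t \<le> a i + d i" using d[OF i] by (auto simp: field_simps)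
      have xa: "x i \<le> a i" "a i + d i \<le> x (i + m)"
        using r(1)[of i] i unfolding a_def d_def by (auto intro!: mono_le)
      have pos: "x (i + m) - x i > 0" using i m by (simp add: mono)
      have md: "x (i + m) - x i \<le> real m * d i" using r(2)[of i] by (simp add: d_def)
      \<comment> \<open>All these points lie between \<open>x i\<close> and
        \<open>x (i + m)\<close>, and this whole length is at most \<open>m\<close> times the
        gap.\<close>
      have "\<bar>\<theta> i j\<bar> \<le> real m" if "j < m - 1" for j
      proof -
        have "x i \<le> x (Suc i + j)" "x (Suc i + j) \<le> x (i + m)"
          using that i by (auto intro!: mono_le)
        then have "\<bar>x (Suc i + j) - a i\<bar> \<le> x (i + m) - x i" using xa d[OF i] by linarith
        also have "\<dots> \<le> real m * d i" by (rule md)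
        finally show ?thesis using d[OF i] by (simp add: \<theta>_def field_simps)
      qed
      then have "\<bar>(deriv ^^ m) (H i) ((t - a i) / d i)\<bar> \<le> \<bar>C\<bar>"
        unfolding H_def using C[of "\<theta> i", OF _ True] by force
      then have "\<bar>c i\<bar> / d i * \<bar>(deriv ^^ m) (H i) ((t - a i) / d i)\<bar> \<le> \<bar>c i\<bar> / d i * \<bar>C\<bar>"
        using d[OF i] by (intro mult_left_mono) auto
      also have "\<dots> = (\<bar>C\<bar> * \<bar>c i\<bar>) * (1 / d i)" by simp
      \<comment> \<open>The second use of the long gap: its reciprocal is at most \<open>m\<close>
        over the whole length. This is the origin of the factor
        \<open>m * \<bar>C\<bar>\<close>.\<close>
      also have "\<dots> \<le> (\<bar>C\<bar> * \<bar>c i\<bar>) * (real m / (x (i + m) - x i))"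
        using md pos d[OF i] by (intro mult_left_mono) (auto simp: field_simps)
      finally show ?thesis
        using t xa d[OF i] by (simp add: abs_mult indicator_def mult_ac)
    qed
    have w_le: "\<bar>(deriv ^^ m) (\<Phi> f) t\<bar> \<le>
        (\<Sum>i<n - m. (real m * \<bar>C\<bar>) * \<bar>c i\<bar> / (x (i + m) - x i) * indicator {x i..x (i + m)} t)" for t
      unfolding \<Phi>m by (rule order_trans[OF sum_abs sum_mono[OF H_le]]) simp
    have wm: "(deriv ^^ m) (\<Phi> f) \<in> borel_measurable lebesgue"
      using borel_measurable_continuous_onI[OF smooth_continuous_on[OF smooth_funpow_deriv[OF sm]]]
      by (simp add: measurable_completion)
    have "real m * \<bar>C\<bar> \<ge> 0" by simp
    note overlapping_sum_Lp_bound[OF p mono m g(1) wm this cb w_le]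
    then show ?thesis by blast
  qed
  have "extension_operator m (2 * (real m * \<bar>C\<bar>) * real (m + 1)^2) X \<Phi>"
    unfolding extension_operator_def
  proof (intro conjI)
    show "\<forall>f h. (\<forall>x\<in>X. f x = h x) \<longrightarrow> \<Phi> f = \<Phi> h" using cong by blast
  qed ((intro allI impI ballI)?, (rule sm | rule add | rule cmult | (rule interp, assumption) | (rule est; assumption)))+
  then show ?thesis by blast
qed

text \<open>The step \<open>S\<close> and the bound \<open>C\<close> are fixed before
  \<open>X\<close>, so \<open>K\<close> depends on \<open>m\<close> alone.\<close>

lemma extension_operators_exist:
  assumes "m \<ge> 1"
  obtains K where "K \<ge> 0" "\<And>X. finite X \<Longrightarrow> card X \<ge> m \<Longrightarrow> \<exists>\<Phi>. extension_operator m K X \<Phi>"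
proof -
  obtain S :: "real \<Rightarrow> real" where S: "smooth S" "\<And>x. x \<le> 0 \<Longrightarrow> S x = 0" "\<And>x. x \<ge> 1 \<Longrightarrow> S x = 1"
    by (rule smooth_step_exists) blast
  obtain C where C: "\<And>\<theta> x. (\<forall>j<m - 1. \<bar>\<theta> j\<bar> \<le> real m) \<Longrightarrow> x \<in> {0..1} \<Longrightarrow>
            \<bar>(deriv ^^ m) (\<lambda>t. (\<Prod>j<m - 1. t - \<theta> j) * S t) x\<bar> \<le> C"
    using prod_times_step_derivative_bound(1)[OF S, of "m - 1" "real m" m] by blast
  show ?thesis
    by (rule that[of "2 * (real m * \<bar>C\<bar>) * real (m + 1)^2"])
       (use finite_extension_operator[OF assms S C] in auto)
qed


subsection \<open>Limits along ultrafilters\<close>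

text \<open>A minimal proper filter below \<open>F\<close> is an ultrafilter: restricting it to the
  points where \<open>P\<close> holds either yields an improper filter, or by minimality changes
  nothing.\<close>

lemma ultrafilter_exists:
  assumes "F \<noteq> bot"
  obtains U where "U \<le> F" "U \<noteq> bot" "\<And>P. eventually P U \<or> eventually (\<lambda>x. \<not> P x) U"
proof -
  define A where "A = {G. G \<noteq> bot \<and> G \<le> F}"
  have "\<exists>m\<in>A. \<forall>a\<in>A. a \<le> m \<longrightarrow> a = m"
  proof (rule predicate_Zorn)
    show "partial_order_on A (relation_of (\<lambda>x y. y \<le> x) A)"
      by (rule partial_order_on_relation_ofI) auto
    fix C assume C: "C \<in> Chains (relation_of (\<lambda>x y. y \<le> x) A)"
    then have CA: "C \<subseteq> A" and lin: "\<And>G H. G \<in> C \<Longrightarrow> H \<in> C \<Longrightarrow> G \<le> H \<or> H \<le> G"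
      by (auto simp: Chains_def relation_of_def)
    show "\<exists>u\<in>A. \<forall>a\<in>C. u \<le> a"
    proof (cases "C = {}")
      case True
      then show ?thesis using assms by (intro bexI[of _ F]) (auto simp: A_def)
    next
      case False
      \<comment> \<open>In a chain the infimum of two filters is one of them, so the chain is a
        filter base and its infimum stays proper.\<close>
      have base: "\<exists>x\<in>C. x \<le> inf G H" if "G \<in> C" "H \<in> C" for G H
        using lin[OF that] that by (metis inf.order_iff inf_commute order_refl)
      have "Inf C \<noteq> bot"
      proof
        assume "Inf C = bot"
        then have "eventually (\<lambda>_. False) (Inf C)" by simp
        then obtain G where "G \<in> C" "eventually (\<lambda>_. False) G"
          using eventually_Inf_base[OF False base] by blast
        then show False using CA by (auto simp: A_def eventually_False)
      qed
      moreover have "Inf C \<le> F" using False CA by (auto simp: A_def intro: Inf_lower2)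
      ultimately show ?thesis by (intro bexI[of _ "Inf C"]) (auto simp: A_def Inf_lower)
    qed
  qed
  then obtain U where U: "U \<noteq> bot" "U \<le> F" "\<And>G. G \<noteq> bot \<Longrightarrow> G \<le> F \<Longrightarrow> G \<le> U \<Longrightarrow> G = U"
    by (auto simp: A_def)
  have "eventually P U \<or> eventually (\<lambda>x. \<not> P x) U" for P
  proof (cases "inf U (principal {x. P x}) = bot")
    case True
    then have "eventually (\<lambda>_. False) (inf U (principal {x. P x}))" by simp
    then show ?thesis by (simp add: eventually_inf_principal)
  next
    case False
    moreover have "inf U (principal {x. P x}) \<le> F" using U(2) by (simp add: le_infI1)
    ultimately have "inf U (principal {x. P x}) = U" by (intro U(3)) simp_all
    moreover have "eventually P (inf U (principal {x. P x}))" by (simp add: eventually_inf_principal)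
    ultimately show ?thesis by simp
  qed
  then show ?thesis using U(1,2) by (intro that)
qed

text \<open>Compactness provides a cluster point, and for an ultrafilter a cluster point is a
  limit.\<close>

lemma ultrafilter_bounded_convergent:
  fixes f :: "'a \<Rightarrow> real"
  assumes ultra: "\<And>P. eventually P U \<or> eventually (\<lambda>x. \<not> P x) U" and U: "U \<noteq> bot"
    and bd: "eventually (\<lambda>x. \<bar>f x\<bar> \<le> B) U"
  shows "\<exists>l. (f \<longlongrightarrow> l) U"
proof -
  have "filtermap f U \<noteq> bot" using U by (simp add: filtermap_bot_iff)
  moreover have "eventually (\<lambda>y. y \<in> {-B..B}) (filtermap f U)"
    using bd by (auto simp: eventually_filtermap abs_le_iff elim!: eventually_mono)
  moreover have "compact {-B..B}" by simp
  ultimately obtain l where l: "inf (nhds l) (filtermap f U) \<noteq> bot"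
    unfolding compact_filter by blast
  have "(f \<longlongrightarrow> l) U"
  proof (rule topological_tendstoI, rule ccontr)
    fix S assume S: "open S" "l \<in> S" and "\<not> eventually (\<lambda>x. f x \<in> S) U"
    then have "eventually (\<lambda>x. f x \<notin> S) U" using ultra by blast
    then have "eventually (\<lambda>y. y \<notin> S) (filtermap f U)" by (simp add: eventually_filtermap)
    moreover have "eventually (\<lambda>y. y \<in> S) (nhds l)" using S by (auto simp: eventually_nhds)
    ultimately have "eventually (\<lambda>_. False) (inf (nhds l) (filtermap f U))"
      by (auto simp: eventually_inf)
    then show False using l by (simp add: eventually_False)
  qed
  then show ?thesis by blast
qed

text \<open>Pointwise limits commute with differentiation at \<open>x\<close> once the derivatives
  are equicontinuous at \<open>x\<close> along the filter.\<close>

lemma has_derivative_limit: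
  fixes a b :: "'x \<Rightarrow> real \<Rightarrow> real"
  assumes U: "U \<noteq> bot"
    and A: "\<And>y. ((\<lambda>X. a X y) \<longlongrightarrow> A y) U" and B: "((\<lambda>X. b X x) \<longlongrightarrow> B) U"
    and der: "eventually (\<lambda>X. \<forall>y. (a X has_real_derivative b X y) (at y)) U"
    and eq: "\<And>e. e > 0 \<Longrightarrow> \<exists>d>0. eventually (\<lambda>X. \<forall>y. \<bar>y - x\<bar> < d \<longrightarrow> \<bar>b X y - b X x\<bar> \<le> e) U"
  shows "(A has_real_derivative B) (at x)"
  unfolding DERIV_def
proof (rule LIM_I)
  fix e :: real assume "e > 0"
  then have "e / 2 > 0" by simp
  from eq[OF this] obtain d where d: "d > 0"
    "eventually (\<lambda>X. \<forall>y. \<bar>y - x\<bar> < d \<longrightarrow> \<bar>b X y - b X x\<bar> \<le> e / 2) U" by blast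
  have "norm ((A (x + h) - A x) / h - B) < e" if h: "h \<noteq> 0" "\<bar>h\<bar> < d" for h
  proof -
    have "eventually (\<lambda>X. \<bar>a X (x + h) - a X x - h * b X x\<bar> \<le> e / 2 * \<bar>h\<bar>) U"
      using der d(2)
    proof eventually_elim
      case (elim X)
      \<comment> \<open>The mean value inequality for \<open>a X\<close> with its slope at
        \<open>x\<close> subtracted.\<close>
      have "norm ((a X (x + h) - (x + h) * b X x) - (a X x - x * b X x)) \<le> e / 2 * norm (x + h - x)"
      proof (rule field_differentiable_bound[where S = "ball x d" and f' = "\<lambda>y. b X y - b X x"
            and f = "\<lambda>y. a X y - y * b X x"])
        fix z assume "z \<in> ball x d"
        show "((\<lambda>y. a X y - y * b X x) has_real_derivative b X z - b X x) (at z within ball x d)"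
          by (rule DERIV_subset[OF _ subset_UNIV]) (use elim in \<open>auto intro!: derivative_eq_intros\<close>)
        show "norm (b X z - b X x) \<le> e / 2"
          using elim \<open>z \<in> ball x d\<close> by (auto simp: dist_real_def abs_minus_commute)
      qed (use h d in \<open>auto simp: dist_real_def\<close>)
      then show ?case by (simp add: algebra_simps)
    qed
    moreover have "((\<lambda>X. \<bar>a X (x + h) - a X x - h * b X x\<bar>) \<longlongrightarrow> \<bar>A (x + h) - A x - h * B\<bar>) U"
      by (intro tendsto_intros A B)
    ultimately have "\<bar>A (x + h) - A x - h * B\<bar> \<le> e / 2 * \<bar>h\<bar>"
      using U by (intro tendsto_upperbound)
    moreover have "(A (x + h) - A x) / h - B = (A (x + h) - A x - h * B) / h"
      using h by (simp add: field_simps)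
    ultimately have "\<bar>(A (x + h) - A x) / h - B\<bar> \<le> e / 2"
      using h by (simp add: abs_divide field_simps)
    then show ?thesis using \<open>e > 0\<close> by simp
  qed
  then show "\<exists>s>0. \<forall>h. h \<noteq> 0 \<and> norm (h - 0) < s \<longrightarrow> norm ((A (x + h) - A x) / h - B) < e"
    using d(1) by (intro exI[of _ d]) auto
qed

text \<open>The oriented integral from 0 to \<open>y\<close>: since {a..b} is empty for
  \<open>b < a\<close>, at most one of the two terms is nonzero. Normalization at 0 keeps the values
  at each point bounded along a family, as convergence requires.\<close>

definition signed_integral :: "(real \<Rightarrow> real) \<Rightarrow> real \<Rightarrow> real" where
  "signed_integral h y = integral {0..y} h - integral {y..0} h"

lemma signed_integral_diff:
  fixes h :: "real \<Rightarrow> real"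
  assumes h: "\<And>a b. h integrable_on {a..b}" and "x \<le> y"
  shows "signed_integral h y - signed_integral h x = integral {x..y} h"
proof -
  have deg: "integral {u..v} h = 0" if "v \<le> u" for u v
    using that by (cases "u = v") auto
  have c: "integral {u..v} h + integral {v..w} h = integral {u..w} h" if "u \<le> v" "v \<le> w" for u v w
    using that by (intro Henstock_Kurzweil_Integration.integral_combine h)
  consider "0 \<le> x" | "y \<le> 0" | "x \<le> 0" "0 \<le> y" using \<open>x \<le> y\<close> by linarith
  then show ?thesis
  proof cases
    case 1
    then show ?thesis using c[of 0 x y] deg[of 0 x] deg[of 0 y] \<open>x \<le> y\<close> by (simp add: signed_integral_def)
  next
    case 2
    then show ?thesis using c[of x y 0] deg[of x 0] deg[of y 0] \<open>x \<le> y\<close> by (simp add: signed_integral_def)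
  next
    case 3
    then show ?thesis using c[of x 0 y] deg[of x 0] deg[of 0 y] by (simp add: signed_integral_def)
  qed
qed

lemma signed_integral_abs_le:
  fixes h :: "real \<Rightarrow> real"
  assumes "\<And>x. h x \<ge> 0" "\<And>a b. h integrable_on {a..b}"
  shows "\<bar>signed_integral h y\<bar> \<le> integral {-\<bar>y\<bar>..\<bar>y\<bar>} h"
proof -
  have "0 \<le> integral {0..y} h" "0 \<le> integral {y..0} h"
    by (intro Henstock_Kurzweil_Integration.integral_nonneg assms)+
  moreover have "integral {0..y} h \<le> integral {-\<bar>y\<bar>..\<bar>y\<bar>} h" "integral {y..0} h \<le> integral {-\<bar>y\<bar>..\<bar>y\<bar>} h"
    using assms by (intro integral_subset_le; auto)+
  ultimately show ?thesis unfolding signed_integral_def by linarith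
qed

lemma integral_powr_le_LINT:
  assumes "g \<in> Lp p"
  shows "integral {a..b} (\<lambda>x. \<bar>g x\<bar> powr p) \<le> (LINT x|lebesgue. \<bar>g x\<bar> powr p)"
  using sum_integral_disjoint_le[of "{()}" "\<lambda>_. a" "\<lambda>_. b" "\<lambda>x. \<bar>g x\<bar> powr p"] Lp_integrable[OF assms]
  by (simp add: disjoint_family_on_def)

text \<open>Weak compactness of bounded sets in \<open>L_p\<close>, in terms of primitives: along the ultrafilter also
  the primitives of \<open>\<bar>w X\<bar>\<close> and of \<open>\<bar>w X\<bar> powr p\<close> converge. The former dominates the increments of
  \<open>G\<close>, which gives a density, and the latter controls its \<open>L_p\<close> norm.\<close>

lemma primitive_ultralimit:
  fixes v w :: "'x \<Rightarrow> real \<Rightarrow> real"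
  assumes ultra: "\<And>P. eventually P U \<or> eventually (\<lambda>x. \<not> P x) U" and U: "U \<noteq> bot" and p: "p > 1"
    and w: "eventually (\<lambda>X. w X \<in> Lp p \<and> primitive (w X) (v X) \<and> (LINT x|lebesgue. \<bar>w X x\<bar> powr p) \<le> \<Lambda>) U"
    and G: "\<And>y. ((\<lambda>X. v X y) \<longlongrightarrow> G y) U"
  shows "\<exists>g. g \<in> Lp p \<and> primitive g G \<and> (LINT x|lebesgue. \<bar>g x\<bar> powr p) \<le> 2 powr p * \<Lambda>"
proof -
  define n where "n X = signed_integral (\<lambda>x. \<bar>w X x\<bar>)" for X
  define q where "q X = signed_integral (\<lambda>x. \<bar>w X x\<bar> powr p)" for X
  have n_diff: "n X y - n X x = integral {x..y} (\<lambda>x. \<bar>w X x\<bar>)" if "w X \<in> Lp p" "x \<le> y" for X x y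
    unfolding n_def using that by (intro signed_integral_diff Lp_abs_integrable_on[OF _ p])
  have q_diff: "q X y - q X x = integral {x..y} (\<lambda>x. \<bar>w X x\<bar> powr p)" if "w X \<in> Lp p" "x \<le> y" for X x y
    unfolding q_def using that by (intro signed_integral_diff Lp_powr_integrable_on)
  have qb: "eventually (\<lambda>X. \<bar>q X y\<bar> \<le> \<Lambda>) U" for y
    using w
  proof eventually_elim
    case (elim X)
    have "\<bar>q X y\<bar> \<le> integral {-\<bar>y\<bar>..\<bar>y\<bar>} (\<lambda>x. \<bar>w X x\<bar> powr p)"
      unfolding q_def using elim by (intro signed_integral_abs_le Lp_powr_integrable_on) auto
    then show ?case using integral_powr_le_LINT[of "w X" p "-\<bar>y\<bar>" "\<bar>y\<bar>"] elim by linarith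
  qed
  have nb: "eventually (\<lambda>X. \<bar>n X y\<bar> \<le> 2 * \<bar>y\<bar> + \<Lambda>) U" for y
    using w
  proof eventually_elim
    case (elim X)
    have "\<bar>n X y\<bar> \<le> integral {-\<bar>y\<bar>..\<bar>y\<bar>} (\<lambda>x. \<bar>w X x\<bar>)"
      unfolding n_def using elim by (intro signed_integral_abs_le Lp_abs_integrable_on[OF _ p]) auto
    also have "\<dots> \<le> 1 * (\<bar>y\<bar> - -\<bar>y\<bar>) + 1 powr (1 - p) * integral {-\<bar>y\<bar>..\<bar>y\<bar>} (\<lambda>x. \<bar>w X x\<bar> powr p)"
      using elim by (intro Lp_integral_le_young p) auto
    finally show ?case using integral_powr_le_LINT[of "w X" p "-\<bar>y\<bar>" "\<bar>y\<bar>"] elim by simp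
  qed
  obtain N where N: "\<And>y. ((\<lambda>X. n X y) \<longlongrightarrow> N y) U"
    using ultrafilter_bounded_convergent[OF ultra U nb] by metis
  obtain M where M: "\<And>y. ((\<lambda>X. q X y) \<longlongrightarrow> M y) U"
    using ultrafilter_bounded_convergent[OF ultra U qb] by metis
  have le: "\<bar>G y - G x\<bar> \<le> N y - N x" if "x \<le> y" for x y
  proof (rule tendsto_le[OF U])
    show "((\<lambda>X. n X y - n X x) \<longlongrightarrow> N y - N x) U" by (intro tendsto_intros N)
    show "((\<lambda>X. \<bar>v X y - v X x\<bar>) \<longlongrightarrow> \<bar>G y - G x\<bar>) U" by (intro tendsto_intros G)
    show "eventually (\<lambda>X. \<bar>v X y - v X x\<bar> \<le> n X y - n X x) U"
      using w
    proof eventually_elim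
      case (elim X)
      then have "\<bar>v X y - v X x\<bar> \<le> integral {x..y} (\<lambda>x. \<bar>w X x\<bar>)"
        using that by (intro primitive_abs_diff_le Lp_interval[OF _ p]) auto
      then show ?case using n_diff[of X x y] elim that by simp
    qed
  qed
  have ac: "absolutely_continuous_on UNIV N"
    unfolding absolutely_continuous_on_def
  proof (intro allI impI)
    fix e :: real assume "e > 0"
    then have "e / 2 > 0" by simp
    from young_small_exists[OF p this] obtain t where t: "t > 0" "t powr (1 - p) * \<Lambda> < e / 2" by blast
    show "\<exists>\<delta>>0. \<forall>(k::nat) a b.
           (\<forall>i<k. a i \<le> b i \<and> {a i..b i} \<subseteq> UNIV) \<longrightarrow>
           disjoint_family_on (\<lambda>i. {a i<..<b i}) {..<k} \<longrightarrow>
           (\<Sum>i<k. b i - a i) < \<delta> \<longrightarrow> (\<Sum>i<k. \<bar>N (b i) - N (a i)\<bar>) < e"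
    proof (intro exI[of _ "e / (2 * t)"] conjI allI impI)
      show "e / (2 * t) > 0" using \<open>e > 0\<close> t by simp
      fix k :: nat and a b
      assume *: "\<forall>i<k. a i \<le> b i \<and> {a i..b i} \<subseteq> UNIV" "disjoint_family_on (\<lambda>i. {a i<..<b i}) {..<k}"
        "(\<Sum>i<k. b i - a i) < e / (2 * t)"
      \<comment> \<open>One \<open>t\<close> serves all \<open>X\<close>, since only
        \<open>\<Lambda>\<close> enters the bound; finitely many points are involved, so it survives
        the pointwise limit.\<close>
      have "eventually (\<lambda>X. (\<Sum>i<k. \<bar>n X (b i) - n X (a i)\<bar>) \<le> t * (\<Sum>i<k. b i - a i) + t powr (1 - p) * \<Lambda>) U"
        using w
      proof eventually_elim
        case (elim X)
        have "(\<Sum>i<k. \<bar>n X (b i) - n X (a i)\<bar>) = (\<Sum>i<k. integral {a i..b i} (\<lambda>x. \<bar>w X x\<bar>))"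
        proof (rule sum.cong[OF refl])
          fix i assume "i \<in> {..<k}"
          then have "n X (b i) - n X (a i) = integral {a i..b i} (\<lambda>x. \<bar>w X x\<bar>)"
            using elim * by (intro n_diff) auto
          moreover have "integral {a i..b i} (\<lambda>x. \<bar>w X x\<bar>) \<ge> 0"
            using elim by (intro Henstock_Kurzweil_Integration.integral_nonneg Lp_abs_integrable_on[OF _ p]) auto
          ultimately show "\<bar>n X (b i) - n X (a i)\<bar> = integral {a i..b i} (\<lambda>x. \<bar>w X x\<bar>)" by simp
        qed
        also have "\<dots> \<le> t * (\<Sum>i<k. b i - a i) + t powr (1 - p) * (LINT x|lebesgue. \<bar>w X x\<bar> powr p)"
          using elim * by (intro Lp_sum_integral_le_young p t) auto
        also have "\<dots> \<le> t * (\<Sum>i<k. b i - a i) + t powr (1 - p) * \<Lambda>"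
          using elim by (intro add_left_mono mult_left_mono) auto
        finally show ?case .
      qed
      moreover have "((\<lambda>X. \<Sum>i<k. \<bar>n X (b i) - n X (a i)\<bar>) \<longlongrightarrow> (\<Sum>i<k. \<bar>N (b i) - N (a i)\<bar>)) U"
        by (intro tendsto_intros N)
      ultimately have "(\<Sum>i<k. \<bar>N (b i) - N (a i)\<bar>) \<le> t * (\<Sum>i<k. b i - a i) + t powr (1 - p) * \<Lambda>"
        using U by (intro tendsto_upperbound)
      also have "t * (\<Sum>i<k. b i - a i) < t * (e / (2 * t))"
        using * t by (intro mult_strict_left_mono) auto
      also have "t * (e / (2 * t)) = e / 2" using t by simp
      finally show "(\<Sum>i<k. \<bar>N (b i) - N (a i)\<bar>) < e" using t by linarith
    qed
  qed
  obtain g where g: "g \<in> borel_measurable borel" "primitive g G"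
    using dominated_increments_primitive[OF le ac] by blast
  have Mmono: "M x \<le> M y" if "x \<le> y" for x y
  proof (rule tendsto_le[OF U M M])
    show "eventually (\<lambda>X. q X x \<le> q X y) U"
      using w
    proof eventually_elim
      case (elim X)
      have "integral {x..y} (\<lambda>x. \<bar>w X x\<bar> powr p) \<ge> 0"
        using elim by (intro Henstock_Kurzweil_Integration.integral_nonneg Lp_powr_integrable_on) auto
      then show ?case using q_diff[of X x y] elim that by linarith
    qed
  qed
  have Mbd: "M y - M x \<le> \<Lambda>" if "x \<le> y" for x y
  proof (rule tendsto_upperbound[OF _ _ U])
    show "((\<lambda>X. q X y - q X x) \<longlongrightarrow> M y - M x) U" by (intro tendsto_intros M)
    show "eventually (\<lambda>X. q X y - q X x \<le> \<Lambda>) U"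
      using w
    proof eventually_elim
      case (elim X)
      then show ?case using q_diff[of X x y] integral_powr_le_LINT[of "w X" p x y] that by linarith
    qed
  qed
  have young: "\<bar>G y - G x\<bar> \<le> t * (y - x) + t powr (1 - p) * (M y - M x)" if "x < y" "t > 0" for x y t
  proof (rule tendsto_le[OF U])
    show "((\<lambda>X. t * (y - x) + t powr (1 - p) * (q X y - q X x)) \<longlongrightarrow> t * (y - x) + t powr (1 - p) * (M y - M x)) U"
      by (intro tendsto_intros M)
    show "((\<lambda>X. \<bar>v X y - v X x\<bar>) \<longlongrightarrow> \<bar>G y - G x\<bar>) U" by (intro tendsto_intros G)
    show "eventually (\<lambda>X. \<bar>v X y - v X x\<bar> \<le> t * (y - x) + t powr (1 - p) * (q X y - q X x)) U"
      using w
    proof eventually_elim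
      case (elim X)
      have "\<bar>v X y - v X x\<bar> \<le> integral {x..y} (\<lambda>x. \<bar>w X x\<bar>)"
        using elim that by (intro primitive_abs_diff_le Lp_interval[OF _ p]) auto
      also have "\<dots> \<le> t * (y - x) + t powr (1 - p) * integral {x..y} (\<lambda>x. \<bar>w X x\<bar> powr p)"
        using elim that by (intro Lp_integral_le_young p) auto
      finally show ?case using q_diff[of X x y] elim that by simp
    qed
  qed
  from primitive_Lp_of_young[OF g(1,2) p Mmono Mbd young] g(2) show ?thesis by blast
qed


subsection \<open>Extension from arbitrary sets\<close>

text \<open>Downward induction on \<open>k\<close>: a zero of \<open>h k\<close> and a bound on
  \<open>h (Suc k)\<close> bound \<open>h k\<close>, with a factor \<open>2 * R\<close> for the
  length. At the top no derivative is available, and the oscillation takes its place.\<close>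

lemma derivatives_bound_between_zeros:
  fixes h :: "nat \<Rightarrow> real \<Rightarrow> real"
  assumes h: "\<And>k x. k < n \<Longrightarrow> (h k has_real_derivative h (Suc k) x) (at x)"
    and z: "\<And>k. k \<le> n \<Longrightarrow> \<exists>z\<in>{-R..R}. h k z = 0"
    and top: "\<And>x y. x \<in> {-R..R} \<Longrightarrow> y \<in> {-R..R} \<Longrightarrow> \<bar>h n x - h n y\<bar> \<le> B"
    and "B \<ge> 0" "R \<ge> 0" "k \<le> n" "x \<in> {-R..R}"
  shows "\<bar>h k x\<bar> \<le> (2 * R) ^ (n - k) * B"
  using \<open>k \<le> n\<close> \<open>x \<in> {-R..R}\<close>
proof (induction "n - k" arbitrary: k x)
  case 0
  then have "k = n" by simp
  then show ?case using z[of n] top[of x] 0 by fastforce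
next
  case (Suc j)
  then have k: "k < n" "n - Suc k = j" by auto
  obtain y where y: "y \<in> {-R..R}" "h k y = 0" using z[of k] Suc.prems(1) by blast
  have "norm (h k x - h k y) \<le> ((2 * R) ^ j * B) * norm (x - y)"
  proof (rule field_differentiable_bound[where S = "{-R..R}" and f' = "h (Suc k)"])
    show "(h k has_real_derivative h (Suc k) t) (at t within {-R..R})" for t
      by (rule DERIV_subset[OF h[OF k(1)] subset_UNIV])
    show "norm (h (Suc k) t) \<le> (2 * R) ^ j * B" if "t \<in> {-R..R}" for t
      using Suc.hyps(1)[of "Suc k" t] that k by simp
  qed (use Suc.prems y in auto)
  also have "\<dots> \<le> ((2 * R) ^ j * B) * (2 * R)"
    using Suc.prems(2) y(1) assms by (intro mult_left_mono) auto
  also have "\<dots> = (2 * R) ^ (n - k) * B" by (simp add: Suc.hyps(2)[symmetric])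
  finally show ?case using y(2) by simp
qed

lemma smooth_primitive_deriv:
  assumes "smooth f" "m \<ge> 1"
  shows "primitive ((deriv ^^ m) f) ((deriv ^^ (m - 1)) f)"
  unfolding primitive_def
proof (intro allI impI)
  fix x y :: real assume "x \<le> y"
  then show "((deriv ^^ m) f has_integral (deriv ^^ (m - 1)) f y - (deriv ^^ (m - 1)) f x) {x..y}"
    using smooth_funpow_has_deriv[OF assms(1), of "m - 1"] assms(2)
    by (intro fundamental_theorem_of_calculus)
       (auto intro: has_field_derivative_at_within simp flip: has_real_derivative_iff_has_vector_derivative)
qed

text \<open>The bound involves \<open>w\<close> only through \<open>\<Lambda>\<close>, so it gives
  equicontinuity of a whole family of primitives.\<close>

lemma primitive_diff_le_young:
  assumes "primitive w v" "w \<in> Lp p" "p > 1" "(LINT s|lebesgue. \<bar>w s\<bar> powr p) \<le> \<Lambda>" "t > 0"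
    and ab: "x \<in> {a..b}" "y \<in> {a..b}"
  shows "\<bar>v y - v x\<bar> \<le> t * (b - a) + t powr (1 - p) * \<Lambda>"
proof -
  have "\<bar>v y - v x\<bar> \<le> integral {a..b} (\<lambda>s. \<bar>w s\<bar>)"
    by (rule primitive_diff_le_integral[OF assms(1-3) ab])
  also have "\<dots> \<le> t * (b - a) + t powr (1 - p) * integral {a..b} (\<lambda>s. \<bar>w s\<bar> powr p)"
    using ab assms by (intro Lp_integral_le_young) auto
  also have "\<dots> \<le> t * (b - a) + t powr (1 - p) * \<Lambda>"
    using integral_powr_le_LINT[OF assms(2), of a b] assms(4) by (intro add_left_mono mult_left_mono) auto
  finally show ?thesis .
qed

text \<open>The difference between an extension from \<open>X\<close> and \<open>F\<close> vanishes
  on \<open>Z\<close>, so each of its derivatives of order less than \<open>m\<close> has a zero in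
  a fixed interval. This bounds the derivatives independently of \<open>X\<close>, which gives the
  limits; equicontinuity makes them a chain of derivatives.\<close>

lemma extension_ultralimit:
  fixes \<Phi> :: "real set \<Rightarrow> (real \<Rightarrow> real) \<Rightarrow> real \<Rightarrow> real"
  assumes ultra: "\<And>P. eventually P U \<or> eventually (\<lambda>x. \<not> P x) U" and U: "U \<noteq> bot"
    and ev: "eventually (\<lambda>X. Z \<subseteq> X \<and> X \<subseteq> E \<and> extension_operator m K X (\<Phi> X)) U"
    and Z: "finite Z" "card Z = m" and m: "m \<ge> 1" and p: "p > 1" and K: "K \<ge> 0"
    and F: "F \<in> sobolev m p" "\<And>x. x \<in> E \<Longrightarrow> F x = f x"
  shows "\<exists>V g. (\<forall>k\<le>m - 1. \<forall>x. ((\<lambda>X. (deriv ^^ k) (\<Phi> X f) x) \<longlongrightarrow> V k x) U) \<and>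
     (\<forall>k<m - 1. \<forall>x. (V k has_real_derivative V (Suc k) x) (at x)) \<and>
     g \<in> Lp p \<and> primitive g (V (m - 1)) \<and> Lp_norm p g \<le> 2 * K * sobolev_seminorm m p F"
proof -
  define n where "n = m - 1"
  define u where "u k = (deriv ^^ k) F" for k
  define v where "v X k = (deriv ^^ k) (\<Phi> X f)" for X k
  define w where "w X = (deriv ^^ m) (\<Phi> X f)" for X
  have u_der: "(u k has_real_derivative u (Suc k) x) (at x)" if "k < n" for k x
    using sobolev_derivative_chain[OF F(1), of k x] that by (simp add: u_def n_def)
  obtain g0 where g0: "g0 \<in> Lp p" "primitive g0 (u n)" "sobolev_seminorm m p F = Lp_norm p g0"
    using sobolev_primitive[OF F(1) p] unfolding u_def n_def by blast
  define \<Lambda>0 where "\<Lambda>0 = (LINT x|lebesgue. \<bar>g0 x\<bar> powr p)"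
  define \<Lambda> where "\<Lambda> = K powr p * \<Lambda>0"
  have \<Lambda>: "\<Lambda>0 \<ge> 0" "\<Lambda> \<ge> 0" by (simp_all add: \<Lambda>0_def \<Lambda>_def)
  define good where "good X \<longleftrightarrow> smooth (\<Phi> X f) \<and> (\<forall>x\<in>Z. \<Phi> X f x = f x) \<and> w X \<in> Lp p \<and>
      primitive (w X) (v X n) \<and> (LINT x|lebesgue. \<bar>w X x\<bar> powr p) \<le> \<Lambda>" for X
  have ZE: "Z \<subseteq> E"
    using eventually_happens'[OF U ev] by blast
  have evgood: "eventually good U"
    using ev
  proof eventually_elim
    case (elim X)
    then have op: "extension_operator m K X (\<Phi> X)" by blast
    then have sm: "smooth (\<Phi> X f)" by (simp add: extension_operator_def)
    have u1: "\<forall>k<m - 1. \<forall>x. (u k has_real_derivative u (Suc k) x) (at x)" using u_der by (simp add: n_def)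
    have u2: "\<forall>x\<in>X. u 0 x = f x" using elim F(2) by (auto simp: u_def)
    have u3: "primitive g0 (u (m - 1))" using g0(2) by (simp add: n_def)
    have est: "w X \<in> Lp p \<and> (LINT x|lebesgue. \<bar>w X x\<bar> powr p) \<le> \<Lambda>"
      using op p u1 u2 g0(1) u3 unfolding extension_operator_def w_def \<Lambda>_def \<Lambda>0_def by blast
    have "\<forall>x\<in>Z. \<Phi> X f x = f x" using op elim by (auto simp: extension_operator_def)
    moreover have "primitive (w X) (v X n)"
      unfolding w_def v_def n_def by (rule smooth_primitive_deriv[OF sm m])
    ultimately show ?case using sm est by (simp add: good_def)
  qed
  have v_der: "(v X k has_real_derivative v X (Suc k) x) (at x)" if "good X" for X k x
    using smooth_funpow_has_deriv[of "\<Phi> X f" k x] that by (simp add: good_def v_def)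
  have "bounded Z" using Z(1) by (rule finite_imp_bounded)
  then obtain R0 where "\<forall>x\<in>Z. \<bar>x\<bar> \<le> R0" unfolding bounded_real by blast
  then have R0: "Z \<subseteq> {-r..r}" if "r \<ge> R0" for r using that by (force simp: abs_le_iff)
  \<comment> \<open>The Young bound with \<open>t = 1\<close> on an interval of length
    \<open>2 * r\<close>, once for the extension and once for \<open>F\<close>.\<close>
  define b where "b r = 4 * r + \<Lambda> + \<Lambda>0" for r
  have diff_bound: "\<bar>v X k x - u k x\<bar> \<le> (2 * r) ^ (n - k) * b r"
    if X: "good X" and r: "r \<ge> R0" "r \<ge> 0" and k: "k \<le> n" and x: "x \<in> {-r..r}" for X k r x
  proof (rule derivatives_bound_between_zeros[where h = "\<lambda>k x. v X k x - u k x" and n = n])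
    have hd: "((\<lambda>x. v X k x - u k x) has_real_derivative v X (Suc k) x - u (Suc k) x) (at x)" if "k < n" for k x
      by (intro DERIV_diff v_der X u_der that)
    then show "((\<lambda>x. v X k x - u k x) has_real_derivative v X (Suc k) x - u (Suc k) x) (at x)" if "k < n" for k x
      using that .
    show "\<exists>z\<in>{-r..r}. v X k z - u k z = 0" if "k \<le> n" for k
    proof (rule higher_derivative_zero[where u = "\<lambda>k x. v X k x - u k x", OF hd Z(1) _ R0[OF r(1)] _ that])
      show "card Z = Suc n" using Z(2) m by (simp add: n_def)
      show "v X 0 x - u 0 x = 0" if "x \<in> Z" for x
        using X that F(2) ZE by (auto simp: good_def v_def u_def)
    qed
    show "\<bar>(v X n y - u n y) - (v X n z - u n z)\<bar> \<le> b r" if "y \<in> {-r..r}" "z \<in> {-r..r}" for y z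
    proof -
      have "\<bar>v X n y - v X n z\<bar> \<le> 1 * (r - -r) + 1 powr (1 - p) * \<Lambda>"
        using X that by (intro primitive_diff_le_young p) (auto simp: good_def)
      moreover have "\<bar>u n y - u n z\<bar> \<le> 1 * (r - -r) + 1 powr (1 - p) * \<Lambda>0"
        using that by (intro primitive_diff_le_young[OF g0(2,1)] p) (auto simp: \<Lambda>0_def)
      ultimately show ?thesis by (simp add: b_def)
    qed
    show "b r \<ge> 0" using r \<Lambda> by (simp add: b_def)
  qed (use r k x in auto)
  have "\<exists>l. k \<le> n \<longrightarrow> ((\<lambda>X. v X k x) \<longlongrightarrow> l) U" for k x
  proof (cases "k \<le> n")
    case True
    define r where "r = max \<bar>R0\<bar> \<bar>x\<bar>"
    have r: "r \<ge> R0" "r \<ge> 0" "x \<in> {-r..r}" by (auto simp: r_def)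
    have "eventually (\<lambda>X. \<bar>v X k x\<bar> \<le> (2 * r) ^ (n - k) * b r + \<bar>u k x\<bar>) U"
      using evgood
    proof eventually_elim
      case (elim X)
      show ?case using diff_bound[OF elim r(1,2) True r(3)] by linarith
    qed
    from ultrafilter_bounded_convergent[OF ultra U this] show ?thesis by blast
  qed simp
  then obtain V where V: "\<And>k x. k \<le> n \<Longrightarrow> ((\<lambda>X. v X k x) \<longlongrightarrow> V k x) U" by metis
  have V_der: "(V k has_real_derivative V (Suc k) x) (at x)" if k: "k < n" for k x
  proof (rule has_derivative_limit[where a = "\<lambda>X. v X k" and b = "\<lambda>X. v X (Suc k)", OF U])
    show "((\<lambda>X. v X k y) \<longlongrightarrow> V k y) U" "((\<lambda>X. v X (Suc k) x) \<longlongrightarrow> V (Suc k) x) U" for y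
      using k by (auto intro: V)
    show "eventually (\<lambda>X. \<forall>y. (v X k has_real_derivative v X (Suc k) y) (at y)) U"
      using evgood by eventually_elim (simp add: v_der)
    fix e :: real assume e: "e > 0"
    show "\<exists>d>0. eventually (\<lambda>X. \<forall>y. \<bar>y - x\<bar> < d \<longrightarrow> \<bar>v X (Suc k) y - v X (Suc k) x\<bar> \<le> e) U"
    \<comment> \<open>The top derivative has a modulus of continuity from the L_p bound only; the
      lower ones are Lipschitz with a constant independent of \<open>X\<close>.\<close>
    proof (cases "Suc k = n")
      case True
      from young_small_exists[OF p, of "e / 2"] e
      obtain t where t: "t > 0" "t powr (1 - p) * \<Lambda> < e / 2" by auto
      \<comment> \<open>The interval around \<open>x\<close> has length \<open>e / (2 * t)\<close>,
        so the term linear in \<open>t\<close> contributes \<open>e / 2\<close>.\<close>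
      have "eventually (\<lambda>X. \<forall>y. \<bar>y - x\<bar> < e / (4 * t) \<longrightarrow> \<bar>v X (Suc k) y - v X (Suc k) x\<bar> \<le> e) U"
        using evgood
      proof (eventually_elim, intro allI impI)
        fix X y assume X: "good X" and y: "\<bar>y - x\<bar> < e / (4 * t)"
        have "\<bar>v X n y - v X n x\<bar> \<le> t * ((x + e / (4 * t)) - (x - e / (4 * t))) + t powr (1 - p) * \<Lambda>"
          using X y t e by (intro primitive_diff_le_young p) (auto simp: good_def abs_less_iff)
        also have "t * ((x + e / (4 * t)) - (x - e / (4 * t))) = e / 2" using t by simp
        finally show "\<bar>v X (Suc k) y - v X (Suc k) x\<bar> \<le> e" using t True by simp
      qed
      then show ?thesis using e t by (intro exI[of _ "e / (4 * t)"]) auto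
    next
      case False
      then have k2: "Suc (Suc k) \<le> n" using k by simp
      define r where "r = max \<bar>R0\<bar> (\<bar>x\<bar> + 1)"
      have r: "r \<ge> R0" "r \<ge> 0" by (auto simp: r_def)
      have near: "y \<in> {-r..r}" if "\<bar>y - x\<bar> \<le> 1" for y using that by (auto simp: r_def)
      have "continuous_on {-r..r} (u (Suc (Suc k)))"
      proof (cases "Suc (Suc k) = n")
        case True
        then show ?thesis using primitive_continuous_on[OF g0(2)] by simp
      next
        case False
        then show ?thesis
          using u_der[of "Suc (Suc k)"] k2 by (intro DERIV_continuous_on[where D = "u (Suc (Suc (Suc k)))"])
            (auto intro: DERIV_subset)
      qed
      then have "bounded (u (Suc (Suc k)) ` {-r..r})"
        by (intro compact_imp_bounded compact_continuous_image) auto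
      then obtain c where c: "\<And>y. y \<in> {-r..r} \<Longrightarrow> \<bar>u (Suc (Suc k)) y\<bar> \<le> c"
        unfolding bounded_real by blast
      define D where "D = \<bar>(2 * r) ^ (n - Suc (Suc k)) * b r + c\<bar> + 1"
      have D: "D > 0" by (simp add: D_def)
      define d where "d = min 1 (e / D)"
      have d: "d > 0" "d \<le> 1" "d \<le> e / D" using e D by (auto simp: d_def)
      have "eventually (\<lambda>X. \<forall>y. \<bar>y - x\<bar> < d \<longrightarrow> \<bar>v X (Suc k) y - v X (Suc k) x\<bar> \<le> e) U"
        using evgood
      proof (eventually_elim, intro allI impI)
        fix X y assume X: "good X" and y: "\<bar>y - x\<bar> < d"
        have "norm (v X (Suc k) y - v X (Suc k) x) \<le> D * norm (y - x)"
        proof (rule field_differentiable_bound[where S = "{-r..r}" and f' = "v X (Suc (Suc k))"])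
          show "(v X (Suc k) has_real_derivative v X (Suc (Suc k)) z) (at z within {-r..r})" for z
            by (rule DERIV_subset[OF v_der[OF X] subset_UNIV])
          show "norm (v X (Suc (Suc k)) z) \<le> D" if "z \<in> {-r..r}" for z
            using diff_bound[OF X r k2 that] c[OF that] by (simp add: D_def)
        qed (use near[of x] near[of y] y d in auto)
        also have "\<dots> \<le> D * (e / D)" using y d D by (intro mult_left_mono) auto
        also have "\<dots> = e" using D by simp
        finally show "\<bar>v X (Suc k) y - v X (Suc k) x\<bar> \<le> e" by simp
      qed
      then show ?thesis using d by blast
    qed
  qed
  have "\<exists>g. g \<in> Lp p \<and> primitive g (V n) \<and> (LINT x|lebesgue. \<bar>g x\<bar> powr p) \<le> 2 powr p * \<Lambda>"
    by (rule primitive_ultralimit[OF ultra U p, where w = w and v = "\<lambda>X. v X n"])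
       (use evgood V in \<open>auto simp: good_def elim!: eventually_mono\<close>)
  then obtain g where g: "g \<in> Lp p" "primitive g (V n)" "(LINT x|lebesgue. \<bar>g x\<bar> powr p) \<le> 2 powr p * \<Lambda>"
    by blast
  have "Lp_norm p g \<le> (2 powr p * \<Lambda>) powr (1 / p)"
    unfolding Lp_norm_def using g(3) p by (intro powr_mono2) auto
  \<comment> \<open>Both 2 and \<open>K\<close> enter as p-th powers, so the root removes
    \<open>p\<close> from the constant.\<close>
  also have "\<dots> = 2 * K * \<Lambda>0 powr (1 / p)"
    using p K \<Lambda> by (simp add: \<Lambda>_def powr_mult powr_powr)
  also have "\<Lambda>0 powr (1 / p) = sobolev_seminorm m p F"
    by (simp add: g0(3) Lp_norm_def \<Lambda>0_def)
  finally have "Lp_norm p g \<le> 2 * K * sobolev_seminorm m p F" .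
  then show ?thesis
    using V V_der g(1,2) unfolding v_def n_def by blast
qed

lemma extension_operator_cong:
  "extension_operator m K X \<Phi> \<Longrightarrow> (\<And>x. x \<in> X \<Longrightarrow> f x = g x) \<Longrightarrow> \<Phi> f = \<Phi> g"
  and extension_operator_add:
  "extension_operator m K X \<Phi> \<Longrightarrow> \<Phi> (\<lambda>x. f x + g x) = (\<lambda>x. \<Phi> f x + \<Phi> g x)"
  and extension_operator_cmult:
  "extension_operator m K X \<Phi> \<Longrightarrow> \<Phi> (\<lambda>x. c * f x) = (\<lambda>x. c * \<Phi> f x)"
  unfolding extension_operator_def by meson+

text \<open>The bound is stated against every \<open>F\<close> with trace \<open>f\<close>; the
  infimum of the trace seminorm is taken only at the very end.\<close>

definition trace_extension :: "nat \<Rightarrow> real \<Rightarrow> real set \<Rightarrow> real \<Rightarrow> ((real \<Rightarrow> real) \<Rightarrow> real \<Rightarrow> real) \<Rightarrow> bool" where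
  "trace_extension m p E C T \<longleftrightarrow> linear_on_trace_space m p E T \<and>
     (\<forall>F\<in>sobolev m p. \<forall>f. restrict F E = f \<longrightarrow>
        T f \<in> sobolev m p \<and> restrict (T f) E = f \<and> sobolev_seminorm m p (T f) \<le> C * sobolev_seminorm m p F)"

text \<open>The ultrafilter refines the directed family of finite subsets of \<open>E\<close>, so
  each point of \<open>E\<close> eventually belongs to \<open>X\<close> and interpolation survives
  the limit. Since \<open>\<Phi>\<close> and \<open>U\<close> are fixed before \<open>f\<close>, the
  limit is linear.\<close>

lemma trace_extension_many_points:
  assumes m: "m \<ge> 1" and K: "K \<ge> 0" and p: "p > 1"
    and ops: "\<And>X. finite X \<Longrightarrow> card X \<ge> m \<Longrightarrow> \<exists>\<Phi>. extension_operator m K X \<Phi>"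
    and Z: "finite Z" "card Z = m" "Z \<subseteq> E"
  shows "\<exists>T. trace_extension m p E (2 * K) T"
proof -
  have "\<forall>X. \<exists>\<Phi>. finite X \<and> card X \<ge> m \<longrightarrow> extension_operator m K X \<Phi>" using ops by blast
  then obtain \<Phi> where \<Phi>: "\<And>X. finite X \<Longrightarrow> card X \<ge> m \<Longrightarrow> extension_operator m K X (\<Phi> X)" by metis
  obtain U where U: "U \<le> finite_subsets_at_top E" "U \<noteq> bot"
    and ultra: "\<And>P. eventually P U \<or> eventually (\<lambda>x. \<not> P x) U"
    using ultrafilter_exists[OF finite_subsets_at_top_neq_bot[of E]] by blast
  have sup: "eventually (\<lambda>X. finite X \<and> Y \<subseteq> X \<and> X \<subseteq> E) U" if "finite Y" "Y \<subseteq> E" for Y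
  proof -
    have "eventually (\<lambda>X. finite X \<and> Y \<subseteq> X \<and> X \<subseteq> E) (finite_subsets_at_top E)"
      using that unfolding eventually_finite_subsets_at_top by blast
    then show ?thesis using U(1) by (rule filter_leD[rotated])
  qed
  have ev: "eventually (\<lambda>X. Z \<subseteq> X \<and> X \<subseteq> E \<and> extension_operator m K X (\<Phi> X)) U"
    using sup[OF Z(1,3)]
  proof eventually_elim
    case (elim X)
    then have "m \<le> card X" using Z(2) card_mono by metis
    then show ?case using elim \<Phi> by blast
  qed
  \<comment> \<open>\<open>Lim\<close> is total; its value is meaningful for traces, for which
    \<open>ext\<close> shows convergence.\<close>
  define T where "T f x = Lim U (\<lambda>X. \<Phi> X f x)" for f x
  have ext: "(\<forall>x. ((\<lambda>X. \<Phi> X f x) \<longlongrightarrow> T f x) U) \<and> T f \<in> sobolev m p \<and> restrict (T f) E = f \<and>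
      sobolev_seminorm m p (T f) \<le> 2 * K * sobolev_seminorm m p F"
    if F: "F \<in> sobolev m p" "restrict F E = f" for F f
  proof -
    have Ff: "F x = f x" if "x \<in> E" for x using F(2) that by auto
    obtain V g where V: "\<forall>k\<le>m - 1. \<forall>x. ((\<lambda>X. (deriv ^^ k) (\<Phi> X f) x) \<longlongrightarrow> V k x) U"
      "\<forall>k<m - 1. \<forall>x. (V k has_real_derivative V (Suc k) x) (at x)"
      and g: "g \<in> Lp p" "primitive g (V (m - 1))" "Lp_norm p g \<le> 2 * K * sobolev_seminorm m p F"
      using extension_ultralimit[OF ultra U(2) ev Z(1,2) m p K F(1) Ff] by blast
    have lim: "((\<lambda>X. \<Phi> X f x) \<longlongrightarrow> V 0 x) U" for x using V(1)[rule_format, of 0 x] by simp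
    then have TV: "T f = V 0" by (simp add: fun_eq_iff T_def tendsto_Lim[OF U(2)])
    have sob: "V 0 \<in> sobolev m p" "sobolev_seminorm m p (V 0) = Lp_norm p g"
      using sobolev_from_jet[where u = V and m = m and g = g and p = p] V(2) g(1,2) p by blast+
    have "T f x = f x" if "x \<in> E" for x
    proof -
      have "eventually (\<lambda>X. {x} \<subseteq> X) U" using sup[of "{x}"] that by (auto elim: eventually_mono)
      then have "eventually (\<lambda>X. \<Phi> X f x = f x) U"
        using ev by eventually_elim (auto simp: extension_operator_def)
      then have "((\<lambda>X. \<Phi> X f x) \<longlongrightarrow> f x) U" by (rule tendsto_eventually)
      then show ?thesis using lim[of x] TV tendsto_unique[OF U(2)] by metis
    qed
    then have "restrict (T f) E = restrict F E" using Ff by (intro restrict_ext) simp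
    then have "restrict (T f) E = f" using F(2) by simp
    then show ?thesis using lim sob g(3) TV by simp
  qed
  have "linear_on_trace_space m p E T"
    unfolding linear_on_trace_space_def
  proof (intro conjI ballI allI)
    fix f h assume "f \<in> trace_space m p E" "h \<in> trace_space m p E"
    then obtain F H where F: "F \<in> sobolev m p" "restrict F E = f" and H: "H \<in> sobolev m p" "restrict H E = h"
      by (auto simp: trace_space_def)
    show "T (\<lambda>x\<in>E. f x + h x) = (\<lambda>x. T f x + T h x)"
    proof
      fix x
      have "((\<lambda>X. \<Phi> X f x + \<Phi> X h x) \<longlongrightarrow> T f x + T h x) U"
        using ext[OF F] ext[OF H] by (intro tendsto_add) auto
      moreover have "eventually (\<lambda>X. \<Phi> X f x + \<Phi> X h x = \<Phi> X (\<lambda>x\<in>E. f x + h x) x) U"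
        using ev
      proof eventually_elim
        case (elim X)
        then have op: "extension_operator m K X (\<Phi> X)" by blast
        \<comment> \<open>The two arguments may differ outside \<open>E\<close>, where the
          restricted sum is \<open>undefined\<close>; only the values on \<open>X\<close>, a subset
          of \<open>E\<close>, count.\<close>
        have "\<Phi> X (\<lambda>x\<in>E. f x + h x) = \<Phi> X (\<lambda>x. f x + h x)"
          using elim by (intro extension_operator_cong[OF op]) auto
        also have "\<dots> = (\<lambda>x. \<Phi> X f x + \<Phi> X h x)"
          by (rule extension_operator_add[OF op])
        finally show ?case by simp
      qed
      ultimately have "((\<lambda>X. \<Phi> X (\<lambda>x\<in>E. f x + h x) x) \<longlongrightarrow> T f x + T h x) U"
        by (rule Lim_transform_eventually)
      then show "T (\<lambda>x\<in>E. f x + h x) x = T f x + T h x"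
        unfolding T_def[of "\<lambda>x\<in>E. f x + h x"] by (rule tendsto_Lim[OF U(2)])
    qed
  next
    fix c f assume "f \<in> trace_space m p E"
    then obtain F where F: "F \<in> sobolev m p" "restrict F E = f" by (auto simp: trace_space_def)
    show "T (\<lambda>x\<in>E. c * f x) = (\<lambda>x. c * T f x)"
    proof
      fix x
      have "((\<lambda>X. c * \<Phi> X f x) \<longlongrightarrow> c * T f x) U"
        using ext[OF F] by (intro tendsto_mult_left) auto
      moreover have "eventually (\<lambda>X. c * \<Phi> X f x = \<Phi> X (\<lambda>x\<in>E. c * f x) x) U"
        using ev
      proof eventually_elim
        case (elim X)
        then have op: "extension_operator m K X (\<Phi> X)" by blast
        have "\<Phi> X (\<lambda>x\<in>E. c * f x) = \<Phi> X (\<lambda>x. c * f x)"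
          using elim by (intro extension_operator_cong[OF op]) auto
        also have "\<dots> = (\<lambda>x. c * \<Phi> X f x)"
          by (rule extension_operator_cmult[OF op])
        finally show ?case by simp
      qed
      ultimately have "((\<lambda>X. \<Phi> X (\<lambda>x\<in>E. c * f x) x) \<longlongrightarrow> c * T f x) U"
        by (rule Lim_transform_eventually)
      then show "T (\<lambda>x\<in>E. c * f x) x = c * T f x"
        unfolding T_def[of "\<lambda>x\<in>E. c * f x"] by (rule tendsto_Lim[OF U(2)])
    qed
  qed
  then show ?thesis using ext unfolding trace_extension_def by blast
qed

text \<open>The interpolating polynomial has degree less than \<open>m\<close>, so its seminorm is 0
  and every nonnegative constant will do.\<close>

lemma trace_extension_few_points:
  assumes m: "m \<ge> 1" and p: "p > 1" and C: "C \<ge> 0" and E: "finite E" "card E < m"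
  shows "\<exists>T. trace_extension m p E C T"
proof -
  define T where "T f = poly (lagrange E f)" for f
  have T_cong: "T f = T h" if "\<And>x. x \<in> E \<Longrightarrow> f x = h x" for f h
    using lagrange_cong[of E f h] that by (simp add: T_def)
  have "linear_on_trace_space m p E T"
    unfolding linear_on_trace_space_def
  proof (intro conjI ballI allI)
    fix f h
    have "T (\<lambda>x\<in>E. f x + h x) = T (\<lambda>x. f x + h x)" by (rule T_cong) simp
    then show "T (\<lambda>x\<in>E. f x + h x) = (\<lambda>x. T f x + T h x)" by (simp add: T_def lagrange_add fun_eq_iff)
  next
    fix c f
    have "T (\<lambda>x\<in>E. c * f x) = T (\<lambda>x. c * f x)" by (rule T_cong) simp
    then show "T (\<lambda>x\<in>E. c * f x) = (\<lambda>x. c * T f x)" by (simp add: T_def lagrange_cmult fun_eq_iff)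
  qed
  moreover have "T f \<in> sobolev m p \<and> sobolev_seminorm m p (T f) = 0" for f
  proof -
    have deg: "degree (lagrange E f) < m" using degree_lagrange[OF E(1), of f] E(2) m by linarith
    have "(deriv ^^ m) (T f) = (\<lambda>x. 0)"
      using poly_higher_pderiv_degree_le[of "lagrange E f" m] deg
      by (simp add: T_def funpow_deriv_poly fun_eq_iff coeff_eq_0)
    then have pr: "primitive (\<lambda>x. 0) ((deriv ^^ (m - 1)) (T f))"
      using smooth_primitive_deriv[OF smooth_poly m, of "lagrange E f"] by (simp add: T_def)
    have "(\<lambda>x. 0) \<in> Lp p" by (simp add: Lp_def)
    moreover have "((deriv ^^ k) (T f) has_real_derivative (deriv ^^ Suc k) (T f) x) (at x)" for k x
      unfolding T_def by (rule smooth_funpow_has_deriv[OF smooth_poly])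
    ultimately show ?thesis
      using sobolev_from_jet[of m "\<lambda>k. (deriv ^^ k) (T f)" "\<lambda>x. 0" p] p pr
      by (simp add: Lp_norm_def del: funpow.simps)
  qed
  moreover have "restrict (T f) E = f" if "restrict F E = f" for F f
  proof -
    have "restrict (T f) E = restrict F E"
      using that poly_lagrange[OF E(1)] by (intro restrict_ext) (auto simp: T_def)
    then show ?thesis using that by simp
  qed
  moreover have "C * sobolev_seminorm m p F \<ge> 0" for F
    using C by (simp add: sobolev_seminorm_def Lp_norm_def)
  ultimately have "trace_extension m p E C T" unfolding trace_extension_def by auto
  then show ?thesis by blast
qed

theorem theorem1p5:
  fixes m :: nat
  assumes "m \<ge> 1"
  shows "\<exists>C::real. \<forall>E::real set. \<forall>p::real. closed E \<longrightarrow> p > 1 \<longrightarrow>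
           (\<exists>T. T \<in> trace_space m p E \<rightarrow> sobolev m p \<and>
                linear_on_trace_space m p E T \<and>
                (\<forall>f \<in> trace_space m p E.
                   restrict (T f) E = f \<and>
                   sobolev_seminorm m p (T f) \<le> C * trace_seminorm m p E f))"
proof -
  obtain K where K: "K \<ge> 0" "\<And>X. finite X \<Longrightarrow> card X \<ge> m \<Longrightarrow> \<exists>\<Phi>. extension_operator m K X \<Phi>"
    using extension_operators_exist[OF assms] by blast
  have T_ex: "\<exists>T. trace_extension m p E (2 * K) T" if p: "p > 1" for E p
  proof (cases "finite E \<and> card E < m")
    case True
    then show ?thesis using trace_extension_few_points[OF assms p, of "2 * K" E] K(1) by simp
  next
    case False
    then obtain Z where "finite Z" "card Z = m" "Z \<subseteq> E"
      by (metis infinite_arbitrarily_large not_less obtain_subset_with_card_n)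
    then show ?thesis using trace_extension_many_points[OF assms K(1) p K(2)] by blast
  qed
  show ?thesis
  \<comment> \<open>The summand 1 makes the constant positive, so that it can be divided out before
    the infimum is taken.\<close>
  proof (intro exI[of _ "2 * K + 1"] allI impI)
    fix E :: "real set" and p :: real assume "p > 1"
    then obtain T where T: "trace_extension m p E (2 * K) T" using T_ex by blast
    have nonneg: "sobolev_seminorm m p F \<ge> 0" for F by (simp add: sobolev_seminorm_def Lp_norm_def)
    have "T f \<in> sobolev m p \<and> restrict (T f) E = f \<and>
        sobolev_seminorm m p (T f) \<le> (2 * K + 1) * trace_seminorm m p E f" if f: "f \<in> trace_space m p E" for f
    proof -
      let ?S = "{sobolev_seminorm m p F | F. F \<in> sobolev m p \<and> restrict F E = f}"
      obtain F where F: "F \<in> sobolev m p" "restrict F E = f" using f by (auto simp: trace_space_def)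
      have "sobolev_seminorm m p (T f) / (2 * K + 1) \<le> Inf ?S"
      proof (rule cInf_greatest)
        show "?S \<noteq> {}" using F by blast
        fix s assume "s \<in> ?S"
        then obtain H where H: "s = sobolev_seminorm m p H" "H \<in> sobolev m p" "restrict H E = f" by blast
        then have "sobolev_seminorm m p (T f) \<le> 2 * K * s" using T by (auto simp: trace_extension_def)
        also have "\<dots> \<le> (2 * K + 1) * s" using nonneg H(1) by (intro mult_right_mono) auto
        finally show "sobolev_seminorm m p (T f) / (2 * K + 1) \<le> s" using K(1) by (simp add: field_simps)
      qed
      then have "sobolev_seminorm m p (T f) \<le> (2 * K + 1) * trace_seminorm m p E f"
        using K(1) by (simp add: trace_seminorm_def field_simps)
      then show ?thesis using T F by (auto simp: trace_extension_def)
    qed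
    then show "\<exists>T. T \<in> trace_space m p E \<rightarrow> sobolev m p \<and>
                linear_on_trace_space m p E T \<and>
                (\<forall>f \<in> trace_space m p E.
                   restrict (T f) E = f \<and>
                   sobolev_seminorm m p (T f) \<le> (2 * K + 1) * trace_seminorm m p E f)"
      using T by (intro exI[of _ T]) (auto simp: trace_extension_def)
  qed
qed

end
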